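(* Let $G$ be a $4$-dimensional simply connected Lie group endowed with a left-invariant complex structure $J$ and a left-invariant $J$-Hermitian static metric $g$, with constant $\lambda$. Then one of the following cases occurs: \begin{itemize} \item $(G,J,g)$ is Kähler–Einstein; \item the Lie algebra $\mathfrak{g}$ of $G$ is isomorphic to $\mathfrak{su}(2)\times\mathbb{R}$ and $\lambda=0$. \end{itemize}
   Context: Let $(M,J)$ be a complex manifold of real dimension $2n$ and $g$ a Hermitian metric on it, with fundamental form $\omega(\cdot,\cdot)=g(\cdot,J\cdot)$. The Bismut connection $\nabla^B$ is the unique connection with $\nabla^B J=\nabla^B g=0$ such that, with $T^B$ its torsion, $c(X,Y,Z)=g(X,T^B(Y,Z))$ is totally skew-symmetric. The metric $g$ is SKT if $dc=0$, equivalently $\partial\overline{\partial}\omega=0$. With the curvature convention $R^B(X,Y)Z=\nabla^B_{[X,Y]}Z-[\nabla^B_X,\nabla^B_Y]Z$, the Bismut Ricci form is $\rho^B(X,Y)=\frac12\sum_{k=1}^{2n}g(R^B(X,Y)\mathbf{e}_k,J\mathbf{e}_k)$, where $\{\mathbf{e}_k\}$ is a local $g$-orthonormal frame of $TM$; $(\rho^B)^{(1,1)}$ denotes its $(1,1)$-part with respect to $J$. The metric $g$ is called static (with constant $\lambda$) if it is SKT and $-(\rho^B)^{(1,1)}=\lambda\,\omega$ for some real constant $\lambda$. Kähler–Einstein means that $g$ is Kähler ($d\omega=0$) and its Ricci form is a real constant (possibly zero) multiple of $\omega$. *)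

theory Defs
  imports "HOL-Analysis.Analysis" "HOL-Library.Function_Algebras"
begin

section \<open>Smooth manifolds\<close>

text \<open>For open \<^term>\<open>S\<close> in a Euclidean space, \<open>Ck_on k S f\<close> says that all iterated directional
  derivatives of \<^term>\<open>f\<close> up to order \<^term>\<open>k\<close> exist and are continuous on \<^term>\<open>S\<close>.\<close>

primrec Ck_on :: "nat \<Rightarrow> 'e set \<Rightarrow> ('e::euclidean_space \<Rightarrow> 'f::real_normed_vector) \<Rightarrow> bool" where
  "Ck_on 0 S f \<longleftrightarrow> continuous_on S f"
| "Ck_on (Suc k) S f \<longleftrightarrow>
     (\<forall>x\<in>S. f differentiable (at x)) \<and> (\<forall>v. Ck_on k S (\<lambda>x. frechet_derivative f (at x) v))"

definition smooth_on :: "'e set \<Rightarrow> ('e::euclidean_space \<Rightarrow> 'f::real_normed_vector) \<Rightarrow> bool" where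
  "smooth_on S f \<longleftrightarrow> (\<forall>k. Ck_on k S f)"

text \<open>A chart is a pair of its domain and its coordinate map; only the values of the coordinate map
  on the domain matter. The underlying set of a manifold is the whole type, and the (automatically
  constant) dimension is \<open>DIM('e)\<close>.\<close>

type_synonym ('a, 'e) chart = "'a set \<times> ('a \<Rightarrow> 'e)"

definition smooth_atlas ::
  "('a::{t2_space,second_countable_topology}, 'e::euclidean_space) chart set \<Rightarrow> bool" where
  "smooth_atlas A \<longleftrightarrow>
     (\<Union>(U, \<phi>)\<in>A. U) = UNIV \<and>
     (\<forall>(U, \<phi>)\<in>A. open U \<and> open (\<phi> ` U) \<and> homeomorphism U (\<phi> ` U) \<phi> (inv_into U \<phi>)) \<and>
     (\<forall>(U, \<phi>)\<in>A. \<forall>(V, \<psi>)\<in>A. smooth_on (\<phi> ` (U \<inter> V)) (\<psi> \<circ> inv_into U \<phi>))"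

definition prod_atlas ::
  "('a, 'e) chart set \<Rightarrow> ('b, 'f) chart set \<Rightarrow> ('a \<times> 'b, 'e \<times> 'f) chart set" where
  "prod_atlas A B = {(U \<times> V, map_prod \<phi> \<psi>) | U \<phi> V \<psi>. (U, \<phi>) \<in> A \<and> (V, \<psi>) \<in> B}"

definition smooth_map ::
  "('a::topological_space, 'e::euclidean_space) chart set \<Rightarrow>
   ('b::topological_space, 'f::euclidean_space) chart set \<Rightarrow> ('a \<Rightarrow> 'b) \<Rightarrow> bool" where
  "smooth_map A B F \<longleftrightarrow> continuous_on UNIV F \<and>
     (\<forall>(U, \<phi>)\<in>A. \<forall>(V, \<psi>)\<in>B. smooth_on (\<phi> ` (U \<inter> F -` V)) (\<psi> \<circ> F \<circ> inv_into U \<phi>))"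

definition smooth_functions :: "('a, 'e::euclidean_space) chart set \<Rightarrow> ('a \<Rightarrow> real) set" where
  "smooth_functions A = {f. \<forall>(U, \<phi>)\<in>A. smooth_on (\<phi> ` U) (f \<circ> inv_into U \<phi>)}"


section \<open>Vector fields and forms\<close>

text \<open>Smooth vector fields are the derivations of the algebra of smooth functions, made extensional
  by the value \<open>0\<close> on non-smooth arguments; \<open>X f p\<close> is the derivative of \<^term>\<open>f\<close> at \<^term>\<open>p\<close> along
  \<^term>\<open>X\<close>. Addition, subtraction, negation and the product of functions are pointwise.\<close>

type_synonym 'a vfield = "('a \<Rightarrow> real) \<Rightarrow> ('a \<Rightarrow> real)"

definition vector_fields :: "('a, 'e::euclidean_space) chart set \<Rightarrow> 'a vfield set" where
  "vector_fields A = {X.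
     (\<forall>f. f \<notin> smooth_functions A \<longrightarrow> X f = 0) \<and>
     (\<forall>f\<in>smooth_functions A. X f \<in> smooth_functions A) \<and>
     (\<forall>f\<in>smooth_functions A. \<forall>h\<in>smooth_functions A.
        X (f + h) = X f + X h \<and> X (f * h) = f * X h + h * X f) \<and>
     (\<forall>c. \<forall>f\<in>smooth_functions A. X (\<lambda>p. c * f p) = (\<lambda>p. c * X f p))}"

definition fscale :: "('a \<Rightarrow> real) \<Rightarrow> 'a vfield \<Rightarrow> 'a vfield"  (infixr \<open>\<odot>\<close> 75) where
  "h \<odot> X = (\<lambda>f. h * X f)"

definition lie_bracket :: "'a vfield \<Rightarrow> 'a vfield \<Rightarrow> 'a vfield" where
  "lie_bracket X Y = (\<lambda>f. X (Y f) - Y (X f))"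

text \<open>Tensor fields are represented by the \<open>C\<^sup>\<infinity>\<close>-multilinear maps they induce on vector fields.
  The exterior derivatives of a 2-form and of a 3-form are given by the invariant (Cartan) formula,
  without a combinatorial normalising factor.\<close>

type_synonym 'a form2 = "'a vfield \<Rightarrow> 'a vfield \<Rightarrow> ('a \<Rightarrow> real)"
type_synonym 'a form3 = "'a vfield \<Rightarrow> 'a vfield \<Rightarrow> 'a vfield \<Rightarrow> ('a \<Rightarrow> real)"

definition ext_deriv2 :: "'a form2 \<Rightarrow> 'a form3" where
  "ext_deriv2 \<omega> X Y Z =
     X (\<omega> Y Z) - Y (\<omega> X Z) + Z (\<omega> X Y)
     - \<omega> (lie_bracket X Y) Z + \<omega> (lie_bracket X Z) Y - \<omega> (lie_bracket Y Z) X"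

definition ext_deriv3 ::
  "'a form3 \<Rightarrow> 'a vfield \<Rightarrow> 'a vfield \<Rightarrow> 'a vfield \<Rightarrow> 'a vfield \<Rightarrow> ('a \<Rightarrow> real)" where
  "ext_deriv3 c W X Y Z =
     W (c X Y Z) - X (c W Y Z) + Y (c W X Z) - Z (c W X Y)
     - c (lie_bracket W X) Y Z + c (lie_bracket W Y) X Z - c (lie_bracket W Z) X Y
     - c (lie_bracket X Y) W Z + c (lie_bracket X Z) W Y - c (lie_bracket Y Z) W X"


section \<open>Complex structures, metrics, connections\<close>

definition almost_complex_structure ::
  "('a, 'e::euclidean_space) chart set \<Rightarrow> ('a vfield \<Rightarrow> 'a vfield) \<Rightarrow> bool" where
  "almost_complex_structure A J \<longleftrightarrow>
     (\<forall>X\<in>vector_fields A. J X \<in> vector_fields A \<and> J (J X) = - X) \<and>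
     (\<forall>X\<in>vector_fields A. \<forall>Y\<in>vector_fields A. J (X + Y) = J X + J Y) \<and>
     (\<forall>h\<in>smooth_functions A. \<forall>X\<in>vector_fields A. J (h \<odot> X) = h \<odot> J X)"

text \<open>A complex structure is an integrable almost complex structure, i.e. one whose Nijenhuis
  tensor vanishes.\<close>

definition complex_structure ::
  "('a, 'e::euclidean_space) chart set \<Rightarrow> ('a vfield \<Rightarrow> 'a vfield) \<Rightarrow> bool" where
  "complex_structure A J \<longleftrightarrow> almost_complex_structure A J \<and>
     (\<forall>X\<in>vector_fields A. \<forall>Y\<in>vector_fields A.
        lie_bracket (J X) (J Y) - J (lie_bracket (J X) Y) - J (lie_bracket X (J Y))
          - lie_bracket X Y = 0)"

definition riemannian_metric :: "('a, 'e::euclidean_space) chart set \<Rightarrow> 'a form2 \<Rightarrow> bool" where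
  "riemannian_metric A g \<longleftrightarrow>
     (\<forall>X\<in>vector_fields A. \<forall>Y\<in>vector_fields A. g X Y \<in> smooth_functions A \<and> g X Y = g Y X) \<and>
     (\<forall>X\<in>vector_fields A. \<forall>Y\<in>vector_fields A. \<forall>Z\<in>vector_fields A. g (X + Y) Z = g X Z + g Y Z) \<and>
     (\<forall>h\<in>smooth_functions A. \<forall>X\<in>vector_fields A. \<forall>Y\<in>vector_fields A.
        g (h \<odot> X) Y = h * g X Y) \<and>
     (\<forall>X\<in>vector_fields A. \<forall>p. (\<exists>f. X f p \<noteq> 0) \<longrightarrow> g X X p > 0)"

definition hermitian_metric ::
  "('a, 'e::euclidean_space) chart set \<Rightarrow> ('a vfield \<Rightarrow> 'a vfield) \<Rightarrow> 'a form2 \<Rightarrow> bool" where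
  "hermitian_metric A J g \<longleftrightarrow> riemannian_metric A g \<and>
     (\<forall>X\<in>vector_fields A. \<forall>Y\<in>vector_fields A. g (J X) (J Y) = g X Y)"

definition fundamental_form :: "('a vfield \<Rightarrow> 'a vfield) \<Rightarrow> 'a form2 \<Rightarrow> 'a form2" where
  "fundamental_form J g X Y = g X (J Y)"

text \<open>A connection \<^term>\<open>D\<close> is written \<open>D X Y\<close> for the covariant derivative of \<^term>\<open>Y\<close> along
  \<^term>\<open>X\<close>.\<close>

definition connection ::
  "('a, 'e::euclidean_space) chart set \<Rightarrow> ('a vfield \<Rightarrow> 'a vfield \<Rightarrow> 'a vfield) \<Rightarrow> bool" where
  "connection A D \<longleftrightarrow>
     (\<forall>X\<in>vector_fields A. \<forall>Y\<in>vector_fields A. D X Y \<in> vector_fields A) \<and>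
     (\<forall>X\<in>vector_fields A. \<forall>Y\<in>vector_fields A. \<forall>Z\<in>vector_fields A.
        D (X + Y) Z = D X Z + D Y Z \<and> D X (Y + Z) = D X Y + D X Z) \<and>
     (\<forall>h\<in>smooth_functions A. \<forall>X\<in>vector_fields A. \<forall>Y\<in>vector_fields A.
        D (h \<odot> X) Y = h \<odot> D X Y \<and> D X (h \<odot> Y) = X h \<odot> Y + h \<odot> D X Y)"

definition metric_connection ::
  "('a, 'e::euclidean_space) chart set \<Rightarrow> 'a form2 \<Rightarrow>
   ('a vfield \<Rightarrow> 'a vfield \<Rightarrow> 'a vfield) \<Rightarrow> bool" where
  "metric_connection A g D \<longleftrightarrow> connection A D \<and>
     (\<forall>X\<in>vector_fields A. \<forall>Y\<in>vector_fields A. \<forall>Z\<in>vector_fields A.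
        X (g Y Z) = g (D X Y) Z + g Y (D X Z))"

definition torsion ::
  "('a vfield \<Rightarrow> 'a vfield \<Rightarrow> 'a vfield) \<Rightarrow> 'a vfield \<Rightarrow> 'a vfield \<Rightarrow> 'a vfield" where
  "torsion D X Y = D X Y - D Y X - lie_bracket X Y"

definition torsion_form ::
  "'a form2 \<Rightarrow> ('a vfield \<Rightarrow> 'a vfield \<Rightarrow> 'a vfield) \<Rightarrow> 'a form3" where
  "torsion_form g D X Y Z = g X (torsion D Y Z)"

definition levi_civita_connection ::
  "('a, 'e::euclidean_space) chart set \<Rightarrow> 'a form2 \<Rightarrow>
   ('a vfield \<Rightarrow> 'a vfield \<Rightarrow> 'a vfield) \<Rightarrow> bool" where
  "levi_civita_connection A g D \<longleftrightarrow> metric_connection A g D \<and>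
     (\<forall>X\<in>vector_fields A. \<forall>Y\<in>vector_fields A. torsion D X Y = 0)"

definition bismut_connection ::
  "('a, 'e::euclidean_space) chart set \<Rightarrow> ('a vfield \<Rightarrow> 'a vfield) \<Rightarrow> 'a form2 \<Rightarrow>
   ('a vfield \<Rightarrow> 'a vfield \<Rightarrow> 'a vfield) \<Rightarrow> bool" where
  "bismut_connection A J g D \<longleftrightarrow> metric_connection A g D \<and>
     (\<forall>X\<in>vector_fields A. \<forall>Y\<in>vector_fields A. D X (J Y) = J (D X Y)) \<and>
     (\<forall>X\<in>vector_fields A. \<forall>Y\<in>vector_fields A. \<forall>Z\<in>vector_fields A.
        torsion_form g D Y X Z = - torsion_form g D X Y Z \<and>
        torsion_form g D X Z Y = - torsion_form g D X Y Z)"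


section \<open>Ricci forms, static and Kaehler--Einstein metrics\<close>

text \<open>Note the sign: this is the negative of the more common curvature convention.\<close>

definition curvature ::
  "('a vfield \<Rightarrow> 'a vfield \<Rightarrow> 'a vfield) \<Rightarrow> 'a vfield \<Rightarrow> 'a vfield \<Rightarrow> 'a vfield \<Rightarrow> 'a vfield" where
  "curvature D X Y Z = D (lie_bracket X Y) Z - (D X (D Y Z) - D Y (D X Z))"

text \<open>A local orthonormal frame around \<^term>\<open>p\<close> is given by globally defined vector fields that are
  orthonormal on a neighbourhood of \<^term>\<open>p\<close>; by means of bump functions every local frame is of this
  form after shrinking its domain.\<close>

definition local_orthonormal_frame ::
  "('a::topological_space, 'e::euclidean_space) chart set \<Rightarrow> 'a form2 \<Rightarrow> 'a \<Rightarrow>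
   (nat \<Rightarrow> 'a vfield) \<Rightarrow> bool" where
  "local_orthonormal_frame A g p E \<longleftrightarrow>
     (\<forall>k<DIM('e). E k \<in> vector_fields A) \<and>
     (\<exists>U. open U \<and> p \<in> U \<and>
        (\<forall>q\<in>U. \<forall>i<DIM('e). \<forall>j<DIM('e). g (E i) (E j) q = (if i = j then 1 else 0)))"

text \<open>The value of the Ricci form at \<^term>\<open>p\<close> does not depend on the frame that is chosen there.\<close>

definition ricci_form ::
  "('a::topological_space, 'e::euclidean_space) chart set \<Rightarrow> ('a vfield \<Rightarrow> 'a vfield) \<Rightarrow> 'a form2 \<Rightarrow>
   ('a vfield \<Rightarrow> 'a vfield \<Rightarrow> 'a vfield) \<Rightarrow> 'a form2" where
  "ricci_form A J g D X Y p =
     (let E = (SOME E. local_orthonormal_frame A g p E)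
      in (1 / 2) * (\<Sum>k<DIM('e). g (curvature D X Y (E k)) (J (E k)) p))"

text \<open>The (1,1)-part of a real 2-form is its \<^term>\<open>J\<close>-invariant part: on the complexified tangent
  bundle \<open>\<rho>(J X, J Y)\<close> equals \<open>\<rho>(X, Y)\<close> for \<open>\<rho>\<close> of type (1,1) and \<open>-\<rho>(X, Y)\<close> for \<open>\<rho>\<close> of type
  (2,0) or (0,2).\<close>

definition part11 :: "('a vfield \<Rightarrow> 'a vfield) \<Rightarrow> 'a form2 \<Rightarrow> 'a form2" where
  "part11 J \<rho> X Y p = (\<rho> X Y p + \<rho> (J X) (J Y) p) / 2"

definition SKT ::
  "('a, 'e::euclidean_space) chart set \<Rightarrow> ('a vfield \<Rightarrow> 'a vfield) \<Rightarrow> 'a form2 \<Rightarrow> bool" where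
  "SKT A J g \<longleftrightarrow> (\<exists>D. bismut_connection A J g D \<and>
     (\<forall>W\<in>vector_fields A. \<forall>X\<in>vector_fields A. \<forall>Y\<in>vector_fields A. \<forall>Z\<in>vector_fields A.
        ext_deriv3 (torsion_form g D) W X Y Z = 0))"

definition static_metric ::
  "('a::topological_space, 'e::euclidean_space) chart set \<Rightarrow> ('a vfield \<Rightarrow> 'a vfield) \<Rightarrow> 'a form2 \<Rightarrow>
   real \<Rightarrow> bool" where
  "static_metric A J g lam \<longleftrightarrow> SKT A J g \<and>
     (\<exists>D. bismut_connection A J g D \<and>
        (\<forall>X\<in>vector_fields A. \<forall>Y\<in>vector_fields A. \<forall>p.
           - part11 J (ricci_form A J g D) X Y p = lam * fundamental_form J g X Y p))"

definition kaehler ::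
  "('a, 'e::euclidean_space) chart set \<Rightarrow> ('a vfield \<Rightarrow> 'a vfield) \<Rightarrow> 'a form2 \<Rightarrow> bool" where
  "kaehler A J g \<longleftrightarrow> complex_structure A J \<and> hermitian_metric A J g \<and>
     (\<forall>X\<in>vector_fields A. \<forall>Y\<in>vector_fields A. \<forall>Z\<in>vector_fields A.
        ext_deriv2 (fundamental_form J g) X Y Z = 0)"

text \<open>The Ricci form of a Kaehler metric is that of its Levi-Civita connection.\<close>

definition kaehler_einstein ::
  "('a::topological_space, 'e::euclidean_space) chart set \<Rightarrow> ('a vfield \<Rightarrow> 'a vfield) \<Rightarrow> 'a form2 \<Rightarrow>
   bool" where
  "kaehler_einstein A J g \<longleftrightarrow> kaehler A J g \<and>
     (\<exists>D \<mu>. levi_civita_connection A g D \<and>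
        (\<forall>X\<in>vector_fields A. \<forall>Y\<in>vector_fields A. \<forall>p.
           ricci_form A J g D X Y p = \<mu> * fundamental_form J g X Y p))"


section \<open>Lie groups\<close>

text \<open>The group operation is written additively, following the type class \<^class>\<open>group_add\<close>, which
  does not assume commutativity.\<close>

definition lie_group ::
  "('a::{group_add,t2_space,second_countable_topology}, 'e::euclidean_space) chart set \<Rightarrow> bool" where
  "lie_group A \<longleftrightarrow> smooth_atlas A \<and>
     smooth_map (prod_atlas A A) A (\<lambda>(a, b). a + b) \<and> smooth_map A A uminus"

text \<open>The push-forward of a vector field by the left translation \<open>b \<mapsto> a + b\<close>.\<close>

definition left_push ::
  "('a::group_add, 'e::euclidean_space) chart set \<Rightarrow> 'a \<Rightarrow> 'a vfield \<Rightarrow> 'a vfield" where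
  "left_push A a X =
     (\<lambda>f. if f \<in> smooth_functions A then (\<lambda>b. X (\<lambda>x. f (a + x)) (- a + b)) else 0)"

definition left_invariant_endo ::
  "('a::group_add, 'e::euclidean_space) chart set \<Rightarrow> ('a vfield \<Rightarrow> 'a vfield) \<Rightarrow> bool" where
  "left_invariant_endo A J \<longleftrightarrow>
     (\<forall>a. \<forall>X\<in>vector_fields A. J (left_push A a X) = left_push A a (J X))"

definition left_invariant_metric ::
  "('a::group_add, 'e::euclidean_space) chart set \<Rightarrow> 'a form2 \<Rightarrow> bool" where
  "left_invariant_metric A g \<longleftrightarrow>
     (\<forall>a b. \<forall>X\<in>vector_fields A. \<forall>Y\<in>vector_fields A.
        g (left_push A a X) (left_push A a Y) (a + b) = g X Y b)"

definition lie_algebra_of ::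
  "('a::group_add, 'e::euclidean_space) chart set \<Rightarrow> 'a vfield set" where
  "lie_algebra_of A = {X \<in> vector_fields A. \<forall>a. left_push A a X = X}"

definition su2 :: "(complex^2^2) set" where
  "su2 = {M. (\<chi> i j. cnj (M $ j $ i)) = - M \<and> trace M = 0}"

definition lie_algebra_isomorphic_su2_R ::
  "('a::group_add, 'e::euclidean_space) chart set \<Rightarrow> bool" where
  "lie_algebra_isomorphic_su2_R A \<longleftrightarrow>
     (\<exists>\<Phi> :: 'a vfield \<Rightarrow> (complex^2^2) \<times> real.
        bij_betw \<Phi> (lie_algebra_of A) (su2 \<times> UNIV) \<and>
        (\<forall>X\<in>lie_algebra_of A. \<forall>Y\<in>lie_algebra_of A.
           \<Phi> (X + Y) = \<Phi> X + \<Phi> Y \<and>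
           \<Phi> (lie_bracket X Y) =
             (fst (\<Phi> X) ** fst (\<Phi> Y) - fst (\<Phi> Y) ** fst (\<Phi> X), 0)) \<and>
        (\<forall>c. \<forall>X\<in>lie_algebra_of A. \<Phi> ((\<lambda>_. c) \<odot> X) = c *\<^sub>R \<Phi> X))"

end

theory Submission
  imports Defs
begin

text \<open>Let \<open>H\<close> be the torsion 3-form of the Bismut connection, which is determined by the exterior
  derivative of the fundamental form. If \<open>H = 0\<close>, the metric is Kaehler, its Bismut connection is its
  Levi-Civita connection, and the first Bianchi identity makes the Ricci form of type (1,1), so that
  static means Einstein. Otherwise choose a left-invariant unitary frame whose first member \<open>e 0\<close>
  spans the kernel of \<open>H\<close>. Since the Bismut connection has holonomy in the unitary group, its Ricci
  form on left-invariant fields is \<open>\<beta> [X, Y]\<close> for a linear form \<open>\<beta>\<close>, so the Jacobi identity, the SKT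
  and the static condition form a system of quadratic equations for the connection coefficients. SKT
  says that \<open>ad (e 0)\<close> has trace 0, and the Jacobi identity gives the same for \<open>ad (J (e 0))\<close>. If the
  Lie algebra is not unimodular, rotating the remaining two frame members makes the trace form dual to
  \<open>e 2\<close>; it vanishes on brackets, and eliminating variables in the resulting system yields
  a vanishing sum of two squares, one of which is positive. If it is unimodular, a Bochner-type
  identity shows that \<open>e 0\<close> is a Killing field, and the remaining equations force \<open>\<lambda> = 0\<close> and the
  brackets of the Lie algebra of \<open>SU(2) \<times> \<real>\<close>.

  All this takes place on vector fields in the sense of derivations. Hadamard's lemma and bump
  functions show that the derivations at a point are spanned by left-invariant fields, so the
  left-invariant frame is a basis of the module of vector fields.\<close>

section \<open>Algebra of the structure constants\<close>

text \<open>In real dimension four a 3-form is the contraction of the volume form with a vector. The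
  form \<open>tau\<close> belongs to a multiple of \<open>e 0\<close>, and d omega to a multiple of
  \<open>e 1\<close>. For a left-invariant X, the exterior derivative of its contraction with the
  volume form is, up to sign, tr (ad X) times the volume form. This is the source of both trace
  conditions: d tau = 0 concerns \<open>e 0\<close>, and d (d omega) = 0 concerns
  \<open>e 1\<close>. Fixing \<open>e 0\<close> leaves only the rotations of the plane of
  \<open>e 2\<close> and \<open>e 3\<close>, which are used up in normalising the trace form.

  Each elimination is recorded as a certificate, an identity whose right-hand side combines Jacobi
  components and static equations, so that \<open>algebra\<close> only has to check it.

  In the unimodular case the coefficient \<open>f 0\<close> stays free. It measures how
  \<open>e 0\<close> rotates the plane of \<open>e 2\<close> and \<open>e 3\<close>, and it is
  absorbed only in the isomorphism, where adding a multiple of \<open>e 1\<close> to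
  \<open>e 0\<close> gives a central element.\<close>

lemma sum_lessThan_4: "(\<Sum>m<4. h m) = h 0 + h 1 + h 2 + h (3::nat)" for h :: "nat \<Rightarrow> 'a::comm_monoid_add"
  by (simp add: eval_nat_numeral add.assoc)

text \<open>The indices refer to a unitary frame \<open>e 0, J (e 0) = e 1, e 2, J (e 2) = e 3\<close> of a
  four-dimensional Lie algebra with structure constants \<^term>\<open>C\<close>, adapted to the torsion 3-form, which
  is \<^term>\<open>s\<close> times \<open>e\<^sup>1 \<and> e\<^sup>2 \<and> e\<^sup>3\<close>. The one-forms \<^term>\<open>a\<close>, \<^term>\<open>b\<close>, \<^term>\<open>c\<close>, \<^term>\<open>f\<close> are the
  entries of the connection matrix of the Bismut connection, which takes values in the unitary Lie
  algebra: \<open>D e\<^sub>0 = a e\<^sub>1 + b e\<^sub>2 + c e\<^sub>3\<close> and \<open>D e\<^sub>2 = - b e\<^sub>0 + c e\<^sub>1 + f e\<^sub>3\<close>.\<close>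

locale bismut_constants =
  fixes C :: "nat \<Rightarrow> nat \<Rightarrow> nat \<Rightarrow> real" and a b c f :: "nat \<Rightarrow> real" and s :: real
  assumes C_01: "C 0 1 0 = - a 0" "C 0 1 1 = - a 1" "C 0 1 2 = - c 0 - b 1" "C 0 1 3 = b 0 - c 1"
    and C_02: "C 0 2 0 = - b 0" "C 0 2 1 = c 0 - a 2" "C 0 2 2 = - b 2" "C 0 2 3 = f 0 - c 2"
    and C_03: "C 0 3 0 = - c 0" "C 0 3 1 = - b 0 - a 3" "C 0 3 2 = - f 0 - b 3" "C 0 3 3 = - c 3"
    and C_12: "C 1 2 0 = a 2 - b 1" "C 1 2 1 = c 1" "C 1 2 2 = c 2" "C 1 2 3 = f 1 - b 2 - s"
    and C_13: "C 1 3 0 = a 3 - c 1" "C 1 3 1 = - b 1" "C 1 3 2 = c 3 - f 1 + s" "C 1 3 3 = - b 3"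
    and C_23: "C 2 3 0 = b 3 - c 2" "C 2 3 1 = - b 2 - c 3 - s" "C 2 3 2 = - f 2" "C 2 3 3 = - f 3"
    and C_antisym: "C i j k = - C j i k"
    and C_jacobi: "\<And>i j k l. \<lbrakk>i < 4; j < 4; k < 4; l < 4\<rbrakk> \<Longrightarrow>
      (\<Sum>m<4. C i j m * C m k l + C j k m * C m i l + C k i m * C m j l) = 0"
begin

lemma C_diag: "C i i k = 0"
  using C_antisym[of i i k] by linarith

lemmas C_flip = C_antisym[of 1 0] C_antisym[of 2 0] C_antisym[of 3 0] C_antisym[of 2 1]
  C_antisym[of 3 1] C_antisym[of 3 2]

lemmas C_table = C_diag C_flip C_01 C_02 C_03 C_12 C_13 C_23

text \<open>Naming the components of the Jacobi identity lets a certificate be checked with them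
  unfolded and then evaluated with all of them equal to 0.\<close>

definition jac :: "nat \<Rightarrow> nat \<Rightarrow> nat \<Rightarrow> nat \<Rightarrow> real" where
  "jac i j k l = (\<Sum>m<4. C i j m * C m k l + C j k m * C m i l + C k i m * C m j l)"

lemma jac_eq_0 [simp]: "\<lbrakk>i < 4; j < 4; k < 4; l < 4\<rbrakk> \<Longrightarrow> jac i j k l = 0"
  unfolding jac_def by (rule C_jacobi)

text \<open>\<open>a + f\<close> is the trace of the connection form, which takes values in u(2);
  \<open>ricci_trace_const\<close> below identifies its value on brackets with the Bismut Ricci
  form.\<close>

definition ric :: "nat \<Rightarrow> nat \<Rightarrow> real" where
  "ric i j = (\<Sum>k<4. (a k + f k) * C i j k)"

lemmas expand = jac_def ric_def sum_lessThan_4 C_table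

text \<open>The two equations express J-invariance of the antisymmetric form \<open>ric\<close>. For
  \<open>s = 0\<close> the connection is torsion-free, so the Jacobi components encode its first
  Bianchi identity, and the defect of invariance is a sum of them.\<close>

lemma kaehler_ric:
  assumes "s = 0"
  shows "ric 0 2 = ric 1 3" "ric 0 3 = - ric 1 2"
proof -
  have "ric 0 2 - ric 1 3 = jac 1 2 3 3 - jac 0 2 3 2 - jac 0 1 3 1 + jac 0 1 2 0"
    unfolding expand assms by algebra
  then show "ric 0 2 = ric 1 3" by simp
  have "ric 0 3 + ric 1 2 = - jac 1 2 3 2 - jac 0 2 3 3 + jac 0 1 3 0 + jac 0 1 2 1"
    unfolding expand assms by algebra
  then show "ric 0 3 = - ric 1 2" by simp
qed

definition tr_ad :: "nat \<Rightarrow> real" where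
  "tr_ad i = (\<Sum>j<4. C i j j)"

text \<open>The trace of ad [X, Y] is the trace of a commutator. Concretely, set
  \<open>l = k\<close> in the Jacobi identity and sum over \<open>k\<close>: exchanging the two
  summation indices makes the last two terms cancel.\<close>

lemma tr_ad_bracket:
  assumes "i < 4" "j < 4"
  shows "(\<Sum>k<4. tr_ad k * C i j k) = 0"
proof -
  have J: "(\<Sum>k<4. \<Sum>m<4. C i j m * C m k k + C j k m * C m i k + C k i m * C m j k) = 0"
    using assms C_jacobi by simp
  have "(\<Sum>k<4. \<Sum>m<4. C k i m * C m j k) = (\<Sum>k<4. \<Sum>m<4. C m i k * C k j m)"
    by (rule sum.swap)
  also have "\<dots> = - (\<Sum>k<4. \<Sum>m<4. C j k m * C m i k)"
    unfolding sum_negf[symmetric]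
    by (intro sum.cong refl) (simp add: C_antisym[of _ j])
  finally have "(\<Sum>k<4. \<Sum>m<4. C i j m * C m k k) = 0"
    using J by (simp add: sum.distrib)
  also have "(\<Sum>k<4. \<Sum>m<4. C i j m * C m k k) = (\<Sum>m<4. \<Sum>k<4. C i j m * C m k k)"
    by (rule sum.swap)
  finally show ?thesis
    unfolding tr_ad_def by (simp add: sum_distrib_left mult.commute)
qed

text \<open>The combination of Jacobi components is, up to sign, d (d omega) on the whole frame:
  omega pairs \<open>e 0\<close> with \<open>e 1\<close> and \<open>e 2\<close> with
  \<open>e 3\<close>, so the Jacobi sum of \<open>e 1\<close>, \<open>e 2\<close>,
  \<open>e 3\<close> contributes its \<open>e 1\<close> component, and so on. The factor
  \<open>s\<close> is the only coefficient of d omega.\<close>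

lemma tr_ad_1:
  assumes "s \<noteq> 0" "a 1 + b 2 + c 3 = 0"
  shows "tr_ad 1 = 0"
proof -
  have a1: "a 1 = - b 2 - c 3" using assms by linarith
  have "s * tr_ad 1 = - jac 1 2 3 1 - jac 0 1 3 3 - jac 0 1 2 2 - jac 0 2 3 0"
    unfolding tr_ad_def expand a1 by algebra
  then show ?thesis using assms(1) by simp
qed

section \<open>Nonzero torsion: the trace form and the static equations\<close>

context
  assumes s: "s \<noteq> 0" and skt: "a 1 + b 2 + c 3 = 0"
    and static: "ric 0 1 = ric 2 3" "ric 0 2 + ric 1 3 = 0" "ric 0 3 = ric 1 2"
begin

lemma a0: "a 0 = b 3 - c 2"
  using tr_ad_1[OF s skt] unfolding tr_ad_def sum_lessThan_4 C_table by simp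

lemma a1: "a 1 = - b 2 - c 3"
  using skt by linarith

lemma not_unimodular:
  assumes h2: "tr_ad 2 \<noteq> 0" and h3: "tr_ad 3 = 0"
  shows False
proof -
  have h: "tr_ad 0 = 0" "tr_ad 1 = 0"
    using skt tr_ad_1[OF s skt] unfolding tr_ad_def sum_lessThan_4 C_table by auto
  \<comment> \<open>Only the \<open>tr_ad 2\<close> term survives in \<open>tr_ad_bracket\<close>,
    so no bracket has an \<open>e 2\<close> component. Reading this off the table gives linear
    relations.\<close>
  have "C i j 2 = 0" if "i < 4" "j < 4" for i j
    using tr_ad_bracket[OF that] h2 h3 h unfolding sum_lessThan_4 by simp
  from this[of 0 1] this[of 0 2] this[of 0 3] this[of 1 2] this[of 1 3] this[of 2 3]
  have e: "b 1 = - c 0" "b 2 = 0" "f 0 = - b 3" "c 2 = 0" "f 1 = c 3 + s" "f 2 = 0"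
    unfolding C_table by auto
  note e' = a0 a1 e
  \<comment> \<open>The certificate is multiplied by \<open>tr_ad 2\<close>; cancelling this factor
    is where the failure of unimodularity enters. The relation first yields \<open>a 2 = 0\<close>
    and is used again in both branches below.\<close>
  have W: "s * c 0 - (a 3 + f 3) * b 3 = 0"
  proof -
    have "tr_ad 2 * (s * c 0 - (a 3 + f 3) * b 3) = (a 3 + f 3) * jac 0 1 2 0
      + s * jac 0 2 3 0 + b 3 * (ric 0 1 - ric 2 3)
      + (-1/2 * a 3 + 1/2 * b 0 + 1/2 * c 1) * (ric 0 2 + ric 1 3)
      + (1/2 * a 2 + c 0) * (ric 0 3 - ric 1 2)"
      unfolding tr_ad_def expand e' by algebra
    then show ?thesis using h2 static by simp
  qed
  have "s * a 2 = 2 * (s * c 0 - (a 3 + f 3) * b 3) - (ric 0 2 + ric 1 3)"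
    unfolding expand e' by algebra
  then have "s * a 2 = 0" unfolding W static by simp
  then have a2: "a 2 = 0" using s by simp
  have "s * (b 3 * (tr_ad 2 + (a 3 + f 3))) = - ((s + c 3) * jac 0 1 2 0 + b 3 * jac 0 1 2 1
    + (b 0 + c 1) * jac 0 2 3 0 - c 0 * jac 0 2 3 1 - c 0 * jac 1 2 3 0)"
    unfolding tr_ad_def expand e' a2 by algebra
  \<comment> \<open>The second alternative is \<open>tr_ad 2 + (a 3 + f 3) = 0\<close> written out.
    There \<open>a 3 + f 3 = - tr_ad 2\<close>, so the two branches end with the same sum of
    squares.\<close>
  then have "b 3 = 0 \<or> a 3 = - b 0 + c 1"
    using s e' C_table unfolding tr_ad_def sum_lessThan_4 by auto
  then show False
  proof
    assume b3: "b 3 = 0"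
    then have c0: "c 0 = 0" using W s by simp
    have "s * s * (s * s + (a 3 + f 3) * (a 3 + f 3)) = (-2 * a 3 * s - 2 * f 3 * s) * jac 0 1 2 1
      - 2 * s * s * jac 0 2 3 1 + (s * s + 2 * c 3 * s) * (ric 0 1 - ric 2 3)
      + (- a 3 * s - 2 * b 0 * s + f 3 * s) * (ric 0 3 - ric 1 2)"
      unfolding expand e' a2 b3 c0 minus_zero by algebra
    then have "s * s + (a 3 + f 3) * (a 3 + f 3) = 0" using s static by simp
    then show False using s by (simp add: sum_squares_eq_zero_iff)
  next
    assume a3: "a 3 = - b 0 + c 1"
    have "s * s * (s * s + tr_ad 2 * tr_ad 2) = 4 * c 0 * s * (s * c 0 - (a 3 + f 3) * b 3)
      - 2 * b 0 * s * (ric 0 3 - ric 1 2) + s * s * jac 1 2 3 0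
      + (2 * b 0 * s - 2 * c 1 * s - 2 * f 3 * s) * jac 0 2 3 3
      + s * s * jac 0 1 2 3 - s * s * jac 0 2 3 1 + s * s * (ric 0 1 - ric 2 3)"
      unfolding tr_ad_def expand e' a2 a3 by algebra
    then have "s * s + tr_ad 2 * tr_ad 2 = 0" using s static W by simp
    then show False using s by (simp add: sum_squares_eq_zero_iff)
  qed
qed

lemma unimodular:
  assumes h2: "tr_ad 2 = 0" and h3: "tr_ad 3 = 0"
  shows "a 0 = 0" "a 1 = 0" "a 2 = 0" "a 3 = 0" "b 0 = 0" "b 1 = 0" "b 2 = 0" "b 3 = 0"
    "c 0 = 0" "c 1 = 0" "c 2 = 0" "c 3 = 0" "f 1 = 0" "f 2 = 0" "f 3 = 0"
proof -
  have f: "f 3 = b 0 - c 1" "f 2 = - c 0 - b 1"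
    using h2 h3 unfolding tr_ad_def sum_lessThan_4 C_table by auto
  \<comment> \<open>The left-hand side is \<^term>\<open>s\<close> times the squared norm of the Lie derivative of the metric along
    \<open>e 0\<close>. The cofactors were found by linear algebra; their existence reflects the Bochner formula
    for \<open>e 0\<close> combined with the contracted Bianchi identity.\<close>
  have "s * (2 * ((a 0)\<^sup>2 + (b 0)\<^sup>2 + (c 0)\<^sup>2 + (a 2 + b 1)\<^sup>2 + (a 3 + c 1)\<^sup>2 + (b 3 + c 2)\<^sup>2)
      + 4 * ((a 1)\<^sup>2 + (b 2)\<^sup>2 + (c 3)\<^sup>2)) =
    (-4 * b 0 + 4 * c 1 - 4 * a 3) * jac 0 1 2 1
    + (2 * s) * jac 0 1 2 3
    + (-4 * b 1 - 4 * c 0 + 4 * a 2) * jac 0 1 3 1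
    - (2 * s) * jac 0 1 3 2
    + (-4 * b 3 + 4 * c 2 - 4 * f 0) * jac 0 2 3 0
    + (2 * s + 4 * b 2 + 4 * c 3 - 4 * f 1) * jac 0 2 3 1
    + (4 * b 2 + 4 * c 3) * (ric 0 1 - ric 2 3)
    + (-2 * b 1 + 2 * c 0 - 2 * a 2) * (ric 0 2 + ric 1 3)
    + (-2 * b 0 - 2 * c 1 - 2 * a 3) * (ric 0 3 - ric 1 2)"
    unfolding expand a0 a1 f by algebra
  then have "2 * ((a 0)\<^sup>2 + (b 0)\<^sup>2 + (c 0)\<^sup>2 + (a 2 + b 1)\<^sup>2 + (a 3 + c 1)\<^sup>2 + (b 3 + c 2)\<^sup>2)
      + 4 * ((a 1)\<^sup>2 + (b 2)\<^sup>2 + (c 3)\<^sup>2) = 0"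
    using s static by simp
  then have z: "a 0 = 0" "b 0 = 0" "c 0 = 0" "b 2 = 0" "c 3 = 0" "b 1 = - a 2" "c 1 = - a 3"
    and "b 3 + c 2 = 0"
    by (smt (verit) zero_le_power2 power2_eq_square mult_eq_0_iff add_eq_0_iff)+
  with a0 have z': "b 3 = 0" "c 2 = 0" by auto
  note e = a1 f z z'
  \<comment> \<open>Only \<open>a 2\<close>, \<open>a 3\<close>, \<open>f 0\<close>,
    \<open>f 1\<close> and \<open>s\<close> are left, and two Jacobi components have become
    multiples of squares.\<close>
  have "jac 0 1 2 3 = 2 * a 3 * a 3" "jac 0 1 3 2 = - (2 * a 2 * a 2)"
    unfolding expand e minus_zero by algebra+
  then have z'': "a 2 = 0" "a 3 = 0" by auto
  have "s * f 1 = ric 0 1 - ric 2 3"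
    unfolding expand e z'' minus_zero by algebra
  then have "f 1 = 0" using s static by simp
  with e z'' show "a 0 = 0" "a 1 = 0" "a 2 = 0" "a 3 = 0" "b 0 = 0" "b 1 = 0" "b 2 = 0" "b 3 = 0"
    "c 0 = 0" "c 1 = 0" "c 2 = 0" "c 3 = 0" "f 1 = 0" "f 2 = 0" "f 3 = 0"
    by simp_all
qed

end

end

section \<open>Smooth functions on Euclidean spaces\<close>

lemma Ck_on_imp_continuous_on: "Ck_on k S f \<Longrightarrow> continuous_on S f"
  by (cases k) (auto intro: continuous_at_imp_continuous_on differentiable_imp_continuous_within)

lemma Ck_on_SucD: "Ck_on (Suc k) S f \<Longrightarrow> Ck_on k S f"
  by (induction k arbitrary: f) (use Ck_on_imp_continuous_on[of "Suc 0"] in auto)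

lemma Ck_on_subset: "Ck_on k S f \<Longrightarrow> T \<subseteq> S \<Longrightarrow> Ck_on k T f"
  by (induction k arbitrary: f) (auto intro: continuous_on_subset)

lemma Ck_on_cong:
  assumes "open S" "\<And>x. x \<in> S \<Longrightarrow> f x = g x" "Ck_on k S f"
  shows "Ck_on k S g"
  using assms(2,3)
proof (induction k arbitrary: f g)
  case 0
  then show ?case by (metis Ck_on.simps(1) continuous_on_cong)
next
  case (Suc k)
  have "(g has_derivative frechet_derivative f (at x)) (at x)" if "x \<in> S" for x
    using Suc.prems that assms(1)
    by (auto simp: frechet_derivative_works intro: has_derivative_transform_within_open)
  note D = this
  have "g differentiable (at x)" if "x \<in> S" for x
    using D[OF that] by (rule differentiableI)
  moreover have "Ck_on k S (\<lambda>x. frechet_derivative g (at x) v)" for v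
  proof (rule Suc.IH)
    show "frechet_derivative f (at x) v = frechet_derivative g (at x) v" if "x \<in> S" for x
      using frechet_derivative_at[OF D[OF that]] by simp
    show "Ck_on k S (\<lambda>x. frechet_derivative f (at x) v)"
      using Suc.prems by simp
  qed
  ultimately show ?case by simp
qed

text \<open>\<open>Ck_on\<close> speaks of \<open>frechet_derivative\<close>; this form lets the
  closure properties work with an explicit derivative instead.\<close>

lemma Ck_on_SucI:
  assumes "open S" "\<And>x. x \<in> S \<Longrightarrow> (f has_derivative f' x) (at x)" "\<And>v. Ck_on k S (\<lambda>x. f' x v)"
  shows "Ck_on (Suc k) S f"
proof -
  have "Ck_on k S (\<lambda>x. frechet_derivative f (at x) v)" for v
    by (rule Ck_on_cong[OF assms(1) _ assms(3)]) (simp add: frechet_derivative_at[OF assms(2)])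
  then show ?thesis using assms(2) by (auto intro: differentiableI)
qed

lemma Ck_on_local:
  assumes "\<And>x. x \<in> S \<Longrightarrow> \<exists>T. open T \<and> x \<in> T \<and> Ck_on k T f"
  shows "Ck_on k S f"
  using assms
proof (induction k arbitrary: f)
  case 0
  then have "isCont f x" if "x \<in> S" for x
    using that by (metis Ck_on.simps(1) continuous_on_eq_continuous_at)
  then show ?case by (simp add: continuous_at_imp_continuous_on)
next
  case (Suc k)
  show ?case
    unfolding Ck_on.simps
  proof (intro conjI ballI allI Suc.IH)
    show "f differentiable at x" if "x \<in> S" for x using Suc.prems[OF that] by auto
    show "\<exists>T. open T \<and> x \<in> T \<and> Ck_on k T (\<lambda>x. frechet_derivative f (at x) v)" if "x \<in> S" for v x
      using Suc.prems[OF that] by auto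
  qed
qed

lemma Ck_on_frechet:
  assumes "Ck_on (Suc k) S f" "x \<in> S"
  shows "(f has_derivative frechet_derivative f (at x)) (at x)"
  using assms by (auto simp: frechet_derivative_works)

lemma Ck_on_const: "open S \<Longrightarrow> Ck_on k S (\<lambda>x. c)"
proof (induction k arbitrary: c)
  case (Suc k)
  show ?case
    by (rule Ck_on_SucI[where f' = "\<lambda>x v. 0"]) (use Suc in auto)
qed auto

lemma Ck_on_linear:
  assumes "bounded_linear L" "open S" "Ck_on k S f"
  shows "Ck_on k S (\<lambda>x. L (f x))"
  using assms(3)
proof (induction k arbitrary: f)
  case 0
  then show ?case by (simp add: bounded_linear.continuous_on[OF assms(1)])
next
  case (Suc k)
  show ?case
    by (rule Ck_on_SucI[where f' = "\<lambda>x v. L (frechet_derivative f (at x) v)"])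
      (use Suc assms in \<open>auto intro: bounded_linear.has_derivative[OF assms(1) Ck_on_frechet]\<close>)
qed

lemma Ck_on_ident: "open S \<Longrightarrow> Ck_on k S (\<lambda>x. x)"
proof (cases k)
  case (Suc m)
  assume "open S"
  then show ?thesis unfolding Suc
    by (intro Ck_on_SucI[where f' = "\<lambda>x v. v"]) (auto intro: Ck_on_const)
qed auto

lemma Ck_on_add:
  assumes "open S" "Ck_on k S f" "Ck_on k S g"
  shows "Ck_on k S (\<lambda>x. f x + g x)"
  using assms(2,3)
proof (induction k arbitrary: f g)
  case 0
  then show ?case by (simp add: continuous_on_add)
next
  case (Suc k)
  show ?case
  proof (rule Ck_on_SucI[OF assms(1)])
    show "((\<lambda>x. f x + g x) has_derivative
        (\<lambda>v. frechet_derivative f (at x) v + frechet_derivative g (at x) v)) (at x)" if "x \<in> S" for x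
      by (intro has_derivative_add Ck_on_frechet[OF Suc.prems(1) that] Ck_on_frechet[OF Suc.prems(2) that])
    show "Ck_on k S (\<lambda>x. frechet_derivative f (at x) v + frechet_derivative g (at x) v)" for v
      using Suc.prems by (intro Suc.IH) auto
  qed
qed

lemma Ck_on_mult:
  fixes f g :: "'e::euclidean_space \<Rightarrow> real"
  assumes "open S" "Ck_on k S f" "Ck_on k S g"
  shows "Ck_on k S (\<lambda>x. f x * g x)"
  using assms(2,3)
proof (induction k arbitrary: f g)
  case 0
  then show ?case by (simp add: continuous_on_mult)
next
  case (Suc k)
  show ?case
  proof (rule Ck_on_SucI[OF assms(1)])
    show "((\<lambda>x. f x * g x) has_derivative
        (\<lambda>v. f x * frechet_derivative g (at x) v + frechet_derivative f (at x) v * g x)) (at x)"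
      if "x \<in> S" for x
      by (intro has_derivative_mult Ck_on_frechet[OF Suc.prems(1) that] Ck_on_frechet[OF Suc.prems(2) that])
    show "Ck_on k S (\<lambda>x. f x * frechet_derivative g (at x) v + frechet_derivative f (at x) v * g x)" for v
      using Suc.prems Ck_on_SucD[OF Suc.prems(1)] Ck_on_SucD[OF Suc.prems(2)]
      by (intro Ck_on_add[OF assms(1)] Suc.IH) auto
  qed
qed

lemma Ck_on_sum:
  assumes "open S" "\<And>i. i \<in> I \<Longrightarrow> Ck_on k S (f i)"
  shows "Ck_on k S (\<lambda>x. \<Sum>i\<in>I. f i x)"
  using assms(2) by (induction I rule: infinite_finite_induct)
    (auto intro: Ck_on_const Ck_on_add assms(1))

lemma Ck_on_compose:
  fixes f :: "'e::euclidean_space \<Rightarrow> real" and g :: "'d::euclidean_space \<Rightarrow> 'e"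
  assumes "open S" "open T" "g ` S \<subseteq> T" "Ck_on k S g" "Ck_on k T f"
  shows "Ck_on k S (\<lambda>x. f (g x))"
  using assms(4,5)
proof (induction k arbitrary: f)
  case 0
  then show ?case using assms(3) by (auto intro: continuous_on_compose2)
next
  case (Suc k)
  let ?Df = "\<lambda>y. frechet_derivative f (at y)" and ?Dg = "\<lambda>x. frechet_derivative g (at x)"
  have D: "((\<lambda>x. f (g x)) has_derivative (\<lambda>v. ?Df (g x) (?Dg x v))) (at x)" if "x \<in> S" for x
  proof -
    have "g x \<in> T" using that assms(3) by auto
    from has_derivative_compose[OF Ck_on_frechet[OF Suc.prems(1) that] Ck_on_frechet[OF Suc.prems(2) this]]
    show ?thesis .
  qed
  show ?case
  proof (rule Ck_on_SucI[OF assms(1) D])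
    fix v
    \<comment> \<open>The derivative of the composition applies a varying linear map to a varying
      vector. Expanding the vector in the basis turns this into sums of products of real functions,
      to which the induction hypothesis for the partial derivatives of \<open>f\<close>
      applies.\<close>
    have "Ck_on k S (\<lambda>x. \<Sum>b\<in>Basis. (?Dg x v \<bullet> b) * ?Df (g x) b)"
    proof (intro Ck_on_sum Ck_on_mult assms(1))
      fix b :: 'e assume "b \<in> Basis"
      show "Ck_on k S (\<lambda>x. ?Dg x v \<bullet> b)"
        using Suc.prems(1) by (intro Ck_on_linear[OF bounded_linear_inner_left assms(1)]) auto
      show "Ck_on k S (\<lambda>x. ?Df (g x) b)"
        using Suc.prems Ck_on_SucD by (intro Suc.IH) auto
    qed
    then show "Ck_on k S (\<lambda>x. ?Df (g x) (?Dg x v))"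
    proof (rule Ck_on_cong[OF assms(1), rotated])
      fix x assume x: "x \<in> S"
      have "g x \<in> T" using x assms(3) by auto
      then have "bounded_linear (?Df (g x))"
        using Ck_on_frechet[OF Suc.prems(2)] has_derivative_bounded_linear by blast
      then interpret bounded_linear "?Df (g x)" .
      have "?Df (g x) (?Dg x v) = ?Df (g x) (\<Sum>b\<in>Basis. (?Dg x v \<bullet> b) *\<^sub>R b)"
        by (simp add: euclidean_representation)
      then show "(\<Sum>b\<in>Basis. (?Dg x v \<bullet> b) * ?Df (g x) b) = ?Df (g x) (?Dg x v)"
        by (simp add: sum scaleR)
    qed
  qed
qed

lemma smooth_on_subset: "smooth_on S f \<Longrightarrow> T \<subseteq> S \<Longrightarrow> smooth_on T f"
  unfolding smooth_on_def using Ck_on_subset by blast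

lemma smooth_on_cong: "\<lbrakk>open S; smooth_on S f; \<And>x. x \<in> S \<Longrightarrow> f x = g x\<rbrakk> \<Longrightarrow> smooth_on S g"
  unfolding smooth_on_def by (metis Ck_on_cong)

lemma smooth_on_local:
  assumes "\<And>x. x \<in> S \<Longrightarrow> \<exists>T. open T \<and> x \<in> T \<and> smooth_on T f"
  shows "smooth_on S f"
  unfolding smooth_on_def using assms by (auto intro!: Ck_on_local simp: smooth_on_def)

lemma smooth_on_const: "open S \<Longrightarrow> smooth_on S (\<lambda>x. c)"
  unfolding smooth_on_def by (auto intro: Ck_on_const)

lemma smooth_on_ident: "open S \<Longrightarrow> smooth_on S (\<lambda>x. x)"
  unfolding smooth_on_def by (auto intro: Ck_on_ident)

lemma smooth_on_linear:
  "bounded_linear L \<Longrightarrow> open S \<Longrightarrow> smooth_on S f \<Longrightarrow> smooth_on S (\<lambda>x. L (f x))"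
  unfolding smooth_on_def by (auto intro: Ck_on_linear)

lemma smooth_on_add:
  "\<lbrakk>open S; smooth_on S f; smooth_on S g\<rbrakk> \<Longrightarrow> smooth_on S (\<lambda>x. f x + g x)"
  unfolding smooth_on_def by (auto intro: Ck_on_add)

lemma smooth_on_mult:
  fixes f g :: "'e::euclidean_space \<Rightarrow> real"
  shows "\<lbrakk>open S; smooth_on S f; smooth_on S g\<rbrakk> \<Longrightarrow> smooth_on S (\<lambda>x. f x * g x)"
  unfolding smooth_on_def by (auto intro: Ck_on_mult)

lemma smooth_on_sum:
  "\<lbrakk>open S; \<And>i. i \<in> I \<Longrightarrow> smooth_on S (f i)\<rbrakk> \<Longrightarrow> smooth_on S (\<lambda>x. \<Sum>i\<in>I. f i x)"
  unfolding smooth_on_def by (auto intro: Ck_on_sum)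

lemma smooth_on_compose:
  fixes f :: "'e::euclidean_space \<Rightarrow> real" and g :: "'d::euclidean_space \<Rightarrow> 'e"
  shows "\<lbrakk>open S; open T; g ` S \<subseteq> T; smooth_on S g; smooth_on T f\<rbrakk> \<Longrightarrow> smooth_on S (\<lambda>x. f (g x))"
  unfolding smooth_on_def by (intro allI Ck_on_compose[of S T g _ f]) auto

lemma smooth_on_frechet_derivative:
  "smooth_on S f \<Longrightarrow> smooth_on S (\<lambda>x. frechet_derivative f (at x) v)"
  unfolding smooth_on_def by (metis Ck_on.simps(2))

lemma smooth_on_has_derivative:
  "smooth_on S f \<Longrightarrow> x \<in> S \<Longrightarrow> (f has_derivative frechet_derivative f (at x)) (at x)"
  unfolding smooth_on_def using Ck_on_frechet by blast

lemma smooth_on_continuous_on: "smooth_on S f \<Longrightarrow> continuous_on S f"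
  unfolding smooth_on_def using Ck_on_imp_continuous_on by blast

section \<open>A smooth bump function\<close>

definition flat :: "nat \<Rightarrow> real \<Rightarrow> real" where
  "flat n t = (if t > 0 then inverse t ^ n * exp (- inverse t) else 0)"

lemma flat_tendsto_0: "((\<lambda>t. flat n t) \<longlongrightarrow> 0) (at 0)"
proof -
  have "((\<lambda>t::real. (inverse t) ^ n / exp (inverse t)) \<longlongrightarrow> 0) (at_right 0)"
    by (rule filterlim_compose[OF tendsto_power_div_exp_0 filterlim_inverse_at_top_right])
  then have "(flat n \<longlongrightarrow> 0) (at_right 0)"
    by (rule Lim_transform_eventually)
      (auto simp: flat_def eventually_at_filter exp_minus field_simps intro!: always_eventually)
  moreover have "(flat n \<longlongrightarrow> 0) (at_left 0)"
    by (rule Lim_transform_eventually[OF tendsto_const])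
      (auto simp: flat_def eventually_at_filter intro!: always_eventually)
  ultimately show ?thesis by (simp add: filterlim_split_at)
qed

text \<open>The exponent \<open>n\<close> is there for this lemma: the functions t^(-n) exp (-1/t),
  extended by 0, are closed under differentiation up to linear combinations, so one induction proves
  all of them smooth.\<close>

lemma flat_has_derivative:
  "(flat n has_real_derivative (- real n * flat (n + 1) t + flat (n + 2) t)) (at t)"
proof -
  consider "t > 0" | "t = 0" | "t < 0" by linarith
  then show ?thesis
  proof cases
    case 1
    have "((\<lambda>t. inverse t ^ n * exp (- inverse t)) has_real_derivative
        (real n * inverse t ^ (n - 1) * - (inverse t)\<^sup>2) * exp (- inverse t)
          + inverse t ^ n * (exp (- inverse t) * (inverse t)\<^sup>2)) (at t)"
      using 1 by (auto intro!: derivative_eq_intros simp: power2_eq_square)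
    also have "(real n * inverse t ^ (n - 1) * - (inverse t)\<^sup>2) * exp (- inverse t)
          + inverse t ^ n * (exp (- inverse t) * (inverse t)\<^sup>2) =
        - real n * flat (n + 1) t + flat (n + 2) t"
      using 1 by (cases n) (simp_all add: flat_def power2_eq_square algebra_simps)
    finally have "((\<lambda>t. inverse t ^ n * exp (- inverse t)) has_real_derivative
        (- real n * flat (n + 1) t + flat (n + 2) t)) (at t)" .
    then show ?thesis
      by (rule has_field_derivative_transform_within_open[where S = "{0<..}"]) (use 1 in \<open>auto simp: flat_def\<close>)
  next
    case 2
    \<comment> \<open>At 0 the difference quotient \<open>flat n h / h\<close> is
      \<open>flat (n + 1) h\<close>, which tends to 0.\<close>
    have "((\<lambda>h. (flat n (0 + h) - flat n 0) / h) \<longlongrightarrow> 0) (at 0)"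
      by (rule Lim_transform_eventually[OF flat_tendsto_0[of "n + 1"]])
        (auto simp: flat_def eventually_at_filter divide_inverse intro!: always_eventually)
    then show ?thesis using 2 by (simp add: DERIV_def flat_def)
  next
    case 3
    have "((\<lambda>t. 0) has_real_derivative (- real n * flat (n + 1) t + flat (n + 2) t)) (at t)"
      using 3 by (simp add: flat_def)
    then show ?thesis
      by (rule has_field_derivative_transform_within_open[where S = "{..<0}"]) (use 3 in \<open>auto simp: flat_def\<close>)
  qed
qed

lemma smooth_on_flat: "smooth_on UNIV (flat n)"
proof -
  have "Ck_on k UNIV (flat n)" for k
  proof (induction k arbitrary: n)
    case 0
    show ?case using flat_has_derivative
      by (auto intro!: continuous_at_imp_continuous_on DERIV_isCont)
  next
    case (Suc k)
    show ?case
    proof (rule Ck_on_SucI)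
      show "(flat n has_derivative (\<lambda>v. (- real n * flat (n + 1) t + flat (n + 2) t) * v)) (at t)" for t
        using flat_has_derivative[of n t] by (simp add: has_field_derivative_def)
      show "Ck_on k UNIV (\<lambda>t. (- real n * flat (n + 1) t + flat (n + 2) t) * v)" for v
        by (intro Ck_on_mult Ck_on_add Ck_on_const Suc open_UNIV)
    qed simp
  qed
  then show ?thesis by (simp add: smooth_on_def)
qed

text \<open>The value 1 is required at \<open>q\<close> only, not near it. This suffices because the
  bump is always multiplied by a function vanishing at \<open>q\<close>, so that its own derivative
  never enters.\<close>

lemma bump_function:
  fixes q :: "'e::euclidean_space"
  assumes "r > 0"
  obtains \<psi> :: "'e \<Rightarrow> real" where
    "smooth_on UNIV \<psi>" "\<psi> q = 1" "\<And>x. x \<notin> ball q r \<Longrightarrow> \<psi> x = 0"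
proof
  let ?g = "\<lambda>x. r\<^sup>2 - (\<Sum>b\<in>Basis. ((x - q) \<bullet> b) * ((x - q) \<bullet> b))"
  let ?\<psi> = "\<lambda>x. flat 0 (?g x) * (1 / flat 0 (r\<^sup>2))"
  have "smooth_on UNIV (\<lambda>x::'e. x - q)"
    using smooth_on_add[OF open_UNIV smooth_on_ident smooth_on_const[of UNIV "- q"]] by simp
  then have *: "smooth_on UNIV (\<lambda>x. (x - q) \<bullet> b)" for b
    by (intro smooth_on_linear[OF bounded_linear_inner_left]) auto
  have "smooth_on UNIV (\<lambda>x. r\<^sup>2 + (-1) * (\<Sum>b\<in>Basis. ((x - q) \<bullet> b) * ((x - q) \<bullet> b)))"
    by (intro smooth_on_add smooth_on_mult smooth_on_const smooth_on_sum * open_UNIV)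
  then have "smooth_on UNIV ?g" by simp
  then show "smooth_on UNIV ?\<psi>"
    by (intro smooth_on_mult smooth_on_const smooth_on_compose[OF _ open_UNIV _ _ smooth_on_flat]) auto
  show "?\<psi> q = 1"
    using assms by (simp add: flat_def)
  show "?\<psi> x = 0" if "x \<notin> ball q r" for x
  proof -
    have "(\<Sum>b\<in>Basis. ((x - q) \<bullet> b) * ((x - q) \<bullet> b)) = (dist q x)\<^sup>2"
      by (simp add: dist_norm norm_minus_commute[of q x] power2_norm_eq_inner flip: euclidean_inner)
    moreover have "(dist q x)\<^sup>2 \<ge> r\<^sup>2"
      using that assms by (intro power_mono) auto
    ultimately show ?thesis by (simp add: flat_def)
  qed
qed

text \<open>The weights \<open>t ^ m\<close> make the class of these integrals closed under differentiation in \<open>x\<close>.\<close>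

definition radial_integral :: "nat \<Rightarrow> ('e::euclidean_space \<Rightarrow> real) \<Rightarrow> 'e \<Rightarrow> 'e \<Rightarrow> real" where
  "radial_integral m H q x = integral (cbox 0 1) (\<lambda>t. t ^ m * H (q + t *\<^sub>R (x - q)))"

lemma radial_in_ball:
  fixes x q :: "'a::real_normed_vector"
  assumes "x \<in> ball q r" "t \<in> cbox 0 (1::real)"
  shows "q + t *\<^sub>R (x - q) \<in> ball q r"
proof -
  have "norm (t *\<^sub>R (x - q)) \<le> norm (x - q)"
    using assms(2) by (simp add: mult_left_le_one_le)
  then show ?thesis using assms(1) by (simp add: dist_norm norm_minus_commute)
qed

lemma continuous_on_radial:
  fixes H :: "'e::euclidean_space \<Rightarrow> 'b::real_normed_vector"
  assumes "continuous_on (ball q r) H"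
  shows "continuous_on (ball q r \<times> cbox 0 (1::real)) (\<lambda>(x, t). t ^ m *\<^sub>R H (q + t *\<^sub>R (x - q)))"
proof -
  have "continuous_on (ball q r \<times> cbox 0 (1::real)) (\<lambda>z. H (q + snd z *\<^sub>R (fst z - q)))"
    by (rule continuous_on_compose2[OF assms])
      (auto intro!: continuous_intros radial_in_ball simp del: mem_ball)
  then show ?thesis
    unfolding case_prod_beta by (intro continuous_intros)
qed

text \<open>Differentiation under the integral sign. Moving \<open>x\<close> by \<open>v\<close>
  moves the argument of \<open>H\<close> by \<open>t\<close> times \<open>v\<close>, which produces
  the additional power of \<open>t\<close>.\<close>

lemma radial_integral_has_derivative:
  fixes H :: "'e::euclidean_space \<Rightarrow> real"
  assumes H: "Ck_on 1 (ball q r) H" and x: "x \<in> ball q r"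
  shows "(radial_integral m H q has_derivative
    (\<lambda>v. radial_integral (Suc m) (\<lambda>y. frechet_derivative H (at y) v) q x)) (at x)"
proof -
  \<comment> \<open>Differentiation under the integral needs a derivative that is continuous in
    operator norm. In finite dimension this follows from continuity of the partial
    derivatives.\<close>
  define F where "F y = Blinfun (frechet_derivative H (at y))" for y
  have D: "(H has_derivative blinfun_apply (F y)) (at y)" if "y \<in> ball q r" for y
  proof -
    have "(H has_derivative frechet_derivative H (at y)) (at y)"
      by (rule Ck_on_frechet[OF H[unfolded One_nat_def] that])
    then show ?thesis
      unfolding F_def using bounded_linear_Blinfun_apply has_derivative_bounded_linear by metis
  qed
  then have F: "blinfun_apply (F y) v = frechet_derivative H (at y) v" if "y \<in> ball q r" for y v
    using that frechet_derivative_at by metis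
  have cF: "continuous_on (ball q r) F"
  proof (rule continuous_on_blinfun_componentwise)
    fix i :: 'e
    have "continuous_on (ball q r) (\<lambda>x. frechet_derivative H (at x) i)"
      using H by simp
    then show "continuous_on (ball q r) (\<lambda>x. blinfun_apply (F x) i)"
      by (rule continuous_on_eq) (simp add: F)
  qed
  define fx where "fx x t = t ^ Suc m *\<^sub>R F (q + t *\<^sub>R (x - q))" for x and t :: real
  have cfx: "continuous_on (ball q r \<times> cbox 0 1) (\<lambda>(x, t). fx x t)"
    unfolding fx_def using continuous_on_radial[OF cF, of "Suc m"] by simp
  have cont_H: "continuous_on (ball q r) H"
    using Ck_on_imp_continuous_on[OF H] .
  have int: "(\<lambda>t. t ^ m * H (q + t *\<^sub>R (x - q))) integrable_on cbox 0 1" if "x \<in> ball q r" for x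
    by (rule integrable_continuous)
      (use that in \<open>auto intro!: continuous_intros continuous_on_compose2[OF cont_H] radial_in_ball
        simp del: mem_ball\<close>)
  have "((\<lambda>x. integral (cbox 0 1) (\<lambda>t. t ^ m * H (q + t *\<^sub>R (x - q)))) has_derivative
      blinfun_apply (integral (cbox 0 1) (fx x))) (at x within ball q r)"
  proof (rule leibniz_rule[OF _ int cfx x])
    fix y and t :: real assume y: "y \<in> ball q r" and t: "t \<in> cbox 0 1"
    have "((\<lambda>x. q + t *\<^sub>R (x - q)) has_derivative (\<lambda>v. t *\<^sub>R v)) (at y within ball q r)"
      by (auto intro!: derivative_eq_intros)
    from has_derivative_compose[OF this D[OF radial_in_ball[OF y t]]]
    have "((\<lambda>x. t ^ m * H (q + t *\<^sub>R (x - q))) has_derivative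
        (\<lambda>v. t ^ m * blinfun_apply (F (q + t *\<^sub>R (y - q))) (t *\<^sub>R v))) (at y within ball q r)"
      by (rule has_derivative_mult_right)
    moreover have "(\<lambda>v. t ^ m * blinfun_apply (F (q + t *\<^sub>R (y - q))) (t *\<^sub>R v)) = blinfun_apply (fx y t)"
      by (simp add: fun_eq_iff fx_def blinfun.scaleR_left blinfun.scaleR_right)
    ultimately show "((\<lambda>x. t ^ m * H (q + t *\<^sub>R (x - q))) has_derivative blinfun_apply (fx y t))
        (at y within ball q r)"
      by simp
  qed auto
  moreover have "blinfun_apply (integral (cbox 0 1) (fx x)) =
      (\<lambda>v. radial_integral (Suc m) (\<lambda>y. frechet_derivative H (at y) v) q x)"
  proof
    fix v
    have "fx x integrable_on cbox 0 1"
    proof (rule integrable_continuous)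
      have "continuous_on (cbox 0 1) ((\<lambda>(x, t). fx x t) \<circ> (\<lambda>t. (x, t)))"
        using x by (intro continuous_on_compose continuous_on_subset[OF cfx]) (auto intro!: continuous_intros)
      then show "continuous_on (cbox 0 1) (fx x)" by (simp add: o_def)
    qed
    then have "blinfun_apply (integral (cbox 0 1) (fx x)) v = integral (cbox 0 1) (\<lambda>t. blinfun_apply (fx x t) v)"
      by (rule blinfun_apply_integral)
    also have "\<dots> = radial_integral (Suc m) (\<lambda>y. frechet_derivative H (at y) v) q x"
      unfolding radial_integral_def fx_def
      by (rule integral_cong) (simp add: blinfun.scaleR_left F radial_in_ball[OF x] del: mem_ball)
    finally show "blinfun_apply (integral (cbox 0 1) (fx x)) v =
      radial_integral (Suc m) (\<lambda>y. frechet_derivative H (at y) v) q x" .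
  qed
  ultimately show ?thesis
    using x at_within_open[of x "ball q r"] by (simp add: radial_integral_def[abs_def])
qed

lemma smooth_on_radial_integral:
  fixes H :: "'e::euclidean_space \<Rightarrow> real"
  assumes "smooth_on (ball q r) H"
  shows "smooth_on (ball q r) (radial_integral m H q)"
proof -
  have "Ck_on k (ball q r) (radial_integral m H q)" if "smooth_on (ball q r) H" for k H m
    using that
  proof (induction k arbitrary: H m)
    case 0
    have "continuous_on (ball q r) (radial_integral m H q)"
      unfolding radial_integral_def[abs_def]
      by (rule integral_continuous_on_param)
        (use continuous_on_radial[OF smooth_on_continuous_on[OF 0], of m] in simp)
    then show ?case by simp
  next
    case (Suc k)
    have H: "Ck_on 1 (ball q r) H" using Suc.prems smooth_on_def by blast
    show ?case
      by (rule Ck_on_SucI[OF open_ball radial_integral_has_derivative[OF H]])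
        (auto intro!: Suc.IH smooth_on_frechet_derivative Suc.prems simp del: mem_ball)
  qed
  with assms show ?thesis by (simp add: smooth_on_def)
qed

text \<open>The fundamental theorem of calculus on the segment from \<open>q\<close> to
  \<open>x\<close>. What matters later is that the coefficients are smooth and that at
  \<open>q\<close> they are the partial derivatives of \<open>H\<close>.\<close>

lemma hadamard:
  fixes H :: "'e::euclidean_space \<Rightarrow> real"
  assumes H: "smooth_on (ball q r) H" and x: "x \<in> ball q r"
  shows "H x = H q + (\<Sum>b\<in>Basis. ((x - q) \<bullet> b) *
    radial_integral 0 (\<lambda>y. frechet_derivative H (at y) b) q x)"
proof -
  let ?D = "\<lambda>y. frechet_derivative H (at y)"
  have D: "(H has_derivative ?D y) (at y)" if "y \<in> ball q r" for y
    using smooth_on_has_derivative[OF H that] .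
  have "((\<lambda>t. ?D (q + t *\<^sub>R (x - q)) (x - q)) has_integral
      H (q + 1 *\<^sub>R (x - q)) - H (q + 0 *\<^sub>R (x - q))) {0..1}"
  proof (rule fundamental_theorem_of_calculus)
    fix t :: real assume t: "t \<in> {0..1}"
    have in_ball: "q + t *\<^sub>R (x - q) \<in> ball q r"
      using radial_in_ball[OF x, of t] t by (simp add: cbox_interval)
    have "((\<lambda>t. q + t *\<^sub>R (x - q)) has_derivative (\<lambda>h. h *\<^sub>R (x - q))) (at t within {0..1})"
      by (auto intro!: derivative_eq_intros)
    from has_derivative_compose[OF this D[OF in_ball]]
    have *: "((\<lambda>t. H (q + t *\<^sub>R (x - q))) has_derivative (\<lambda>h. ?D (q + t *\<^sub>R (x - q)) (h *\<^sub>R (x - q))))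
      (at t within {0..1})" .
    have "bounded_linear (?D (q + t *\<^sub>R (x - q)))"
      using has_derivative_bounded_linear[OF D[OF in_ball]] .
    then have "?D (q + t *\<^sub>R (x - q)) (h *\<^sub>R (x - q)) = h *\<^sub>R ?D (q + t *\<^sub>R (x - q)) (x - q)" for h
      by (rule linear_cmul[OF bounded_linear.linear])
    with * show "((\<lambda>t. H (q + t *\<^sub>R (x - q))) has_vector_derivative ?D (q + t *\<^sub>R (x - q)) (x - q))
      (at t within {0..1})"
      by (simp add: has_vector_derivative_def)
  qed simp
  then have "H x - H q = integral (cbox 0 1) (\<lambda>t. ?D (q + t *\<^sub>R (x - q)) (x - q))"
    by (simp add: integral_unique cbox_interval)
  also have "\<dots> = integral (cbox 0 1) (\<lambda>t. \<Sum>b\<in>Basis. ((x - q) \<bullet> b) * ?D (q + t *\<^sub>R (x - q)) b)"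
  proof (rule integral_cong)
    fix t :: real assume "t \<in> cbox 0 1"
    then have "bounded_linear (?D (q + t *\<^sub>R (x - q)))"
      using has_derivative_bounded_linear[OF D[OF radial_in_ball[OF x]]] by blast
    then interpret bounded_linear "?D (q + t *\<^sub>R (x - q))" .
    have "?D (q + t *\<^sub>R (x - q)) (x - q) = ?D (q + t *\<^sub>R (x - q)) (\<Sum>b\<in>Basis. ((x - q) \<bullet> b) *\<^sub>R b)"
      by (simp add: euclidean_representation)
    then show "?D (q + t *\<^sub>R (x - q)) (x - q) = (\<Sum>b\<in>Basis. ((x - q) \<bullet> b) * ?D (q + t *\<^sub>R (x - q)) b)"
      by (simp only: sum scaleR real_scaleR_def)
  qed
  also have "\<dots> = (\<Sum>b\<in>Basis. ((x - q) \<bullet> b) * radial_integral 0 (\<lambda>y. ?D y b) q x)"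
  proof -
    have "(\<lambda>t. ?D (q + t *\<^sub>R (x - q)) b) integrable_on cbox 0 1" for b
      by (rule integrable_continuous)
        (use x in \<open>auto intro!: continuous_intros radial_in_ball simp del: mem_ball
          intro: continuous_on_compose2[OF smooth_on_continuous_on[OF smooth_on_frechet_derivative[OF H]]]\<close>)
    then show ?thesis
      by (subst integral_sum) (auto simp: radial_integral_def intro!: integrable_on_mult_right)
  qed
  finally show ?thesis by simp
qed

lemma radial_integral_center: "radial_integral 0 H q q = H q"
  by (simp add: radial_integral_def)

section \<open>Vector fields on manifolds\<close>

lemma sum_fun_apply: "(\<Sum>i\<in>I. F i) x = (\<Sum>i\<in>I. F i x)"
  by (induction I rule: infinite_finite_induct) auto

lemma prod_fun_apply: "(\<Prod>i\<in>I. F i) x = (\<Prod>i\<in>I. F i x)"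
  by (induction I rule: infinite_finite_induct) auto

text \<open>The condition that \<open>smooth_atlas\<close> places on a single chart, isolated so
  that it can be applied to charts of the product manifold as well.\<close>

definition chart_ok :: "'a::topological_space set \<Rightarrow> ('a \<Rightarrow> 'e::euclidean_space) \<Rightarrow> bool" where
  "chart_ok U \<phi> \<longleftrightarrow> open U \<and> open (\<phi> ` U) \<and> homeomorphism U (\<phi> ` U) \<phi> (inv_into U \<phi>)"

lemma chart_okD:
  assumes "chart_ok U \<phi>"
  shows "open U" "open (\<phi> ` U)" "continuous_on U \<phi>" "continuous_on (\<phi> ` U) (inv_into U \<phi>)"
    "\<And>p. p \<in> U \<Longrightarrow> inv_into U \<phi> (\<phi> p) = p"
    "\<And>y. y \<in> \<phi> ` U \<Longrightarrow> inv_into U \<phi> y \<in> U" "\<And>y. y \<in> \<phi> ` U \<Longrightarrow> \<phi> (inv_into U \<phi> y) = y"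
  using assms by (auto simp: chart_ok_def homeomorphism_def inv_into_into f_inv_into_f)

lemma chart_ok_open_image:
  assumes "chart_ok U \<phi>" "open W" "W \<subseteq> U"
  shows "open (\<phi> ` W)"
proof -
  have "\<phi> ` W = \<phi> ` U \<inter> inv_into U \<phi> -` W"
    using assms(3) chart_okD(5-7)[OF assms(1)] by (auto simp: image_iff)
  then show ?thesis
    using chart_okD[OF assms(1)] assms(2) continuous_open_preimage by metis
qed

lemma chart_ok_map_prod:
  fixes \<phi> :: "'a::topological_space \<Rightarrow> 'e::euclidean_space"
    and \<psi> :: "'b::topological_space \<Rightarrow> 'f::euclidean_space"
  assumes "chart_ok U \<phi>" "chart_ok V \<psi>"
  shows "chart_ok (U \<times> V) (map_prod \<phi> \<psi>)"
    and "\<And>x y. \<lbrakk>x \<in> \<phi> ` U; y \<in> \<psi> ` V\<rbrakk> \<Longrightarrow>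
      inv_into (U \<times> V) (map_prod \<phi> \<psi>) (x, y) = (inv_into U \<phi> x, inv_into V \<psi> y)"
proof -
  note U = chart_okD[OF assms(1)] and V = chart_okD[OF assms(2)]
  have inj: "inj_on (map_prod \<phi> \<psi>) (U \<times> V)"
    by (rule inj_on_inverseI[where g = "map_prod (inv_into U \<phi>) (inv_into V \<psi>)"]) (auto simp: U V)
  show inv: "inv_into (U \<times> V) (map_prod \<phi> \<psi>) (x, y) = (inv_into U \<phi> x, inv_into V \<psi> y)"
    if "x \<in> \<phi> ` U" "y \<in> \<psi> ` V" for x y
    by (rule inv_into_f_eq[OF inj]) (use that U V in auto)
  have image: "map_prod \<phi> \<psi> ` (U \<times> V) = \<phi> ` U \<times> \<psi> ` V" by force
  have "continuous_on (U \<times> V) (\<lambda>z. (\<phi> (fst z), \<psi> (snd z)))"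
    by (intro continuous_intros continuous_on_compose2[OF U(3)] continuous_on_compose2[OF V(3)]) auto
  then have "continuous_on (U \<times> V) (map_prod \<phi> \<psi>)"
    by (simp add: map_prod_def case_prod_beta')
  moreover have "continuous_on (\<phi> ` U \<times> \<psi> ` V) (\<lambda>z. (inv_into U \<phi> (fst z), inv_into V \<psi> (snd z)))"
    by (intro continuous_intros continuous_on_compose2[OF U(4)] continuous_on_compose2[OF V(4)]) auto
  then have "continuous_on (\<phi> ` U \<times> \<psi> ` V) (inv_into (U \<times> V) (map_prod \<phi> \<psi>))"
    by (rule continuous_on_eq) (auto simp: inv)
  ultimately have "homeomorphism (U \<times> V) (\<phi> ` U \<times> \<psi> ` V) (map_prod \<phi> \<psi>) (inv_into (U \<times> V) (map_prod \<phi> \<psi>))"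
    using inj by (intro homeomorphismI) (auto simp: inv U V)
  then show "chart_ok (U \<times> V) (map_prod \<phi> \<psi>)"
    unfolding chart_ok_def image using U V by (auto intro: open_Times)
qed

lemma smooth_functions_chart:
  "f \<in> smooth_functions A \<Longrightarrow> (U, \<phi>) \<in> A \<Longrightarrow> smooth_on (\<phi> ` U) (f \<circ> inv_into U \<phi>)"
  unfolding smooth_functions_def by auto

lemma smooth_functions_compose:
  assumes f: "f \<in> smooth_functions B" and F: "smooth_map A B F"
    and A: "\<And>U \<phi>. (U, \<phi>) \<in> A \<Longrightarrow> chart_ok U \<phi>" and B: "\<And>V \<psi>. (V, \<psi>) \<in> B \<Longrightarrow> chart_ok V \<psi>"
    and cover: "\<Union> (fst ` B) = UNIV"
  shows "(\<lambda>p. f (F p)) \<in> smooth_functions A"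
  unfolding smooth_functions_def
proof (safe intro!: smooth_on_local)
  fix U \<phi> p assume U: "(U, \<phi>) \<in> A" and p: "p \<in> U"
  note U' = chart_okD[OF A[OF U]]
  from cover obtain V \<psi> where V: "(V, \<psi>) \<in> B" and FV: "F p \<in> V" by fastforce
  note V' = chart_okD[OF B[OF V]]
  let ?W = "U \<inter> F -` V"
  have "open (F -` V)"
    using F V'(1) open_vimage unfolding smooth_map_def by blast
  then have op: "open (\<phi> ` ?W)"
    using chart_ok_open_image[OF A[OF U]] U'(1) by auto
  have sm: "smooth_on (\<phi> ` ?W) (\<psi> \<circ> F \<circ> inv_into U \<phi>)"
    using F U V unfolding smooth_map_def by blast
  have "smooth_on (\<phi> ` ?W) (\<lambda>x. (f \<circ> inv_into V \<psi>) ((\<psi> \<circ> F \<circ> inv_into U \<phi>) x))"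
    by (rule smooth_on_compose[OF op V'(2) _ sm smooth_functions_chart[OF f V]]) (auto simp: U')
  then have "smooth_on (\<phi> ` ?W) ((\<lambda>p. f (F p)) \<circ> inv_into U \<phi>)"
    by (rule smooth_on_cong[OF op]) (auto simp: U' V')
  then show "\<exists>T. open T \<and> \<phi> p \<in> T \<and> smooth_on T ((\<lambda>p. f (F p)) \<circ> inv_into U \<phi>)"
    using op p FV by auto
qed

section \<open>Smooth functions, and vector fields as derivations\<close>

locale smooth_manifold =
  fixes A :: "('a::{t2_space,second_countable_topology}, 'e::euclidean_space) chart set"
  assumes atlas: "smooth_atlas A"
begin

lemma chart: "(U, \<phi>) \<in> A \<Longrightarrow> chart_ok U \<phi>"
  using atlas unfolding smooth_atlas_def chart_ok_def by auto

lemma cover: "\<Union> (fst ` A) = UNIV"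
  using atlas unfolding smooth_atlas_def by (auto simp: case_prod_beta)

lemma chart_at: obtains U \<phi> where "(U, \<phi>) \<in> A" "p \<in> U"
  using cover by fastforce

lemma transition:
  "\<lbrakk>(U, \<phi>) \<in> A; (V, \<psi>) \<in> A\<rbrakk> \<Longrightarrow> smooth_on (\<phi> ` (U \<inter> V)) (\<psi> \<circ> inv_into U \<phi>)"
  using atlas unfolding smooth_atlas_def by auto

text \<open>The definition tests every chart; because transition maps are smooth, one chart around
  each point is enough.\<close>

lemma sf_locally:
  assumes "\<And>p. \<exists>U \<phi> W. (U, \<phi>) \<in> A \<and> p \<in> W \<and> open W \<and> W \<subseteq> U \<and> smooth_on (\<phi> ` W) (f \<circ> inv_into U \<phi>)"
  shows "f \<in> smooth_functions A"
  unfolding smooth_functions_def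
proof (safe intro!: smooth_on_local)
  fix V \<psi> p assume V: "(V, \<psi>) \<in> A" and p: "p \<in> V"
  obtain U \<phi> W where U: "(U, \<phi>) \<in> A" and W: "p \<in> W" "open W" "W \<subseteq> U"
    and sm: "smooth_on (\<phi> ` W) (f \<circ> inv_into U \<phi>)"
    using assms by blast
  note U' = chart_okD[OF chart[OF U]] and V' = chart_okD[OF chart[OF V]]
  have op: "open (\<psi> ` (W \<inter> V))" "open (\<phi> ` W)"
    using chart_ok_open_image chart U V W V'(1) by blast+
  have "smooth_on (\<psi> ` (W \<inter> V)) (\<lambda>x. (f \<circ> inv_into U \<phi>) ((\<phi> \<circ> inv_into V \<psi>) x))"
    by (rule smooth_on_compose[OF op _ smooth_on_subset[OF transition[OF V U]] sm])
      (use W in \<open>auto simp: V'\<close>)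
  then have "smooth_on (\<psi> ` (W \<inter> V)) (f \<circ> inv_into V \<psi>)"
    by (rule smooth_on_cong[OF op(1)]) (use W U' V' in auto)
  then show "\<exists>T. open T \<and> \<psi> p \<in> T \<and> smooth_on T (f \<circ> inv_into V \<psi>)"
    using op W p by auto
qed

lemma sf_const: "(\<lambda>p. c) \<in> smooth_functions A"
  unfolding smooth_functions_def using chart chart_okD(2)
  by (auto simp: o_def intro!: smooth_on_const)

lemma sf_add:
  assumes "f \<in> smooth_functions A" "h \<in> smooth_functions A"
  shows "f + h \<in> smooth_functions A"
  unfolding smooth_functions_def
proof clarify
  fix U \<phi> assume U: "(U, \<phi>) \<in> A"
  show "smooth_on (\<phi> ` U) ((f + h) \<circ> inv_into U \<phi>)"
    using smooth_on_add[OF chart_okD(2)[OF chart[OF U]] smooth_functions_chart[OF assms(1) U]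
      smooth_functions_chart[OF assms(2) U]]
    by (simp add: o_def plus_fun_def)
qed

lemma sf_mult:
  assumes "f \<in> smooth_functions A" "h \<in> smooth_functions A"
  shows "f * h \<in> smooth_functions A"
  unfolding smooth_functions_def
proof clarify
  fix U \<phi> assume U: "(U, \<phi>) \<in> A"
  show "smooth_on (\<phi> ` U) ((f * h) \<circ> inv_into U \<phi>)"
    using smooth_on_mult[OF chart_okD(2)[OF chart[OF U]] smooth_functions_chart[OF assms(1) U]
      smooth_functions_chart[OF assms(2) U]]
    by (simp add: o_def times_fun_def)
qed

lemma sf_0: "0 \<in> smooth_functions A"
  using sf_const[of 0] by (simp add: zero_fun_def)

lemma sf_1: "1 \<in> smooth_functions A"
  using sf_const[of 1] by (simp add: one_fun_def)

lemma sf_cmult: "f \<in> smooth_functions A \<Longrightarrow> (\<lambda>p. c * f p) \<in> smooth_functions A"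
  using sf_mult[OF sf_const[of c]] by (simp add: times_fun_def)

lemma sf_uminus: "f \<in> smooth_functions A \<Longrightarrow> - f \<in> smooth_functions A"
  using sf_cmult[of f "-1"] by (simp add: fun_Compl_def)

lemma sf_diff: "\<lbrakk>f \<in> smooth_functions A; h \<in> smooth_functions A\<rbrakk> \<Longrightarrow> f - h \<in> smooth_functions A"
  using sf_add[OF _ sf_uminus] by (metis diff_conv_add_uminus)

lemma sf_sum: "(\<And>i. i \<in> I \<Longrightarrow> F i \<in> smooth_functions A) \<Longrightarrow> (\<Sum>i\<in>I. F i) \<in> smooth_functions A"
  by (induction I rule: infinite_finite_induct) (auto intro: sf_0 sf_add)

lemma sf_prod: "(\<And>i. i \<in> I \<Longrightarrow> F i \<in> smooth_functions A) \<Longrightarrow> (\<Prod>i\<in>I. F i) \<in> smooth_functions A"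
  by (induction I rule: infinite_finite_induct) (auto intro: sf_1 sf_mult)

text \<open>The room between the two radii yields two kinds of open sets that cover the manifold: on
  one the formula in the chart is smooth, on the other the function is identically 0.\<close>

lemma sf_extend:
  assumes U: "(U, \<phi>) \<in> A" and r: "cball q r \<subseteq> ball q R" "ball q R \<subseteq> \<phi> ` U"
    and \<psi>: "smooth_on UNIV \<psi>" "\<And>x. x \<notin> ball q r \<Longrightarrow> \<psi> x = 0" and H: "smooth_on (ball q R) H"
  shows "(\<lambda>p. if p \<in> U then \<psi> (\<phi> p) * H (\<phi> p) else 0) \<in> smooth_functions A"
proof (rule sf_locally)
  fix p
  let ?f = "\<lambda>p. if p \<in> U then \<psi> (\<phi> p) * H (\<phi> p) else 0"
  note U' = chart_okD[OF chart[OF U]]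
  show "\<exists>V \<theta> W. (V, \<theta>) \<in> A \<and> p \<in> W \<and> open W \<and> W \<subseteq> V \<and> smooth_on (\<theta> ` W) (?f \<circ> inv_into V \<theta>)"
  proof (cases "p \<in> U \<and> \<phi> p \<in> ball q R")
    case True
    let ?W = "U \<inter> \<phi> -` ball q R"
    have W: "open ?W" using U' continuous_open_preimage open_ball by blast
    have img: "\<phi> ` ?W = ball q R" using r(2) by auto
    have "smooth_on (ball q R) (\<lambda>x. \<psi> x * H x)"
      using \<psi>(1) H by (intro smooth_on_mult) (auto intro: smooth_on_subset)
    then have "smooth_on (\<phi> ` ?W) (?f \<circ> inv_into U \<phi>)"
      unfolding img
    proof (rule smooth_on_cong[OF open_ball])
      fix x assume "x \<in> ball q R"
      then have "x \<in> \<phi> ` U" using r(2) by blast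
      then show "\<psi> x * H x = (?f \<circ> inv_into U \<phi>) x" using U'(6,7) by simp
    qed
    then show ?thesis using True U W by (intro exI[of _ U] exI[of _ \<phi>] exI[of _ ?W]) simp
  next
    case False
    \<comment> \<open>As the image of a compact ball this set is compact, hence closed in the
      Hausdorff manifold, so its complement is open also around points outside
      \<open>U\<close>.\<close>
    let ?K = "inv_into U \<phi> ` cball q r"
    have "compact ?K"
      using r by (intro compact_continuous_image continuous_on_subset[OF U'(4)]) auto
    then have K: "open (- ?K)" by (simp add: compact_imp_closed open_Compl)
    have pK: "p \<notin> ?K"
    proof
      assume "p \<in> ?K"
      then obtain y where y: "y \<in> cball q r" "p = inv_into U \<phi> y" by blast
      then have "y \<in> \<phi> ` U" "y \<in> ball q R" using r by blast+
      then show False using False y U'(6,7)[of y] by simp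
    qed
    obtain V \<theta> where V: "(V, \<theta>) \<in> A" "p \<in> V" by (rule chart_at)
    note V' = chart_okD[OF chart[OF V(1)]]
    have op: "open (\<theta> ` (V - ?K))"
      using chart_ok_open_image[OF chart[OF V(1)]] V'(1) K by (simp add: Diff_eq open_Int)
    have zero: "?f x = 0" if "x \<notin> ?K" for x
    proof (cases "x \<in> U")
      case True
      then have "\<phi> x \<notin> cball q r" using that U'(5) by (metis image_eqI)
      then show ?thesis using \<psi>(2)[of "\<phi> x"] by (auto simp: dist_commute)
    qed simp
    have "smooth_on (\<theta> ` (V - ?K)) (?f \<circ> inv_into V \<theta>)"
    proof (rule smooth_on_cong[OF op smooth_on_const[OF op, of 0]])
      fix x assume "x \<in> \<theta> ` (V - ?K)"
      then have "inv_into V \<theta> x \<notin> ?K" using V'(5) by auto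
      then show "0 = (?f \<circ> inv_into V \<theta>) x" using zero by simp
    qed
    moreover have "open (V - ?K)" using V'(1) K by (simp add: Diff_eq open_Int)
    ultimately show ?thesis using V pK by (intro exI[of _ V] exI[of _ \<theta>] exI[of _ "V - ?K"]) auto
  qed
qed

abbreviation "VF \<equiv> vector_fields A"
abbreviation "SF \<equiv> smooth_functions A"

lemma vf_sf: "X \<in> VF \<Longrightarrow> X f \<in> SF"
  unfolding vector_fields_def using sf_0 by (cases "f \<in> SF") auto

lemma vf_junk: "X \<in> VF \<Longrightarrow> f \<notin> SF \<Longrightarrow> X f = 0"
  unfolding vector_fields_def by auto

lemma vf_f_add: "\<lbrakk>X \<in> VF; f \<in> SF; h \<in> SF\<rbrakk> \<Longrightarrow> X (f + h) = X f + X h"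
  unfolding vector_fields_def by auto

lemma vf_f_mult: "\<lbrakk>X \<in> VF; f \<in> SF; h \<in> SF\<rbrakk> \<Longrightarrow> X (f * h) = f * X h + h * X f"
  unfolding vector_fields_def by auto

lemma vf_f_cmult: "\<lbrakk>X \<in> VF; f \<in> SF\<rbrakk> \<Longrightarrow> X (\<lambda>p. c * f p) = (\<lambda>p. c * X f p)"
  unfolding vector_fields_def by auto

lemma vfI:
  assumes "\<And>f. f \<notin> SF \<Longrightarrow> X f = 0" "\<And>f. f \<in> SF \<Longrightarrow> X f \<in> SF"
    "\<And>f h. \<lbrakk>f \<in> SF; h \<in> SF\<rbrakk> \<Longrightarrow> X (f + h) = X f + X h"
    "\<And>f h. \<lbrakk>f \<in> SF; h \<in> SF\<rbrakk> \<Longrightarrow> X (f * h) = f * X h + h * X f"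
    "\<And>c f. f \<in> SF \<Longrightarrow> X (\<lambda>p. c * f p) = (\<lambda>p. c * X f p)"
  shows "X \<in> VF"
  unfolding vector_fields_def using assms by auto

lemma vf_f_uminus: "\<lbrakk>X \<in> VF; f \<in> SF\<rbrakk> \<Longrightarrow> X (- f) = - X f"
  using vf_f_cmult[of X f "-1"] by (simp add: fun_Compl_def)

lemma vf_f_diff: "\<lbrakk>X \<in> VF; f \<in> SF; h \<in> SF\<rbrakk> \<Longrightarrow> X (f - h) = X f - X h"
  by (metis vf_f_add vf_f_uminus sf_uminus diff_conv_add_uminus)

lemma vf_f_const: "X \<in> VF \<Longrightarrow> X (\<lambda>p. c) = 0"
proof -
  assume X: "X \<in> VF"
  have "X 1 = 0" using vf_f_mult[OF X sf_1 sf_1] by (simp add: fun_eq_iff)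
  then show ?thesis using vf_f_cmult[OF X sf_1, of c] by (simp add: one_fun_def zero_fun_def)
qed

lemma vf_f_0: "X \<in> VF \<Longrightarrow> X 0 = 0"
  using vf_f_const[of X 0] by (simp add: zero_fun_def)

lemma vf_f_sum: "X \<in> VF \<Longrightarrow> (\<And>i. i \<in> I \<Longrightarrow> F i \<in> SF) \<Longrightarrow> X (\<Sum>i\<in>I. F i) = (\<Sum>i\<in>I. X (F i))"
  by (induction I rule: infinite_finite_induct) (auto simp: vf_f_0 vf_f_add sf_sum)

lemma vf_0: "0 \<in> VF"
  by (rule vfI) (auto simp: sf_0 zero_fun_def[symmetric])

lemma vf_add: "\<lbrakk>X \<in> VF; Y \<in> VF\<rbrakk> \<Longrightarrow> X + Y \<in> VF"
  by (rule vfI) (auto simp: vf_junk sf_add vf_sf vf_f_add vf_f_mult vf_f_cmult algebra_simps fun_eq_iff)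

lemma vf_scale: "\<lbrakk>h \<in> SF; X \<in> VF\<rbrakk> \<Longrightarrow> h \<odot> X \<in> VF"
  by (rule vfI)
    (auto simp: fscale_def vf_junk sf_mult vf_sf vf_f_add vf_f_mult vf_f_cmult algebra_simps fun_eq_iff)

lemma vf_cscale: "X \<in> VF \<Longrightarrow> (\<lambda>_. c) \<odot> X \<in> VF"
  by (rule vf_scale[OF sf_const])

lemma vf_uminus: "X \<in> VF \<Longrightarrow> - X \<in> VF"
  using vf_cscale[of X "-1"] by (simp add: fscale_def fun_Compl_def times_fun_def)

lemma vf_diff: "\<lbrakk>X \<in> VF; Y \<in> VF\<rbrakk> \<Longrightarrow> X - Y \<in> VF"
  using vf_add[OF _ vf_uminus] by (metis diff_conv_add_uminus)

lemma vf_sum: "(\<And>i. i \<in> I \<Longrightarrow> X i \<in> VF) \<Longrightarrow> (\<Sum>i\<in>I. X i) \<in> VF"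
  by (induction I rule: infinite_finite_induct) (auto intro: vf_0 vf_add)

lemma vf_bracket:
  assumes "X \<in> VF" "Y \<in> VF"
  shows "lie_bracket X Y \<in> VF"
proof (rule vfI)
  fix f h c assume f: "f \<in> SF"
  show "lie_bracket X Y f \<in> SF"
    using assms f by (auto simp: lie_bracket_def intro: sf_diff vf_sf)
  show "lie_bracket X Y (\<lambda>p. c * f p) = (\<lambda>p. c * lie_bracket X Y f p)"
    using assms f by (simp add: lie_bracket_def vf_f_cmult vf_sf fun_eq_iff algebra_simps)
  assume h: "h \<in> SF"
  show "lie_bracket X Y (f + h) = lie_bracket X Y f + lie_bracket X Y h"
    using assms f h by (simp add: lie_bracket_def vf_f_add vf_sf del: plus_fun_apply)
  show "lie_bracket X Y (f * h) = f * lie_bracket X Y h + h * lie_bracket X Y f"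
    using assms f h by (simp add: lie_bracket_def vf_f_add vf_f_mult vf_sf sf_mult algebra_simps
        del: plus_fun_apply times_fun_apply)
qed (simp add: assms lie_bracket_def vf_junk vf_f_0 del: zero_fun_apply)

lemma vf_eqI: "\<lbrakk>X \<in> VF; Y \<in> VF; \<And>f p. f \<in> SF \<Longrightarrow> X f p = Y f p\<rbrakk> \<Longrightarrow> X = Y"
  by (rule ext, rule ext) (metis vf_junk)

text \<open>The functions \<open>h b\<close> are the coordinates centred at \<open>p\<close>, cut
  off by a bump. Hadamard's lemma writes \<open>f\<close> minus its value at \<open>p\<close> as a
  combination of them, and the product rule then leaves only the first-order coefficients.\<close>

lemma coordinate_functions:
  assumes U: "(U, \<phi>) \<in> A" "p \<in> U"
  obtains h where "\<forall>b. h b \<in> SF"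
    "\<forall>b\<in>Basis. \<forall>b'\<in>Basis.
      frechet_derivative (h b \<circ> inv_into U \<phi>) (at (\<phi> p)) b' = (if b = b' then 1 else 0)"
    "\<forall>Y\<in>VF. \<forall>f\<in>SF.
      Y f p = (\<Sum>b\<in>Basis. Y (h b) p * frechet_derivative (f \<circ> inv_into U \<phi>) (at (\<phi> p)) b)"
proof -
  note U' = chart_okD[OF chart[OF U(1)]]
  define q where "q = \<phi> p"
  have "q \<in> \<phi> ` U" using U by (auto simp: q_def)
  then obtain R where R: "R > 0" "ball q R \<subseteq> \<phi> ` U"
    using U'(2) openE by blast
  define r where "r = R / 2"
  have r: "r > 0" "cball q r \<subseteq> ball q R" using R by (auto simp: r_def)
  obtain \<psi> :: "'e \<Rightarrow> real" where \<psi>: "smooth_on UNIV \<psi>" "\<psi> q = 1" "\<And>x. x \<notin> ball q r \<Longrightarrow> \<psi> x = 0"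
    using bump_function[OF r(1)] by blast
  define E where "E H = (\<lambda>p. if p \<in> U then \<psi> (\<phi> p) * H (\<phi> p) else 0)" for H
  have E: "E H \<in> SF" if "smooth_on (ball q R) H" for H
    unfolding E_def by (rule sf_extend[OF U(1) r(2) R(2) \<psi>(1,3) that])
  have Ep: "E H p = H q" for H using U \<psi> by (simp add: E_def q_def)
  define h where "h b = E (\<lambda>x. (x - q) \<bullet> b)" for b
  have lin: "smooth_on (ball q R) (\<lambda>x. (x - q) \<bullet> b)" for b
    using smooth_on_add[OF open_ball smooth_on_ident smooth_on_const, of q R "- q"]
    by (intro smooth_on_linear[OF bounded_linear_inner_left]) auto
  have hS: "h b \<in> SF" for b unfolding h_def by (intro E lin)
  show thesis
  proof (rule that[of h]; intro allI ballI)
    show "h b \<in> SF" for b by (rule hS)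
    show "frechet_derivative (h b \<circ> inv_into U \<phi>) (at (\<phi> p)) b' = (if b = b' then 1 else 0)"
      if "b \<in> Basis" "b' \<in> Basis" for b b'
    proof -
      have "(\<psi> has_derivative frechet_derivative \<psi> (at q)) (at q)"
        using smooth_on_has_derivative[OF \<psi>(1)] by simp
      then have "((\<lambda>x. \<psi> x * ((x - q) \<bullet> b)) has_derivative (\<lambda>v. v \<bullet> b)) (at q)"
        by (auto intro!: derivative_eq_intros simp: \<psi>(2))
      then have "(h b \<circ> inv_into U \<phi> has_derivative (\<lambda>v. v \<bullet> b)) (at q)"
        by (rule has_derivative_transform_within_open[OF _ open_ball[of q R]])
          (use R U' in \<open>auto simp: h_def E_def subset_eq\<close>)
      then have "frechet_derivative (h b \<circ> inv_into U \<phi>) (at q) b' = b' \<bullet> b"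
        by (metis frechet_derivative_at)
      then show ?thesis using that by (simp add: q_def inner_Basis)
    qed
    fix Y f assume Y: "Y \<in> VF" and f: "f \<in> SF"
    define F where "F = f \<circ> inv_into U \<phi>"
    define G where "G b = radial_integral 0 (\<lambda>y. frechet_derivative F (at y) b) q" for b
    have F: "smooth_on (ball q R) F"
      unfolding F_def by (rule smooth_on_subset[OF smooth_functions_chart[OF f U(1)] R(2)])
    have EG: "E (G b) \<in> SF" for b
      unfolding G_def by (intro E smooth_on_radial_integral smooth_on_frechet_derivative F)
    have E1: "E (\<lambda>_. 1) \<in> SF" by (intro E smooth_on_const open_ball)
    define f0 where "f0 = f - (\<lambda>_. f p)"
    have f0: "f0 \<in> SF" unfolding f0_def by (intro sf_diff f sf_const)
    have Yf0: "Y f0 = Y f" unfolding f0_def by (simp add: vf_f_diff[OF Y f sf_const] vf_f_const[OF Y])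
    \<comment> \<open>Each of \<open>h b\<close> and \<open>E (G b)\<close> carries one factor of
      the bump, so Hadamard's identity is multiplied by its square. Since \<open>f0\<close> vanishes
      at \<open>p\<close>, applying \<open>Y\<close> there to the left-hand side still gives
      \<open>Y f p\<close>.\<close>
    have "E (\<lambda>_. 1) * (E (\<lambda>_. 1) * f0) = (\<Sum>b\<in>Basis. h b * E (G b))"
    proof
      fix x
      show "(E (\<lambda>_. 1) * (E (\<lambda>_. 1) * f0)) x = (\<Sum>b\<in>Basis. h b * E (G b)) x"
      proof (cases "x \<in> U \<and> \<phi> x \<in> ball q r")
        case True
        then have "\<phi> x \<in> ball q R" using r by (metis ball_subset_cball subsetD)
        from hadamard[OF F this] have "F (\<phi> x) - F q = (\<Sum>b\<in>Basis. ((\<phi> x - q) \<bullet> b) * G b (\<phi> x))"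
          by (simp add: G_def)
        moreover have "F (\<phi> x) - F q = f0 x"
          using True U U' by (simp add: F_def f0_def q_def)
        ultimately show ?thesis
          using True by (simp add: E_def h_def sum_fun_apply sum_distrib_left mult_ac)
      next
        case False
        then have "E H x = 0" for H using \<psi>(3) by (auto simp: E_def)
        then show ?thesis by (simp add: sum_fun_apply h_def)
      qed
    qed
    then have "Y (E (\<lambda>_. 1) * (E (\<lambda>_. 1) * f0)) p = (\<Sum>b\<in>Basis. Y (h b * E (G b))) p"
      by (simp only: vf_f_sum[OF Y sf_mult[OF hS EG]])
    moreover have "Y (E (\<lambda>_. 1) * (E (\<lambda>_. 1) * f0)) p = Y f p"
      using vf_f_mult[OF Y E1 sf_mult[OF E1 f0]] vf_f_mult[OF Y E1 f0] Yf0
      by (simp add: Ep f0_def)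
    moreover have "Y (h b * E (G b)) p = Y (h b) p * frechet_derivative F (at q) b" for b
      using vf_f_mult[OF Y hS EG] by (simp add: Ep h_def G_def radial_integral_center)
    ultimately show "Y f p = (\<Sum>b\<in>Basis. Y (h b) p * frechet_derivative (f \<circ> inv_into U \<phi>) (at (\<phi> p)) b)"
      by (simp add: sum_fun_apply F_def q_def)
  qed
qed

end

section \<open>Left-invariant vector fields\<close>

lemma (in smooth_manifold) riemannian_sum:
  assumes g: "riemannian_metric A g" and X: "\<And>i. i \<in> I \<Longrightarrow> X i \<in> VF" and Y: "Y \<in> VF"
  shows "g (\<Sum>i\<in>I. X i) Y = (\<Sum>i\<in>I. g (X i) Y)"
proof -
  have add: "g (X + X') Y = g X Y + g X' Y" if "X \<in> VF" "X' \<in> VF" for X X'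
    using g that Y unfolding riemannian_metric_def by blast
  have "g 0 Y = 0" using add[OF vf_0 vf_0] by simp
  with X show ?thesis
    by (induction I rule: infinite_finite_induct) (auto simp: add vf_sum)
qed

locale lie_group_manifold =
  fixes A :: "('a::{group_add,t2_space,second_countable_topology}, 'e::euclidean_space) chart set"
  assumes lie: "lie_group A"
begin

sublocale smooth_manifold A
  using lie by unfold_locales (simp add: lie_group_def)

lemma sf_group_add: "f \<in> SF \<Longrightarrow> (\<lambda>z. f (fst z + snd z)) \<in> smooth_functions (prod_atlas A A)"
proof -
  assume f: "f \<in> SF"
  have "(\<lambda>z. f ((\<lambda>(a, b). a + b) z)) \<in> smooth_functions (prod_atlas A A)"
    by (rule smooth_functions_compose[OF f _ _ chart cover])
      (use lie chart in \<open>auto simp: lie_group_def prod_atlas_def intro: chart_ok_map_prod(1)\<close>)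
  then show ?thesis by (simp add: case_prod_beta)
qed

text \<open>Smoothness of the group operation in coordinates. Freezing the first variable makes
  translations smooth; differentiating in the second makes left-invariant fields smooth.\<close>

lemma sf_two_charts:
  assumes f: "f \<in> SF" and V: "(V, \<psi>) \<in> A" and U: "(U, \<phi>) \<in> A"
  shows "smooth_on (\<psi> ` V \<times> \<phi> ` U) (\<lambda>z. f (inv_into V \<psi> (fst z) + inv_into U \<phi> (snd z)))"
proof -
  have "(V \<times> U, map_prod \<psi> \<phi>) \<in> prod_atlas A A" using U V by (auto simp: prod_atlas_def)
  from smooth_functions_chart[OF sf_group_add[OF f] this]
  have "smooth_on (\<psi> ` V \<times> \<phi> ` U) ((\<lambda>z. f (fst z + snd z)) \<circ> inv_into (V \<times> U) (map_prod \<psi> \<phi>))"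
    by (simp add: map_prod_surj_on[of \<psi> V "\<psi> ` V" \<phi> U "\<phi> ` U"])
  then show ?thesis
    by (rule smooth_on_cong[rotated])
      (use chart_ok_map_prod(2)[OF chart[OF V] chart[OF U]] chart_okD(2)[OF chart[OF V]]
        chart_okD(2)[OF chart[OF U]] in \<open>auto intro: open_Times\<close>)
qed

lemma sf_translate:
  assumes f: "f \<in> SF"
  shows "(\<lambda>x. f (a + x)) \<in> SF"
  unfolding smooth_functions_def
proof clarify
  fix U \<phi> assume U: "(U, \<phi>) \<in> A"
  obtain V \<psi> where V: "(V, \<psi>) \<in> A" "a \<in> V" by (rule chart_at)
  note U' = chart_okD[OF chart[OF U]] and V' = chart_okD[OF chart[OF V(1)]]
  have bl: "bounded_linear (\<lambda>y::'e. (0::'e, y))"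
    by (intro bounded_linear_Pair bounded_linear_zero bounded_linear_ident)
  have "smooth_on (\<phi> ` U) (\<lambda>y. (\<psi> a, 0) + (0, y))"
    by (intro smooth_on_add smooth_on_const smooth_on_linear[OF bl] smooth_on_ident U'(2))
  then have "smooth_on (\<phi> ` U) (\<lambda>y. (\<psi> a, y))" by simp
  then have "smooth_on (\<phi> ` U)
      (\<lambda>y. (\<lambda>z. f (inv_into V \<psi> (fst z) + inv_into U \<phi> (snd z))) (\<psi> a, y))"
    by (rule smooth_on_compose[OF U'(2) _ _ _ sf_two_charts[OF f V(1) U], rotated 2])
      (use U'(2) V'(2) V in \<open>auto intro: open_Times\<close>)
  then show "smooth_on (\<phi> ` U) ((\<lambda>x. f (a + x)) \<circ> inv_into U \<phi>)"
    using V V'(5) by (simp add: o_def)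
qed

lemma left_push_apply: "f \<in> SF \<Longrightarrow> left_push A a X f b = X (\<lambda>x. f (a + x)) (- a + b)"
  by (simp add: left_push_def)

lemma left_push_eq: "f \<in> SF \<Longrightarrow> left_push A a X f = (\<lambda>b. X (\<lambda>x. f (a + x)) (- a + b))"
  by (simp add: left_push_def)

lemma vf_left_push: "X \<in> VF \<Longrightarrow> left_push A a X \<in> VF"
proof (rule vfI)
  assume X: "X \<in> VF"
  fix f assume f: "f \<in> SF"
  note Lf = sf_translate[OF f, of a]
  show "left_push A a X f \<in> SF"
    unfolding left_push_eq[OF f] by (rule sf_translate[OF vf_sf[OF X]])
  show "left_push A a X (\<lambda>p. c * f p) = (\<lambda>p. c * left_push A a X f p)" for c
    by (simp add: left_push_eq f sf_cmult vf_f_cmult[OF X Lf])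
  fix h assume h: "h \<in> SF"
  note Lh = sf_translate[OF h, of a]
  have *: "(\<lambda>x. (f + h) (a + x)) = (\<lambda>x. f (a + x)) + (\<lambda>x. h (a + x))"
    "(\<lambda>x. (f * h) (a + x)) = (\<lambda>x. f (a + x)) * (\<lambda>x. h (a + x))" by auto
  show "left_push A a X (f + h) = left_push A a X f + left_push A a X h"
  proof
    fix b
    show "left_push A a X (f + h) b = (left_push A a X f + left_push A a X h) b"
      unfolding left_push_apply[OF sf_add[OF f h]] * vf_f_add[OF X Lf Lh]
      by (simp add: left_push_apply f h)
  qed
  show "left_push A a X (f * h) = f * left_push A a X h + h * left_push A a X f"
  proof
    fix b
    show "left_push A a X (f * h) b = (f * left_push A a X h + h * left_push A a X f) b"
      unfolding left_push_apply[OF sf_mult[OF f h]] * vf_f_mult[OF X Lf Lh]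
      by (simp add: left_push_apply f h flip: add.assoc)
  qed
qed (simp add: left_push_def)

lemma left_push_bracket:
  assumes X: "X \<in> VF" and Y: "Y \<in> VF"
  shows "left_push A a (lie_bracket X Y) = lie_bracket (left_push A a X) (left_push A a Y)"
proof (rule vf_eqI)
  fix f p assume f: "f \<in> SF"
  have *: "left_push A a Z f \<in> SF" "(\<lambda>x. left_push A a Z f (a + x)) = Z (\<lambda>x. f (a + x))" if "Z \<in> VF" for Z
    by (rule vf_sf[OF vf_left_push[OF that]]) (simp add: left_push_eq f add.assoc[symmetric])
  show "left_push A a (lie_bracket X Y) f p = lie_bracket (left_push A a X) (left_push A a Y) f p"
    by (simp add: lie_bracket_def left_push_apply[OF f] left_push_apply[OF *(1)[OF X]]
      left_push_apply[OF *(1)[OF Y]] *(2)[OF X] *(2)[OF Y])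
qed (intro vf_left_push vf_bracket X Y)+

abbreviation "LI \<equiv> lie_algebra_of A"

lemma li_vf: "X \<in> LI \<Longrightarrow> X \<in> VF"
  by (simp add: lie_algebra_of_def)

lemma li_push: "X \<in> LI \<Longrightarrow> left_push A a X = X"
  by (simp add: lie_algebra_of_def)

lemma liI: "\<lbrakk>X \<in> VF; \<And>a. left_push A a X = X\<rbrakk> \<Longrightarrow> X \<in> LI"
  by (simp add: lie_algebra_of_def)

lemma li_bracket: "\<lbrakk>X \<in> LI; Y \<in> LI\<rbrakk> \<Longrightarrow> lie_bracket X Y \<in> LI"
  by (intro liI) (simp_all add: li_vf vf_bracket left_push_bracket li_push)

lemma li_translate: "X \<in> LI \<Longrightarrow> f \<in> SF \<Longrightarrow> X f a = X (\<lambda>x. f (a + x)) 0"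
  using left_push_apply[of f a X a] li_push[of X a] by simp

lemma li_add: "\<lbrakk>X \<in> LI; Y \<in> LI\<rbrakk> \<Longrightarrow> X + Y \<in> LI"
proof (rule liI)
  assume X: "X \<in> LI" and Y: "Y \<in> LI"
  then show XY: "X + Y \<in> VF" by (intro vf_add li_vf)
  show "left_push A a (X + Y) = X + Y" for a
  proof (rule vf_eqI[OF vf_left_push[OF XY] XY])
    fix f p assume f: "f \<in> SF"
    have "left_push A a (X + Y) f p = left_push A a X f p + left_push A a Y f p"
      by (simp add: left_push_apply[OF f])
    then show "left_push A a (X + Y) f p = (X + Y) f p" by (simp add: li_push X Y)
  qed
qed

lemma li_cscale: "X \<in> LI \<Longrightarrow> (\<lambda>_. c) \<odot> X \<in> LI"
proof (rule liI)
  assume X: "X \<in> LI"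
  then show cX: "(\<lambda>_. c) \<odot> X \<in> VF" by (intro vf_cscale li_vf)
  show "left_push A a ((\<lambda>_. c) \<odot> X) = (\<lambda>_. c) \<odot> X" for a
  proof (rule vf_eqI[OF vf_left_push[OF cX] cX])
    fix f p assume f: "f \<in> SF"
    have "left_push A a ((\<lambda>_. c) \<odot> X) f p = c * left_push A a X f p"
      by (simp add: left_push_apply[OF f] fscale_def)
    then show "left_push A a ((\<lambda>_. c) \<odot> X) f p = ((\<lambda>_. c) \<odot> X) f p"
      by (simp add: li_push X fscale_def)
  qed
qed

lemma li_0: "0 \<in> LI"
  by (rule liI[OF vf_0]) (auto simp: left_push_def fun_eq_iff)

lemma li_uminus: "X \<in> LI \<Longrightarrow> - X \<in> LI"
  using li_cscale[of X "-1"] by (simp add: fscale_def fun_Compl_def times_fun_def)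

lemma li_sum: "(\<And>i. i \<in> I \<Longrightarrow> X i \<in> LI) \<Longrightarrow> (\<Sum>i\<in>I. X i) \<in> LI"
  by (induction I rule: infinite_finite_induct) (auto intro: li_0 li_add)

text \<open>\<open>h\<close> are coordinates near 0. In the last clause they are carried to
  \<open>a\<close> by translation, so the coefficients apply \<open>Y\<close> to a function
  depending on \<open>a\<close>: the expansion is pointwise and does not exhibit them as smooth in
  \<open>a\<close>.\<close>

definition left_invariant_basis :: "('e \<Rightarrow> 'a vfield) \<Rightarrow> ('e \<Rightarrow> 'a \<Rightarrow> real) \<Rightarrow> bool" where
  "left_invariant_basis L h \<longleftrightarrow>
    (\<forall>v. L v \<in> LI) \<and> (\<forall>f a. linear (\<lambda>v. L v f a)) \<and> (\<forall>b. h b \<in> SF) \<and>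
    (\<forall>b\<in>Basis. \<forall>b'\<in>Basis. L b' (h b) 0 = (if b = b' then 1 else 0)) \<and>
    (\<forall>Y\<in>VF. \<forall>f\<in>SF. \<forall>a. Y f a = (\<Sum>b\<in>Basis. Y (\<lambda>x. h b (- a + x)) a * L b f a))"

text \<open>\<open>L v\<close> differentiates the translate of a function at 0 in the direction
  \<open>v\<close>. As a function of the translating point this is a partial derivative of the group
  operation in a product chart, hence smooth. The expansion at \<open>a\<close> is the one at 0,
  transported by translation.\<close>

lemma ex_left_invariant_basis: "\<exists>L h. left_invariant_basis L h"
proof -
  obtain U \<phi> where U: "(U, \<phi>) \<in> A" "0 \<in> U" by (rule chart_at)
  note U' = chart_okD[OF chart[OF U(1)]]
  have q: "\<phi> 0 \<in> \<phi> ` U" using U by blast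
  define D :: "'e \<Rightarrow> ('a \<Rightarrow> real) \<Rightarrow> real" where "D v f = frechet_derivative (f \<circ> inv_into U \<phi>) (at (\<phi> 0)) v" for v f
  have D: "(f \<circ> inv_into U \<phi> has_derivative (\<lambda>v. D v f)) (at (\<phi> 0))" if "f \<in> SF" for f
    unfolding D_def using smooth_on_has_derivative[OF smooth_functions_chart[OF that U(1)] q] .
  have D_unique: "D v f = F v" if "(f \<circ> inv_into U \<phi> has_derivative F) (at (\<phi> 0))" for f F v
    unfolding D_def using frechet_derivative_at[OF that] by simp
  define L where "L v f = (if f \<in> SF then \<lambda>a. D v (\<lambda>x. f (a + x)) else 0)" for v f
  have L0: "L v f 0 = D v f" if "f \<in> SF" for v f using that by (simp add: L_def)
  have LS: "L v f \<in> SF" if f: "f \<in> SF" for v f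
    unfolding smooth_functions_def
  proof clarify
    fix V \<psi> assume V: "(V, \<psi>) \<in> A"
    note V' = chart_okD[OF chart[OF V]]
    let ?F = "\<lambda>z. f (inv_into V \<psi> (fst z) + inv_into U \<phi> (snd z))"
    have F: "smooth_on (\<psi> ` V \<times> \<phi> ` U) ?F" by (rule sf_two_charts[OF f V U(1)])
    have bl: "bounded_linear (\<lambda>x::'e. (x, 0::'e))"
      by (intro bounded_linear_Pair bounded_linear_zero bounded_linear_ident)
    have "smooth_on (\<psi> ` V) (\<lambda>x. (0, \<phi> 0) + (x, 0))"
      by (intro smooth_on_add smooth_on_const smooth_on_linear[OF bl] smooth_on_ident V'(2))
    then have "smooth_on (\<psi> ` V) (\<lambda>x. (x, \<phi> 0))" by simp
    then have "smooth_on (\<psi> ` V) (\<lambda>x. (\<lambda>z. frechet_derivative ?F (at z) (0, v)) (x, \<phi> 0))"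
      by (rule smooth_on_compose[OF V'(2) _ _ _ smooth_on_frechet_derivative[OF F], rotated 2])
        (use U'(2) V'(2) q in \<open>auto intro: open_Times\<close>)
    then show "smooth_on (\<psi> ` V) (L v f \<circ> inv_into V \<psi>)"
    proof (rule smooth_on_cong[OF V'(2)])
      fix x assume x: "x \<in> \<psi> ` V"
      have "((\<lambda>y. (x, y)) has_derivative (\<lambda>v. (0, v))) (at (\<phi> 0))"
        by (auto intro!: derivative_eq_intros)
      moreover have "(?F has_derivative frechet_derivative ?F (at (x, \<phi> 0))) (at (x, \<phi> 0))"
        by (rule smooth_on_has_derivative[OF F]) (use x q in simp)
      ultimately have "((\<lambda>y. ?F (x, y)) has_derivative (\<lambda>v. frechet_derivative ?F (at (x, \<phi> 0)) (0, v))) (at (\<phi> 0))"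
        by (rule has_derivative_compose)
      then have "D v (\<lambda>y. f (inv_into V \<psi> x + y)) = frechet_derivative ?F (at (x, \<phi> 0)) (0, v)"
        by (intro D_unique) (simp add: o_def)
      then show "frechet_derivative ?F (at (x, \<phi> 0)) (0, v) = (L v f \<circ> inv_into V \<psi>) x"
        by (simp add: L_def f)
    qed
  qed
  have LV: "L v \<in> VF" for v
  proof (rule vfI)
    fix f h c assume f: "f \<in> SF"
    note Lf = D[OF sf_translate[OF f]]
    show "L v f \<in> SF" by (rule LS[OF f])
    show "L v (\<lambda>p. c * f p) = (\<lambda>p. c * L v f p)"
    proof
      fix a
      have "D v (\<lambda>x. c * f (a + x)) = c * D v (\<lambda>x. f (a + x))"
        using has_derivative_mult_right[OF Lf] by (intro D_unique) (simp add: o_def)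
      then show "L v (\<lambda>p. c * f p) a = c * L v f a" by (simp add: L_def f sf_cmult)
    qed
    assume h: "h \<in> SF"
    note Lh = D[OF sf_translate[OF h]]
    show "L v (f + h) = L v f + L v h"
    proof
      fix a
      have "D v (\<lambda>x. (f + h) (a + x)) = D v (\<lambda>x. f (a + x)) + D v (\<lambda>x. h (a + x))"
        using has_derivative_add[OF Lf Lh] by (intro D_unique) (simp add: o_def)
      then show "L v (f + h) a = (L v f + L v h) a" by (simp add: L_def f h sf_add)
    qed
    show "L v (f * h) = f * L v h + h * L v f"
    proof
      fix a
      have "D v (\<lambda>x. (f * h) (a + x)) = f a * D v (\<lambda>x. h (a + x)) + D v (\<lambda>x. f (a + x)) * h a"
        using has_derivative_mult[OF Lf Lh] U U'(5) by (intro D_unique) (simp add: o_def)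
      then show "L v (f * h) a = (f * L v h + h * L v f) a" by (simp add: L_def f h sf_mult)
    qed
  qed (simp add: L_def)
  have LL: "L v \<in> LI" for v
  proof (rule liI[OF LV])
    show "left_push A a (L v) = L v" for a
      by (rule vf_eqI[OF vf_left_push[OF LV] LV])
        (simp add: left_push_apply L_def sf_translate flip: add.assoc)
  qed
  have lin: "linear (\<lambda>v. L v f a)" for f a
  proof (cases "f \<in> SF")
    case True
    then show ?thesis
      using has_derivative_linear[OF D[OF sf_translate[OF True, of a]]] by (simp add: L_def)
  next
    case False
    then show ?thesis by (simp add: L_def linear_iff)
  qed
  obtain h where "\<forall>b. h b \<in> SF"
    and "\<forall>b\<in>Basis. \<forall>b'\<in>Basis. D b' (h b) = (if b = b' then 1 else 0)"
    and "\<forall>Y\<in>VF. \<forall>f\<in>SF. Y f 0 = (\<Sum>b\<in>Basis. Y (h b) 0 * D b f)"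
    unfolding D_def by (rule coordinate_functions[OF U]) blast
  note hS = this(1)[rule_format] and hD = this(2)[rule_format] and hY = this(3)[rule_format]
  show ?thesis
    unfolding left_invariant_basis_def
  proof (intro exI[of _ L] exI[of _ h] conjI allI ballI LL lin hS)
    show "L b' (h b) 0 = (if b = b' then 1 else 0)" if "b \<in> Basis" "b' \<in> Basis" for b b'
      using hD[OF that] by (simp add: L0 hS)
    fix Y f a assume Y: "Y \<in> VF" and f: "f \<in> SF"
    have "Y f a = left_push A (- a) Y (\<lambda>x. f (a + x)) 0"
      by (simp add: left_push_apply sf_translate[OF f] flip: add.assoc)
    also have "\<dots> = (\<Sum>b\<in>Basis. left_push A (- a) Y (h b) 0 * D b (\<lambda>x. f (a + x)))"
      by (rule hY[OF vf_left_push[OF Y] sf_translate[OF f]])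
    also have "\<dots> = (\<Sum>b\<in>Basis. Y (\<lambda>x. h b (- a + x)) a * L b f a)"
      by (simp add: left_push_apply hS L_def f)
    finally show "Y f a = (\<Sum>b\<in>Basis. Y (\<lambda>x. h b (- a + x)) a * L b f a)" .
  qed
qed

text \<open>The form in which the basis is used: dimension counts for left-invariant fields, and
  replacement of an arbitrary field at one point by a left-invariant field with the same
  value.\<close>

lemma left_invariant_param:
  obtains L :: "'e \<Rightarrow> 'a vfield" where
    "\<forall>v. L v \<in> LI" "\<forall>f a. linear (\<lambda>v. L v f a)"
    "\<forall>v. (\<forall>f\<in>SF. L v f 0 = 0) \<longrightarrow> v = 0"
    "\<forall>Y\<in>VF. \<forall>a. \<exists>w. \<forall>f\<in>SF. Y f a = L w f a"
    "\<forall>X\<in>LI. \<exists>w. X = L w"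
proof -
  obtain L h where "left_invariant_basis L h" using ex_left_invariant_basis by blast
  then have Lh: "\<forall>v. L v \<in> LI" "\<forall>f a. linear (\<lambda>v. L v f a)" "\<forall>b. h b \<in> SF"
    "\<forall>b\<in>Basis. \<forall>b'\<in>Basis. L b' (h b) 0 = (if b = b' then 1 else 0)"
    "\<forall>Y\<in>VF. \<forall>f\<in>SF. \<forall>a. Y f a = (\<Sum>b\<in>Basis. Y (\<lambda>x. h b (- a + x)) a * L b f a)"
    unfolding left_invariant_basis_def by simp_all
  note L = Lh(1,2)[rule_format] and h = Lh(3,4)[rule_format] and LY = Lh(5)[rule_format]
  have L_sum: "L (\<Sum>b\<in>Basis. c b *\<^sub>R b) f a = (\<Sum>b\<in>Basis. c b * L b f a)" for c f a
    by (simp add: linear_sum[OF L(2)] linear_cmul[OF L(2)])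
  have ex: "\<exists>w. \<forall>f\<in>SF. Y f a = L w f a" if "Y \<in> VF" for Y a
    using LY[OF that] by (intro exI[of _ "\<Sum>b\<in>Basis. Y (\<lambda>x. h b (- a + x)) a *\<^sub>R b"]) (simp add: L_sum)
  have "v = 0" if v: "\<And>f. f \<in> SF \<Longrightarrow> L v f 0 = 0" for v
  proof (rule euclidean_eqI)
    fix b :: 'e assume b: "b \<in> Basis"
    have "0 = L (\<Sum>b\<in>Basis. (v \<bullet> b) *\<^sub>R b) (h b) 0"
      using v[OF h(1)] by (simp add: euclidean_representation)
    also have "\<dots> = (\<Sum>b'\<in>Basis. if b = b' then v \<bullet> b else 0)"
      unfolding L_sum using h(2)[OF b] by (intro sum.cong) auto
    finally show "v \<bullet> b = 0 \<bullet> b" using b by simp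
  qed
  moreover have "\<exists>w. X = L w" if X: "X \<in> LI" for X
  proof -
    obtain w where w: "\<And>f. f \<in> SF \<Longrightarrow> X f 0 = L w f 0" using ex[OF li_vf[OF X]] by blast
    have "X = L w"
    proof (rule vf_eqI[OF li_vf[OF X] li_vf[OF L(1)]])
      fix f p assume f: "f \<in> SF"
      show "X f p = L w f p"
        using w[OF sf_translate[OF f]] li_translate[OF X f] li_translate[OF L(1) f] by simp
    qed
    then show ?thesis ..
  qed
  ultimately show thesis using that L ex by blast
qed

end

locale lie_group_n = lie_group_manifold A
  for A :: "('a::{group_add,t2_space,second_countable_topology}, real^'n) chart set"
begin

text \<open>By Cramer's rule, the determinant of the coordinate matrix of the left-invariant basis times
  \<^term>\<open>W\<close> is a combination of that basis with globally smooth coefficients that vanish at \<^term>\<open>p\<close>.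
  No localisation is needed.\<close>

lemma riemannian_tensorial:
  assumes g: "riemannian_metric A g" and W: "W \<in> VF" and Y: "Y \<in> VF"
    and W0: "\<And>f. f \<in> SF \<Longrightarrow> W f p = 0"
  shows "g W Y p = 0"
proof -
  obtain L h where "left_invariant_basis L h" using ex_left_invariant_basis by blast
  then have Lh: "\<forall>v. L v \<in> LI" "\<forall>f a. linear (\<lambda>v. L v f a)" "\<forall>b. h b \<in> SF"
    "\<forall>b\<in>Basis. \<forall>b'\<in>Basis. L b' (h b) 0 = (if b = b' then 1 else 0)"
    "\<forall>Y\<in>VF. \<forall>f\<in>SF. \<forall>a. Y f a = (\<Sum>b\<in>Basis. Y (\<lambda>x. h b (- a + x)) a * L b f a)"
    unfolding left_invariant_basis_def by simp_all
  note L = Lh(1)[rule_format] and h = Lh(3,4)[rule_format] and LY = Lh(5)[rule_format]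
  define E where "E j = L (axis j 1)" for j :: 'n
  have E: "E j \<in> LI" "E j \<in> VF" for j using L li_vf by (auto simp: E_def)
  define k where "k i x = h (axis i 1) (- p + x)" for i x
  have k: "k i \<in> SF" for i unfolding k_def by (rule sf_translate[OF h(1)])
  have Ek: "E j (k i) p = (if i = j then 1 else 0)" for i j
    unfolding li_translate[OF E(1) k] using h(2)[of "axis i 1" "axis j 1"]
    by (auto simp: E_def k_def axis_eq_axis axis_in_Basis_iff simp flip: add.assoc)
  define M where "M q = (\<chi> i j. E j (k i) q)" for q
  define N where "N l q = (\<chi> i j. if j = l then W (k i) q else E j (k i) q)" for l q
  have det_sf: "(\<lambda>q. det (\<chi> i j. F i j q)) \<in> SF" if "\<And>i j. F i j \<in> SF" for F :: "'n \<Rightarrow> 'n \<Rightarrow> 'a \<Rightarrow> real"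
  proof -
    have "(\<Sum>\<pi>\<in>{\<pi>. \<pi> permutes UNIV}. (\<lambda>_. of_int (sign \<pi>)) * (\<Prod>i\<in>UNIV. F i (\<pi> i))) \<in> SF"
      by (intro sf_sum sf_mult sf_const sf_prod that)
    then show ?thesis
      by (rule back_subst[of "\<lambda>u. u \<in> SF"]) (simp add: fun_eq_iff det_def sum_fun_apply prod_fun_apply)
  qed
  have M: "(\<lambda>q. det (M q)) \<in> SF" unfolding M_def by (intro det_sf vf_sf E)
  have N: "(\<lambda>q. det (N l q)) \<in> SF" for l
    using det_sf[of "\<lambda>i j. if j = l then W (k i) else E j (k i)"] vf_sf[OF W] vf_sf[OF E(2)]
    by (simp add: N_def if_distribR cong: if_cong)
  \<comment> \<open>The coefficient vector \<open>w\<close> depends on \<open>q\<close> without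
    visible smoothness. The determinants are smooth, and only they occur in the global identity
    below.\<close>
  have cramer: "\<exists>w. (\<forall>f\<in>SF. W f q = (\<Sum>l\<in>UNIV. w $ l * E l f q)) \<and> (\<forall>l. det (N l q) = w $ l * det (M q))" for q
  proof -
    define w where "w = (\<chi> l. W (\<lambda>x. h (axis l 1) (- q + x)) q)"
    have w: "W f q = (\<Sum>l\<in>UNIV. w $ l * E l f q)" if "f \<in> SF" for f
      using LY[OF W that, of q]
      by (simp add: w_def E_def Basis_vec_def sum.reindex inj_on_def axis_eq_axis UNION_singleton_eq_range)
    then have "W (k i) q = (M q *v w) $ i" for i
      using k by (simp add: M_def matrix_vector_mult_def mult.commute)
    moreover have "E j (k i) q = M q $ i $ j" for i j by (simp add: M_def)
    ultimately have "N l q = (\<chi> i j. if j = l then (M q *v w) $ i else M q $ i $ j)" for l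
      by (simp only: N_def)
    with cramer_lemma[of _ "M q" w] w show ?thesis by metis
  qed
  have eq: "(\<lambda>q. det (M q)) \<odot> W = (\<Sum>l\<in>UNIV. (\<lambda>q. det (N l q)) \<odot> E l)"
  proof (rule vf_eqI)
    fix f q assume f: "f \<in> SF"
    obtain w where w: "W f q = (\<Sum>l\<in>UNIV. w $ l * E l f q)" "\<And>l. det (N l q) = w $ l * det (M q)"
      using cramer[of q] f by blast
    show "((\<lambda>q. det (M q)) \<odot> W) f q = (\<Sum>l\<in>UNIV. (\<lambda>q. det (N l q)) \<odot> E l) f q"
      by (simp add: fscale_def sum_fun_apply w sum_distrib_left mult_ac)
  qed (intro vf_scale vf_sum M N W E)+
  have gs: "g (u \<odot> X) Y = u * g X Y" if "u \<in> SF" "X \<in> VF" for u X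
    using g that Y unfolding riemannian_metric_def by blast
  have "M p = mat 1" by (simp add: M_def mat_def Ek vec_eq_iff)
  then have Mp: "det (M p) = 1" by simp
  have "det (N l p) = 0" for l
  proof -
    have "column l (N l p) = 0" by (simp add: column_def N_def vec_eq_iff W0 k)
    then show ?thesis by (rule det_zero_column)
  qed
  then have "g (\<Sum>l\<in>UNIV. (\<lambda>q. det (N l q)) \<odot> E l) Y p = 0"
    by (simp add: riemannian_sum[OF g] vf_scale N E Y gs sum_fun_apply)
  then show ?thesis
    unfolding eq[symmetric] by (simp add: gs M W Mp)
qed

end

section \<open>Unitary frames\<close>

lemma fscale_apply: "(h \<odot> X) f p = h p * X f p"
  by (simp add: fscale_def)

locale hermitian_lie_group = lie_group_n A
  for A :: "('a::{group_add,t2_space,second_countable_topology}, real^4) chart set" +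
  fixes J :: "'a vfield \<Rightarrow> 'a vfield" and g :: "'a form2"
  assumes complex: "complex_structure A J" and J_invariant: "left_invariant_endo A J"
    and hermitian: "hermitian_metric A J g" and g_invariant: "left_invariant_metric A g"
begin

lemma riemannian: "riemannian_metric A g"
  using hermitian by (simp add: hermitian_metric_def)

lemma g_sf: "\<lbrakk>X \<in> VF; Y \<in> VF\<rbrakk> \<Longrightarrow> g X Y \<in> SF"
  using riemannian unfolding riemannian_metric_def by blast

lemma g_sym: "\<lbrakk>X \<in> VF; Y \<in> VF\<rbrakk> \<Longrightarrow> g X Y = g Y X"
  using riemannian unfolding riemannian_metric_def by blast

lemma g_add: "\<lbrakk>X \<in> VF; Y \<in> VF; Z \<in> VF\<rbrakk> \<Longrightarrow> g (X + Y) Z p = g X Z p + g Y Z p"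
proof -
  assume "X \<in> VF" "Y \<in> VF" "Z \<in> VF"
  then have "g (X + Y) Z = g X Z + g Y Z" using riemannian unfolding riemannian_metric_def by blast
  then show ?thesis by simp
qed

lemma g_scale: "\<lbrakk>h \<in> SF; X \<in> VF; Y \<in> VF\<rbrakk> \<Longrightarrow> g (h \<odot> X) Y p = h p * g X Y p"
proof -
  assume "h \<in> SF" "X \<in> VF" "Y \<in> VF"
  then have "g (h \<odot> X) Y = h * g X Y" using riemannian unfolding riemannian_metric_def by blast
  then show ?thesis by simp
qed

lemma g_pos: "\<lbrakk>X \<in> VF; X f p \<noteq> 0\<rbrakk> \<Longrightarrow> g X X p > 0"
  using riemannian unfolding riemannian_metric_def by blast

lemma g_add_right: "\<lbrakk>X \<in> VF; Y \<in> VF; Z \<in> VF\<rbrakk> \<Longrightarrow> g Z (X + Y) p = g Z X p + g Z Y p"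
  by (simp add: g_sym[of Z] vf_add g_add)

lemma g_scale_right: "\<lbrakk>h \<in> SF; X \<in> VF; Y \<in> VF\<rbrakk> \<Longrightarrow> g Y (h \<odot> X) p = h p * g Y X p"
  by (simp add: g_sym[of Y] vf_scale g_scale)

lemma uminus_eq_scale: "- X = (\<lambda>_. - 1) \<odot> X" for X :: "'a vfield"
  by (simp add: fscale_def fun_eq_iff)

lemma g_uminus: "\<lbrakk>X \<in> VF; Y \<in> VF\<rbrakk> \<Longrightarrow> g (- X) Y p = - g X Y p"
  by (simp add: uminus_eq_scale g_scale sf_const)

lemma g_uminus_right: "\<lbrakk>X \<in> VF; Y \<in> VF\<rbrakk> \<Longrightarrow> g Y (- X) p = - g Y X p"
  by (simp add: uminus_eq_scale g_scale_right sf_const)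

lemma g_diff: "\<lbrakk>X \<in> VF; Y \<in> VF; Z \<in> VF\<rbrakk> \<Longrightarrow> g (X - Y) Z p = g X Z p - g Y Z p"
  using g_add[of X "- Y" Z p] g_uminus[of Y Z p] vf_uminus by simp

lemma g_diff_right: "\<lbrakk>X \<in> VF; Y \<in> VF; Z \<in> VF\<rbrakk> \<Longrightarrow> g Z (X - Y) p = g Z X p - g Z Y p"
  by (simp add: g_sym[of Z] vf_diff g_diff)

lemma g_sum: "(\<And>i. i \<in> I \<Longrightarrow> X i \<in> VF) \<Longrightarrow> Y \<in> VF \<Longrightarrow> g (\<Sum>i\<in>I. X i) Y p = (\<Sum>i\<in>I. g (X i) Y p)"
  using riemannian_sum[OF riemannian, of I X Y] by (simp add: sum_fun_apply)

lemma J_vf: "X \<in> VF \<Longrightarrow> J X \<in> VF"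
  using complex unfolding complex_structure_def almost_complex_structure_def by blast

lemma J_J: "X \<in> VF \<Longrightarrow> J (J X) = - X"
  using complex unfolding complex_structure_def almost_complex_structure_def by blast

lemma J_add: "\<lbrakk>X \<in> VF; Y \<in> VF\<rbrakk> \<Longrightarrow> J (X + Y) = J X + J Y"
  using complex unfolding complex_structure_def almost_complex_structure_def by blast

lemma J_scale: "\<lbrakk>h \<in> SF; X \<in> VF\<rbrakk> \<Longrightarrow> J (h \<odot> X) = h \<odot> J X"
  using complex unfolding complex_structure_def almost_complex_structure_def by blast

lemma J_uminus: "X \<in> VF \<Longrightarrow> J (- X) = - J X"
  using J_scale[OF sf_const[of "- 1"], of X] by (simp add: uminus_eq_scale)

lemma nijenhuis:
  "\<lbrakk>X \<in> VF; Y \<in> VF\<rbrakk> \<Longrightarrow>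
    lie_bracket (J X) (J Y) - J (lie_bracket (J X) Y) - J (lie_bracket X (J Y)) - lie_bracket X Y = 0"
  using complex unfolding complex_structure_def by blast

lemma g_J_J: "\<lbrakk>X \<in> VF; Y \<in> VF\<rbrakk> \<Longrightarrow> g (J X) (J Y) = g X Y"
  using hermitian unfolding hermitian_metric_def by blast

lemma g_J_right: "\<lbrakk>X \<in> VF; Y \<in> VF\<rbrakk> \<Longrightarrow> g X (J Y) p = - g (J X) Y p"
  using g_J_J[of X "J Y"] J_J[of Y] g_uminus_right[of Y "J X" p] J_vf by simp

lemma g_J_self: "X \<in> VF \<Longrightarrow> g X (J X) p = 0"
  using g_J_right[of X X p] g_sym[of X "J X"] J_vf[of X] by simp

lemma J_li: "X \<in> LI \<Longrightarrow> J X \<in> LI"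
  using J_invariant li_vf li_push J_vf unfolding left_invariant_endo_def by (metis liI)

lemma g_li: "\<lbrakk>X \<in> LI; Y \<in> LI\<rbrakk> \<Longrightarrow> g X Y p = g X Y 0"
  using g_invariant li_vf li_push unfolding left_invariant_metric_def by (metis add.right_neutral)

lemma g_li_const: "\<lbrakk>X \<in> LI; Y \<in> LI\<rbrakk> \<Longrightarrow> g X Y = (\<lambda>_. g X Y 0)"
  using g_li by blast

text \<open>Left-invariance is demanded for every index, so that later facts about
  \<open>e i\<close> need no bound on \<open>i\<close>; \<open>frame_of\<close> accordingly repeats
  its last member.\<close>

definition unitary_frame :: "(nat \<Rightarrow> 'a vfield) \<Rightarrow> bool" where
  "unitary_frame e \<longleftrightarrow> (\<forall>i. e i \<in> LI) \<and> (\<forall>i<4. \<forall>j<4. g (e i) (e j) 0 = (if i = j then 1 else 0)) \<and>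
    J (e 0) = e 1 \<and> J (e 2) = e 3"

definition frame_of :: "'a vfield \<Rightarrow> 'a vfield \<Rightarrow> nat \<Rightarrow> 'a vfield" where
  "frame_of X Y i = (if i = 0 then X else if i = 1 then J X else if i = 2 then Y else J Y)"

lemma frame_of_simps [simp]:
  "frame_of X Y 0 = X" "frame_of X Y 1 = J X" "frame_of X Y (Suc 0) = J X" "frame_of X Y 2 = Y"
  "frame_of X Y 3 = J Y"
  by (simp_all add: frame_of_def)

lemma less_4_cases: "i < 4 \<Longrightarrow> i = 0 \<or> i = 1 \<or> i = 2 \<or> i = (3::nat)"
  by auto

lemma unitary_frame_of:
  assumes X: "X \<in> LI" "g X X 0 = 1" and Y: "Y \<in> LI" "g Y Y 0 = 1" and XY: "g X Y 0 = 0" "g (J X) Y 0 = 0"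
  shows "unitary_frame (frame_of X Y)"
proof -
  note vf = li_vf[OF X(1)] li_vf[OF Y(1)] J_vf[OF li_vf[OF X(1)]] J_vf[OF li_vf[OF Y(1)]]
  have "g (frame_of X Y i) (frame_of X Y j) 0 = (if i = j then 1 else 0)" if "i < 4" "j < 4" for i j
    using less_4_cases[OF that(1)] less_4_cases[OF that(2)] X(2) Y(2) XY
      g_J_self[OF vf(1), of 0] g_J_self[OF vf(2), of 0] g_J_J[OF vf(1) vf(1)] g_J_J[OF vf(1) vf(2)]
      g_J_J[OF vf(2) vf(2)] g_J_right[OF vf(1,2), of 0]
      g_sym[OF vf(1,2)] g_sym[OF vf(1,3)] g_sym[OF vf(1,4)] g_sym[OF vf(2,3)] g_sym[OF vf(2,4)] g_sym[OF vf(3,4)]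
    by (elim disjE) simp_all
  then show ?thesis
    using X(1) Y(1) J_li by (auto simp: unitary_frame_def frame_of_def)
qed

lemma unitary_frame_exI:
  assumes X: "X \<in> LI" "g X X 0 = 1"
  obtains Y where "unitary_frame (frame_of X Y)"
proof -
  obtain L :: "real^4 \<Rightarrow> 'a vfield" where "\<forall>v. L v \<in> LI" "\<forall>f a. linear (\<lambda>v. L v f a)"
    "\<forall>v. (\<forall>f\<in>SF. L v f 0 = 0) \<longrightarrow> v = 0"
    by (rule left_invariant_param) blast
  note L = this[rule_format]
  note vf = li_vf[OF X(1)] J_vf[OF li_vf[OF X(1)]] li_vf[OF L(1)]
  have La: "L (v + w) = L v + L w" for v w
    by (simp add: fun_eq_iff linear_add[OF L(2)])
  have Ls: "L (c *\<^sub>R v) = (\<lambda>_. c) \<odot> L v" for c v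
    by (simp add: fun_eq_iff fscale_apply linear_cmul[OF L(2)])
  \<comment> \<open>The kernel of this map from a 4-dimensional to a 2-dimensional space consists of
    the parameters of fields orthogonal to \<open>X\<close> and \<open>J X\<close>, so it contains a
    nonzero one.\<close>
  define T where "T v = (g (L v) X 0, g (L v) (J X) 0)" for v
  have "linear T"
    by (rule linearI) (simp_all add: T_def La Ls g_add g_scale vf sf_const)
  have "\<not> inj T"
  proof
    assume "inj T"
    then have "dim (range T) = 4"
      using dim_image_eq[OF \<open>linear T\<close>, of UNIV] by simp
    then show False using dim_subset_UNIV[of "range T"] by simp
  qed
  then obtain v where v: "v \<noteq> 0" "T v = 0"
    using linear_injective_0[OF \<open>linear T\<close>] by blast
  from v(1) L(3) obtain f where "L v f 0 \<noteq> 0" by blast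
  with vf(3) have pos: "g (L v) (L v) 0 > 0" by (rule g_pos)
  define c where "c = 1 / sqrt (g (L v) (L v) 0)"
  have c: "c * c * g (L v) (L v) 0 = 1" using pos by (simp add: c_def)
  define Y where "Y = (\<lambda>_. c) \<odot> L v"
  have "unitary_frame (frame_of X Y)"
  proof (rule unitary_frame_of[OF X])
    show "Y \<in> LI" unfolding Y_def by (intro li_cscale L)
    show "g Y Y 0 = 1" using c by (simp add: Y_def g_scale g_scale_right vf_scale vf sf_const mult.assoc)
    show "g X Y 0 = 0" "g (J X) Y 0 = 0"
      using v(2) g_sym[OF vf(1,3), of v] g_sym[OF vf(2,3), of v]
      by (simp_all add: Y_def g_scale_right vf sf_const T_def zero_prod_def)
  qed
  then show thesis by (rule that)
qed

text \<open>A left-invariant field that is nonzero somewhere is nonzero at 0, by translation; there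
  its square length is positive.\<close>

lemma li_normalize:
  assumes "X \<in> LI" "X \<noteq> 0"
  obtains c where "g ((\<lambda>_. c) \<odot> X) ((\<lambda>_. c) \<odot> X) 0 = 1"
proof -
  note X = assms(1) li_vf[OF assms(1)]
  obtain f a where fa: "X f a \<noteq> 0" using assms(2) by (auto simp: fun_eq_iff)
  then have "f \<in> SF" using vf_junk[OF X(2), of f] by fastforce
  then have "X (\<lambda>x. f (a + x)) 0 \<noteq> 0" using fa li_translate[OF X(1)] by simp
  then have "g X X 0 > 0" by (rule g_pos[OF X(2)])
  then show thesis
    by (intro that[of "1 / sqrt (g X X 0)"]) (simp add: g_scale g_scale_right vf_scale X sf_const)
qed

lemma unitary_frame_ex: obtains e where "unitary_frame e"
proof -
  obtain L :: "real^4 \<Rightarrow> 'a vfield" where "\<forall>v. L v \<in> LI" "\<forall>v. (\<forall>f\<in>SF. L v f 0 = 0) \<longrightarrow> v = 0"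
    by (rule left_invariant_param) blast
  note L = this[rule_format]
  have "L (axis 1 1) \<noteq> 0"
    using L(2)[of "axis 1 1"] by (auto simp: axis_eq_0_iff)
  with L(1) obtain c where "g ((\<lambda>_. c) \<odot> L (axis 1 1)) ((\<lambda>_. c) \<odot> L (axis 1 1)) 0 = 1"
    by (rule li_normalize)
  with li_cscale[OF L(1)] show thesis
    by (rule unitary_frame_exI) (rule that)
qed

context
  fixes e :: "nat \<Rightarrow> 'a vfield"
  assumes e: "unitary_frame e"
begin

lemma e_li: "e i \<in> LI"
  using e by (simp add: unitary_frame_def)

lemma e_vf: "e i \<in> VF"
  by (rule li_vf[OF e_li])

lemma g_e_e: "\<lbrakk>i < 4; j < 4\<rbrakk> \<Longrightarrow> g (e i) (e j) p = (if i = j then 1 else 0)"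
  using e g_li[OF e_li e_li, of i j p] by (simp add: unitary_frame_def)

lemma J_e: "J (e 0) = e 1" "J (e 1) = - e 0" "J (e 2) = e 3" "J (e 3) = - e 2"
  using e J_J[OF e_vf] unfolding unitary_frame_def by metis+

text \<open>A unitary frame spans at every point. The argument replaces \<open>Z\<close> at
  \<open>p\<close> by a left-invariant \<open>L w\<close> and shows that a left-invariant field
  orthogonal to the frame is 0.\<close>

lemma vf_vanish:
  assumes Z: "Z \<in> VF" and orth: "\<And>j. j < 4 \<Longrightarrow> g Z (e j) p = 0"
  shows "Z f p = 0"
proof -
  obtain L :: "real^4 \<Rightarrow> 'a vfield" where "\<forall>v. L v \<in> LI" "\<forall>f a. linear (\<lambda>v. L v f a)"
    "\<forall>Y\<in>VF. \<forall>a. \<exists>w. \<forall>f\<in>SF. Y f a = L w f a" "\<forall>X\<in>LI. \<exists>w. X = L w"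
    by (rule left_invariant_param) blast
  note L = this[rule_format]
  note vf = li_vf[OF L(1)]
  have La: "L (v + w) = L v + L w" for v w
    by (simp add: fun_eq_iff linear_add[OF L(2)])
  have Ls: "L (c *\<^sub>R v) = (\<lambda>_. c) \<odot> L v" for c v
    by (simp add: fun_eq_iff fscale_apply linear_cmul[OF L(2)])
  obtain w where w: "\<And>f. f \<in> SF \<Longrightarrow> Z f p = L w f p" using L(3)[OF Z] by blast
  have gw: "g (L w) (e j) 0 = 0" if "j < 4" for j
  proof -
    \<comment> \<open>The metric takes fields, not tangent vectors, as arguments; tensoriality
      justifies using \<open>L w\<close>, which agrees with \<open>Z\<close> only at
      \<open>p\<close>.\<close>
    have "g (Z - L w) (e j) p = 0"
      by (rule riemannian_tensorial[OF riemannian vf_diff[OF Z vf] e_vf]) (simp add: w)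
    then show ?thesis
      using orth[OF that] g_li[OF L(1) e_li, of w j p] by (simp add: g_diff Z vf e_vf)
  qed
  obtain \<iota> where "bij_betw \<iota> {0..<card (UNIV :: 4 set)} (UNIV :: 4 set)"
    using ex_bij_betw_nat_finite[of "UNIV :: 4 set"] by auto
  then have \<iota>: "bij_betw \<iota> {..<4} (UNIV :: 4 set)" by (simp add: atLeast0LessThan)
  \<comment> \<open>\<open>T\<close> sends a parameter to its frame components. It hits every basis
    vector, so it is surjective and, by equality of dimensions, injective.\<close>
  define T where "T v = (\<Sum>i<4. g (L v) (e i) 0 *\<^sub>R (axis (\<iota> i) 1 :: real^4))" for v
  have T: "linear T"
    by (rule linearI)
      (simp_all add: T_def La Ls g_add g_scale vf e_vf sf_const scaleR_add_left sum.distrib scaleR_sum_right)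
  have "\<exists>v. e i = L v" for i using L(4)[OF e_li] .
  then obtain v where v: "\<And>i. e i = L (v i)" by metis
  have "T (v i) = axis (\<iota> i) 1" if "i < 4" for i
  proof -
    have "T (v i) = (\<Sum>j<4. if i = j then axis (\<iota> j) 1 else 0)"
      unfolding T_def v[symmetric] by (intro sum.cong) (auto simp: g_e_e that)
    then show ?thesis using that by simp
  qed
  then have "range T \<supseteq> Basis"
    using \<iota> unfolding Basis_vec_def bij_betw_def by (auto simp: image_iff) (metis UNIV_I imageE lessThan_iff)
  then have "span (range T) = UNIV"
    using span_mono[of Basis "range T"] span_Basis by auto
  then have "surj T"
    using linear_subspace_image[OF T subspace_UNIV] by (metis span_eq_iff)
  then have "inj T" using linear_surjective_imp_injective[OF T] by simp
  moreover have "T w = 0" by (simp add: T_def gw)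
  ultimately have "w = 0" using linear_injective_0[OF T] by blast
  then have "L w f p = 0" using linear_0[OF L(2)] by simp
  with w show ?thesis using vf_junk[OF Z, of f] by (cases "f \<in> SF") auto
qed

lemma frame_expand: "X \<in> VF \<Longrightarrow> X = (\<Sum>i<4. g X (e i) \<odot> e i)"
proof -
  assume X: "X \<in> VF"
  let ?S = "\<Sum>i<4. g X (e i) \<odot> e i"
  have S: "?S \<in> VF" by (intro vf_sum vf_scale g_sf X e_vf)
  have "(X - ?S) f p = 0" for f p
  proof (rule vf_vanish[OF vf_diff[OF X S]])
    fix j :: nat assume j: "j < 4"
    have "g ?S (e j) p = (\<Sum>i<4. g X (e i) p * g (e i) (e j) p)"
      by (simp add: g_sum vf_scale g_sf X e_vf g_scale)
    also have "\<dots> = (\<Sum>i<4. if j = i then g X (e i) p else 0)"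
      by (intro sum.cong) (auto simp: g_e_e j)
    finally show "g (X - ?S) (e j) p = 0"
      using j by (simp add: g_diff X S e_vf)
  qed
  then show "X = ?S" by (simp add: fun_eq_iff)
qed

lemma vf_eq_0: "X \<in> VF \<Longrightarrow> (\<And>i p. i < 4 \<Longrightarrow> g X (e i) p = 0) \<Longrightarrow> X = 0"
  using vf_vanish by (simp add: fun_eq_iff)

text \<open>\<open>F\<close> stands for one slot of a tensor evaluated at \<open>p\<close>: it
  scales by the value of \<open>h\<close> at \<open>p\<close> alone.\<close>

lemma tensor_expand:
  fixes F :: "'a vfield \<Rightarrow> real"
  assumes add: "\<And>X Y. \<lbrakk>X \<in> VF; Y \<in> VF\<rbrakk> \<Longrightarrow> F (X + Y) = F X + F Y"
    and scale: "\<And>h X. \<lbrakk>h \<in> SF; X \<in> VF\<rbrakk> \<Longrightarrow> F (h \<odot> X) = h p * F X" and X: "X \<in> VF"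
  shows "F X = (\<Sum>i<4. g X (e i) p * F (e i))"
proof -
  have F0: "F 0 = 0" using add[OF vf_0 vf_0] by simp
  have "F (\<Sum>i\<in>I. Z i) = (\<Sum>i\<in>I. F (Z i))" if "\<And>i. i \<in> I \<Longrightarrow> Z i \<in> VF" for I and Z :: "nat \<Rightarrow> 'a vfield"
    using that by (induction I rule: infinite_finite_induct) (auto simp: F0 add vf_sum)
  then have "F (\<Sum>i<4. g X (e i) \<odot> e i) = (\<Sum>i<4. F (g X (e i) \<odot> e i))"
    by (simp add: vf_scale g_sf X e_vf)
  also have "\<dots> = (\<Sum>i<4. g X (e i) p * F (e i))"
    by (simp add: scale g_sf X e_vf)
  finally show ?thesis using frame_expand[OF X] by simp
qed

lemma li_expand: "X \<in> LI \<Longrightarrow> X = (\<Sum>i<4. (\<lambda>_. g X (e i) 0) \<odot> e i)"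
  using frame_expand[OF li_vf] g_li_const[OF _ e_li] by simp

text \<open>The variant for maps such as brackets and \<open>D\<close>, which are linear over
  constants but not over functions in the slot concerned, and which are therefore restricted to
  left-invariant fields.\<close>

lemma li_functional_expand:
  fixes F :: "'a vfield \<Rightarrow> real"
  assumes add: "\<And>X Y. \<lbrakk>X \<in> LI; Y \<in> LI\<rbrakk> \<Longrightarrow> F (X + Y) = F X + F Y"
    and scale: "\<And>c X. X \<in> LI \<Longrightarrow> F ((\<lambda>_. c) \<odot> X) = c * F X" and X: "X \<in> LI"
  shows "F X = (\<Sum>i<4. g X (e i) 0 * F (e i))"
proof -
  have F0: "F 0 = 0" using add[OF li_0 li_0] by simp
  have "F (\<Sum>i\<in>I. Z i) = (\<Sum>i\<in>I. F (Z i))" if "\<And>i. i \<in> I \<Longrightarrow> Z i \<in> LI" for I and Z :: "nat \<Rightarrow> 'a vfield"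
    using that by (induction I rule: infinite_finite_induct) (auto simp: F0 add li_sum)
  then have "F (\<Sum>i<4. (\<lambda>_. g X (e i) 0) \<odot> e i) = (\<Sum>i<4. F ((\<lambda>_. g X (e i) 0) \<odot> e i))"
    by (simp add: li_cscale e_li)
  also have "\<dots> = (\<Sum>i<4. g X (e i) 0 * F (e i))"
    by (simp add: scale e_li)
  finally show ?thesis using li_expand[OF X] by simp
qed

end

end

section \<open>The Bismut connection\<close>

lemma (in smooth_manifold) jacobi:
  assumes "X \<in> VF" "Y \<in> VF" "Z \<in> VF"
  shows "lie_bracket (lie_bracket X Y) Z + lie_bracket (lie_bracket Y Z) X + lie_bracket (lie_bracket Z X) Y = 0"
proof
  fix f :: "'a \<Rightarrow> real"
  have sf: "U (V f) \<in> SF" if "U \<in> VF" for U V :: "'a vfield" using that by (rule vf_sf)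
  have "lie_bracket (lie_bracket U V) W f = (U (V (W f)) - V (U (W f))) - (W (U (V f)) - W (V (U f)))"
    if "U \<in> VF" "V \<in> VF" "W \<in> VF" for U V W :: "'a vfield"
    using that by (simp add: lie_bracket_def vf_f_diff sf fun_eq_iff)
  with assms show "(lie_bracket (lie_bracket X Y) Z + lie_bracket (lie_bracket Y Z) X
      + lie_bracket (lie_bracket Z X) Y) f = 0 f"
    by (simp add: fun_eq_iff)
qed

lemmas fun_ops = plus_fun_apply minus_apply uminus_apply zero_fun_apply times_fun_apply

lemma lie_bracket_antisym: "lie_bracket X Y = - lie_bracket Y X"
  by (simp add: lie_bracket_def fun_eq_iff)

context lie_group_manifold
begin

lemma li_diff: "\<lbrakk>X \<in> LI; Y \<in> LI\<rbrakk> \<Longrightarrow> X - Y \<in> LI"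
  using li_add[of X "- Y"] li_uminus[of Y] by simp

lemma bracket_add: "\<lbrakk>X \<in> VF; Y \<in> VF; Z \<in> VF\<rbrakk> \<Longrightarrow> lie_bracket (X + Y) Z = lie_bracket X Z + lie_bracket Y Z"
proof -
  assume *: "X \<in> VF" "Y \<in> VF" "Z \<in> VF"
  have "Z (X f + Y f) p = Z (X f) p + Z (Y f) p" for f p
    using vf_f_add[of Z "X f" "Y f"] * vf_sf by simp
  then show ?thesis by (simp add: fun_eq_iff lie_bracket_def)
qed

end

locale bismut_lie_group = hermitian_lie_group A J g
  for A :: "('a::{group_add,t2_space,second_countable_topology}, real^4) chart set" and J g +
  fixes D :: "'a vfield \<Rightarrow> 'a vfield \<Rightarrow> 'a vfield"
  assumes bismut: "bismut_connection A J g D"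
begin

lemma connection: "connection A D"
  using bismut by (simp add: bismut_connection_def metric_connection_def)

lemma D_vf: "\<lbrakk>X \<in> VF; Y \<in> VF\<rbrakk> \<Longrightarrow> D X Y \<in> VF"
  using connection unfolding connection_def by blast

lemma D_add_left: "\<lbrakk>X \<in> VF; Y \<in> VF; Z \<in> VF\<rbrakk> \<Longrightarrow> D (X + Y) Z = D X Z + D Y Z"
  using connection unfolding connection_def by blast

lemma D_add_right: "\<lbrakk>X \<in> VF; Y \<in> VF; Z \<in> VF\<rbrakk> \<Longrightarrow> D X (Y + Z) = D X Y + D X Z"
  using connection unfolding connection_def by blast

lemma D_scale_left: "\<lbrakk>h \<in> SF; X \<in> VF; Y \<in> VF\<rbrakk> \<Longrightarrow> D (h \<odot> X) Y = h \<odot> D X Y"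
  using connection unfolding connection_def by blast

lemma D_scale_right: "\<lbrakk>h \<in> SF; X \<in> VF; Y \<in> VF\<rbrakk> \<Longrightarrow> D X (h \<odot> Y) = X h \<odot> Y + h \<odot> D X Y"
  using connection unfolding connection_def by blast

lemma D_metric: "\<lbrakk>X \<in> VF; Y \<in> VF; Z \<in> VF\<rbrakk> \<Longrightarrow> X (g Y Z) p = g (D X Y) Z p + g Y (D X Z) p"
proof -
  assume "X \<in> VF" "Y \<in> VF" "Z \<in> VF"
  then have "X (g Y Z) = g (D X Y) Z + g Y (D X Z)"
    using bismut unfolding bismut_connection_def metric_connection_def by blast
  then show ?thesis by simp
qed

lemma D_J: "\<lbrakk>X \<in> VF; Y \<in> VF\<rbrakk> \<Longrightarrow> D X (J Y) = J (D X Y)"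
  using bismut unfolding bismut_connection_def by blast

section \<open>The torsion form and its left-invariance\<close>

abbreviation "T \<equiv> torsion D"
abbreviation "tau \<equiv> torsion_form g D"

lemma T_vf: "\<lbrakk>X \<in> VF; Y \<in> VF\<rbrakk> \<Longrightarrow> T X Y \<in> VF"
  unfolding torsion_def by (intro vf_diff D_vf vf_bracket)

lemma tau_skew:
  assumes "X \<in> VF" "Y \<in> VF" "Z \<in> VF"
  shows "tau Y X Z p = - tau X Y Z p" "tau X Z Y p = - tau X Y Z p"
proof -
  have "tau Y X Z = - tau X Y Z" "tau X Z Y = - tau X Y Z"
    using bismut assms unfolding bismut_connection_def by blast+
  then show "tau Y X Z p = - tau X Y Z p" "tau X Z Y p = - tau X Y Z p" by simp_all
qed

lemma tau_uminus:
  assumes "X \<in> VF" "Y \<in> VF" "Z \<in> VF"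
  shows "tau (- X) Y Z p = - tau X Y Z p" "tau X (- Y) Z p = - tau X Y Z p" "tau X Y (- Z) p = - tau X Y Z p"
proof -
  have 1: "tau (- X) Y Z p = - tau X Y Z p" if "X \<in> VF" "Y \<in> VF" "Z \<in> VF" for X Y Z
    unfolding torsion_form_def using that by (simp add: g_uminus T_vf)
  have 2: "tau X (- Y) Z p = - tau X Y Z p" if "X \<in> VF" "Y \<in> VF" "Z \<in> VF" for X Y Z
    using tau_skew(1)[of X "- Y" Z p] tau_skew(1)[of X Y Z p] 1[of Y X Z] that vf_uminus by simp
  show "tau (- X) Y Z p = - tau X Y Z p" by (rule 1[OF assms])
  show "tau X (- Y) Z p = - tau X Y Z p" by (rule 2[OF assms])
  show "tau X Y (- Z) p = - tau X Y Z p"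
    using tau_skew(2)[of X Y "- Z" p] tau_skew(2)[of X Y Z p] 2[of X Z Y] assms vf_uminus by simp
qed

lemma g_bracket:
  assumes "X \<in> VF" "Y \<in> VF" "Z \<in> VF"
  shows "g Z (lie_bracket X Y) p = g Z (D X Y) p - g Z (D Y X) p - tau Z X Y p"
proof -
  have "lie_bracket X Y = D X Y - D Y X - T X Y" by (simp add: torsion_def)
  then show ?thesis
    using assms by (simp add: torsion_form_def g_diff_right vf_diff D_vf T_vf)
qed

lemma g_bracket_left:
  assumes "X \<in> VF" "Y \<in> VF" "Z \<in> VF"
  shows "g (lie_bracket X Y) Z p = g Z (D X Y) p - g Z (D Y X) p - tau Z X Y p"
  using g_bracket[OF assms] g_sym[of Z "lie_bracket X Y"] vf_bracket assms by simp

lemma fundamental_deriv: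
  assumes "X \<in> VF" "Y \<in> VF" "Z \<in> VF"
  shows "X (fundamental_form J g Y Z) p = g (J Z) (D X Y) p - g (J Y) (D X Z) p"
proof -
  have "fundamental_form J g Y Z = g Y (J Z)" by (rule ext) (simp add: fundamental_form_def)
  then show ?thesis
    using assms D_metric[of X Y "J Z" p] g_J_right[of Y "D X Z" p] g_sym[of "D X Y" "J Z"]
    by (simp add: J_vf D_J D_vf)
qed

text \<open>The fundamental form is parallel for \<open>D\<close>, so all connection terms in its
  exterior derivative cancel and only torsion is left.\<close>

lemma ext_deriv2_fundamental:
  assumes "X \<in> VF" "Y \<in> VF" "Z \<in> VF"
  shows "ext_deriv2 (fundamental_form J g) X Y Z p = tau (J X) Y Z p + tau X (J Y) Z p + tau X Y (J Z) p"
proof -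
  note vf = assms J_vf[OF assms(1)] J_vf[OF assms(2)] J_vf[OF assms(3)]
  have "ext_deriv2 (fundamental_form J g) X Y Z p =
    tau (J Z) X Y p - tau (J Y) X Z p + tau (J X) Y Z p"
    by (simp add: ext_deriv2_def fundamental_deriv vf fundamental_form_def[of J g "lie_bracket _ _"]
      g_bracket_left)
  then show ?thesis
    using tau_skew(1)[OF vf(1,5,3), of p] tau_skew(1)[OF vf(1,6,2), of p] tau_skew(2)[OF vf(1,2,6), of p] by simp
qed

text \<open>Because \<open>J\<close> is parallel, the connection terms also cancel in the Nijenhuis
  tensor. The resulting identity says that the torsion form has no part of type (3,0) or
  (0,3).\<close>

lemma tau_nijenhuis:
  assumes "X \<in> VF" "Y \<in> VF" "Z \<in> VF"
  shows "tau Z X Y p = tau Z (J X) (J Y) p + tau (J Z) (J X) Y p + tau (J Z) X (J Y) p"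
proof -
  note vf = assms J_vf[OF assms(1)] J_vf[OF assms(2)] J_vf[OF assms(3)]
  have "g Z (lie_bracket (J X) (J Y) - J (lie_bracket (J X) Y) - J (lie_bracket X (J Y)) - lie_bracket X Y) p = 0"
    unfolding nijenhuis[OF assms(1,2)] using g_add_right[OF vf_0 vf_0 assms(3), of p] by simp
  then have "g Z (lie_bracket (J X) (J Y)) p + g (J Z) (lie_bracket (J X) Y) p
      + g (J Z) (lie_bracket X (J Y)) p - g Z (lie_bracket X Y) p = 0"
    by (simp add: g_diff_right vf vf_diff J_vf vf_bracket g_J_right)
  then show ?thesis
    by (simp add: g_bracket vf D_J D_vf g_J_right g_J_J)
qed

text \<open>In particular the torsion form does not depend on the Bismut connection.\<close>

lemma tau_eq:
  assumes "X \<in> VF" "Y \<in> VF" "Z \<in> VF"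
  shows "tau X Y Z p = - ext_deriv2 (fundamental_form J g) (J X) (J Y) (J Z) p"
proof -
  note vf = assms J_vf[OF assms(1)] J_vf[OF assms(2)] J_vf[OF assms(3)]
  show ?thesis
    using tau_nijenhuis[OF assms(2,3,1), of p]
    by (simp add: ext_deriv2_fundamental vf J_J tau_uminus)
qed

lemma vf_g_li: "\<lbrakk>X \<in> VF; Y \<in> LI; Z \<in> LI\<rbrakk> \<Longrightarrow> X (g Y Z) = 0"
  by (subst g_li_const, assumption, assumption, rule vf_f_const)

lemma g_D_li:
  assumes "X \<in> LI" "Y \<in> LI" "Z \<in> LI"
  shows "g (D X Y) Z p = - g Y (D X Z) p"
  using D_metric[of X Y Z p] vf_g_li[of X Y Z] assms by (simp add: li_vf)

text \<open>Left-invariance of \<open>D\<close> is not part of its definition. It is derived from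
  the fact that \<open>tau\<close> is given by d omega, which is computed from left-invariant
  data.\<close>

lemma tau_li:
  assumes "X \<in> LI" "Y \<in> LI" "Z \<in> LI"
  shows "tau X Y Z p = tau X Y Z 0"
proof -
  have 1: "fundamental_form J g Y Z = (\<lambda>_. g Y (J Z) 0)" if "Y \<in> LI" "Z \<in> LI" for Y Z
    using g_li[OF that(1) J_li[OF that(2)]] by (auto simp: fundamental_form_def)
  have "ext_deriv2 (fundamental_form J g) X Y Z p = ext_deriv2 (fundamental_form J g) X Y Z 0"
    if "X \<in> LI" "Y \<in> LI" "Z \<in> LI" for X Y Z
    using that by (simp add: ext_deriv2_def 1 li_bracket vf_f_const li_vf)
  then show ?thesis using assms J_li li_vf by (simp add: tau_eq)
qed

text \<open>A Koszul formula with torsion: metric compatibility and the known torsion express the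
  components of \<open>D X Y\<close> by brackets and \<open>tau\<close>, all of them
  constant.\<close>

lemma D_li:
  assumes X: "X \<in> LI" and Y: "Y \<in> LI"
  shows "D X Y \<in> LI"
proof -
  define b where "b X Y Z = g (lie_bracket X Y) Z 0 + tau Z X Y 0" for X Y Z
  have 1: "g (D X Y) Z p = g (D Y X) Z p + b X Y Z" if "X \<in> LI" "Y \<in> LI" "Z \<in> LI" for X Y Z p
    using g_bracket_left[of X Y Z p] g_li[OF li_bracket[OF that(1,2)] that(3), of p]
      tau_li[OF that(3,1,2), of p] g_sym[of Z "D X Y"] g_sym[of Z "D Y X"] that
    by (simp add: b_def li_vf D_vf)
  have 2: "g (D X Y) Z p = - g (D X Z) Y p" if "X \<in> LI" "Y \<in> LI" "Z \<in> LI" for X Y Z p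
    using g_D_li[OF that, of p] g_sym[of Y "D X Z"] that by (simp add: li_vf D_vf)
  \<comment> \<open>\<open>1\<close> exchanges the first two fields at the cost of \<open>b\<close>,
    and \<open>2\<close> exchanges the last two with a sign. Going round all six orders returns to
    the start with the opposite sign.\<close>
  have const: "2 * g (D X Y) Z p = b X Y Z - b Y Z X + b Z X Y" if Z: "Z \<in> LI" for Z p
    using 1[OF X Y Z, of p] 2[OF Y X Z, of p] 1[OF Y Z X, of p] 2[OF Z Y X, of p] 1[OF Z X Y, of p]
      2[OF X Z Y, of p] by linarith
  obtain e where e: "unitary_frame e" by (rule unitary_frame_ex)
  have "g (D X Y) (e i) = (\<lambda>_. g (D X Y) (e i) 0)" for i
  proof
    show "g (D X Y) (e i) p = g (D X Y) (e i) 0" for p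
      using const[OF e_li[OF e], of i p] const[OF e_li[OF e], of i 0] by simp
  qed
  then have "D X Y = (\<Sum>i<4. (\<lambda>_. g (D X Y) (e i) 0) \<odot> e i)"
    using frame_expand[OF e D_vf[OF li_vf[OF X] li_vf[OF Y]]] by simp
  also have "\<dots> \<in> LI" by (intro li_sum li_cscale e_li[OF e])
  finally show ?thesis .
qed

lemma fscale_bracket_left:
  assumes "h \<in> SF" "X \<in> VF" "Y \<in> VF"
  shows "lie_bracket (h \<odot> X) Y = h \<odot> lie_bracket X Y - Y h \<odot> X"
proof
  fix f
  show "lie_bracket (h \<odot> X) Y f = (h \<odot> lie_bracket X Y - Y h \<odot> X) f"
    using assms vf_f_mult[OF assms(3,1) vf_sf[OF assms(2)], of f]
    by (simp add: lie_bracket_def fscale_def fun_eq_iff algebra_simps)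
qed

lemma D_diff_left: "\<lbrakk>X \<in> VF; Y \<in> VF; Z \<in> VF\<rbrakk> \<Longrightarrow> D (X - Y) Z = D X Z - D Y Z"
  using D_add_left[of "X - Y" Y Z] vf_diff[of X Y] by (simp add: algebra_simps)

lemma D_uminus_left: "\<lbrakk>X \<in> VF; Y \<in> VF\<rbrakk> \<Longrightarrow> D (- X) Y = - D X Y"
  using D_scale_left[OF sf_const[of "-1"], of X Y] by (simp add: uminus_eq_scale)

section \<open>Curvature and the independence of its trace from the frame\<close>

abbreviation "R \<equiv> curvature D"

lemma R_vf: "\<lbrakk>X \<in> VF; Y \<in> VF; Z \<in> VF\<rbrakk> \<Longrightarrow> R X Y Z \<in> VF"
  unfolding curvature_def by (intro vf_diff D_vf vf_bracket)

lemma R_antisym: "\<lbrakk>X \<in> VF; Y \<in> VF; Z \<in> VF\<rbrakk> \<Longrightarrow> R X Y Z = - R Y X Z"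
proof -
  assume "X \<in> VF" "Y \<in> VF" "Z \<in> VF"
  then have "D (lie_bracket X Y) Z = - D (lie_bracket Y X) Z"
    using D_uminus_left[OF vf_bracket[of Y X], of Z] lie_bracket_antisym[of X Y] by metis
  then show ?thesis by (simp add: curvature_def fun_eq_iff)
qed

lemma R_add_left:
  "\<lbrakk>X \<in> VF; X' \<in> VF; Y \<in> VF; Z \<in> VF\<rbrakk> \<Longrightarrow> R (X + X') Y Z = R X Y Z + R X' Y Z"
  by (simp add: curvature_def bracket_add D_add_left D_add_right D_vf vf_bracket)

lemma R_scale_left:
  assumes "h \<in> SF" "X \<in> VF" "Y \<in> VF" "Z \<in> VF"
  shows "R (h \<odot> X) Y Z = h \<odot> R X Y Z"
proof -
  have "D (lie_bracket (h \<odot> X) Y) Z = h \<odot> D (lie_bracket X Y) Z - Y h \<odot> D X Z"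
    using assms by (simp add: fscale_bracket_left D_diff_left D_scale_left vf_scale vf_bracket vf_sf)
  then show ?thesis
    using assms by (simp add: curvature_def D_scale_left D_scale_right D_vf fun_eq_iff fscale_apply algebra_simps)
qed

lemma R_add_right:
  "\<lbrakk>X \<in> VF; Y \<in> VF; Z \<in> VF; Z' \<in> VF\<rbrakk> \<Longrightarrow> R X Y (Z + Z') = R X Y Z + R X Y Z'"
  by (simp add: curvature_def D_add_right D_vf vf_bracket)

text \<open>The derivatives of \<open>h\<close> cancel because the bracket is the commutator of
  derivations.\<close>

lemma R_scale_right:
  assumes "h \<in> SF" "X \<in> VF" "Y \<in> VF" "Z \<in> VF"
  shows "R X Y (h \<odot> Z) = h \<odot> R X Y Z"
proof -
  have 1: "D (lie_bracket X Y) (h \<odot> Z) = (X (Y h) - Y (X h)) \<odot> Z + h \<odot> D (lie_bracket X Y) Z"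
    unfolding D_scale_right[OF assms(1) vf_bracket[OF assms(2,3)] assms(4)]
    by (simp add: fun_eq_iff lie_bracket_def[of X Y, THEN fun_cong, of h])
  have 2: "D X (D Y (h \<odot> Z)) = X (Y h) \<odot> Z + Y h \<odot> D X Z + (X h \<odot> D Y Z + h \<odot> D X (D Y Z))"
    if "X \<in> VF" "Y \<in> VF" for X Y
    using assms that by (simp add: D_scale_right D_add_right vf_scale D_vf vf_sf del: plus_fun_apply)
  show ?thesis
    unfolding curvature_def 1 2[OF assms(2,3)] 2[OF assms(3,2)]
    by (simp add: fun_eq_iff fscale_apply algebra_simps)
qed

text \<open>\<open>ricci_form\<close> with the chosen frame turned into an argument, so that
  independence of the choice can be stated.\<close>

definition ricci_trace :: "(nat \<Rightarrow> 'a vfield) \<Rightarrow> 'a vfield \<Rightarrow> 'a vfield \<Rightarrow> 'a \<Rightarrow> real" where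
  "ricci_trace E X Y p = 1 / 2 * (\<Sum>k<4. g (R X Y (E k)) (J (E k)) p)"

text \<open>The chosen frame need not be left-invariant; only its transition matrix \<open>M\<close>
  at \<open>p\<close> matters. Orthonormality says that the rows of \<open>M\<close> are
  orthonormal, hence so are its columns, and the column relations collapse the expanded
  trace.\<close>

lemma ricci_trace_frame:
  assumes e: "unitary_frame e" and E: "local_orthonormal_frame A g p E" and X: "X \<in> VF" and Y: "Y \<in> VF"
  shows "ricci_trace E X Y p = ricci_trace e X Y p"
proof -
  have E: "E k \<in> VF" if "k < 4" for k using E that by (auto simp: local_orthonormal_frame_def)
  have E1: "g (E i) (E j) p = (if i = j then 1 else 0)" if "i < 4" "j < 4" for i j
    using assms(2) that unfolding local_orthonormal_frame_def by auto
  note e' = e_vf[OF e]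
  define Q where "Q Z W = g (R X Y Z) (J W) p" for Z W
  have Q1: "Q Z W = (\<Sum>l<4. g Z (e l) p * Q (e l) W)" if "Z \<in> VF" "W \<in> VF" for Z W
    unfolding Q_def using that X Y
    by (intro tensor_expand[OF e]) (simp_all add: R_add_right R_scale_right g_add g_scale R_vf J_vf del: fun_ops)
  have Q2: "Q Z W = (\<Sum>l<4. g W (e l) p * Q Z (e l))" if "Z \<in> VF" "W \<in> VF" for Z W
    unfolding Q_def using that X Y
    by (intro tensor_expand[OF e]) (simp_all add: J_add J_scale g_add_right g_scale_right R_vf J_vf del: fun_ops)
  obtain \<iota> where "bij_betw \<iota> {0..<card (UNIV :: 4 set)} (UNIV :: 4 set)"
    using ex_bij_betw_nat_finite[of "UNIV :: 4 set"] by auto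
  then have \<iota>: "bij_betw \<iota> {..<4} (UNIV :: 4 set)" by (simp add: atLeast0LessThan)
  \<comment> \<open>This bijection carries frame indices to the index type of square matrices, where
    a one-sided inverse is two-sided.\<close>
  define \<kappa> where "\<kappa> = inv_into {..<4} \<iota>"
  have \<kappa>: "bij_betw \<kappa> (UNIV :: 4 set) {..<4}" unfolding \<kappa>_def by (rule bij_betw_inv_into[OF \<iota>])
  have \<kappa>4: "\<kappa> i < 4" for i using \<kappa> by (auto simp: bij_betw_def)
  have \<kappa>_inj: "\<kappa> i = \<kappa> j \<longleftrightarrow> i = j" for i j using \<kappa> by (auto simp: bij_betw_def inj_on_def)
  have \<kappa>_sum: "(\<Sum>i\<in>UNIV. F (\<kappa> i)) = (\<Sum>k<4. F k)" for F :: "nat \<Rightarrow> real"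
    by (rule sum.reindex_bij_betw[OF \<kappa>])
  define M where "M = (\<chi> i j. g (E (\<kappa> i)) (e (\<kappa> j)) p)"
  have "M ** transpose M = mat 1"
  proof -
    have "(\<Sum>l<4. g (E (\<kappa> i)) (e l) p * g (E (\<kappa> j)) (e l) p) = (if i = j then 1 else 0)" for i j
    proof -
      have "g (E (\<kappa> i)) (E (\<kappa> j)) p = (\<Sum>l<4. g (E (\<kappa> i)) (e l) p * g (e l) (E (\<kappa> j)) p)"
        by (rule tensor_expand[OF e]) (simp_all add: g_add g_scale E \<kappa>4 del: fun_ops)
      then show ?thesis using E1[OF \<kappa>4 \<kappa>4] \<kappa>_inj g_sym[OF e' E[OF \<kappa>4]] by simp
    qed
    then show ?thesis
      by (simp add: M_def matrix_matrix_mult_def transpose_def mat_def vec_eq_iff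
        \<kappa>_sum[of "\<lambda>l. g (E (\<kappa> _)) (e l) p * g (E (\<kappa> _)) (e l) p"])
  qed
  then have "transpose M ** M = mat 1" by (simp add: matrix_left_right_inverse)
  then have orth: "(\<Sum>k<4. g (E k) (e (\<kappa> l)) p * g (E k) (e (\<kappa> m)) p) = (if l = m then 1 else 0)" for l m
    by (simp add: M_def matrix_matrix_mult_def transpose_def mat_def vec_eq_iff
      \<kappa>_sum[of "\<lambda>k. g (E k) (e (\<kappa> _)) p * g (E k) (e (\<kappa> _)) p"])
  have "(\<Sum>k<4. Q (E k) (E k)) = (\<Sum>k<4. \<Sum>l<4. \<Sum>m<4. g (E k) (e l) p * g (E k) (e m) p * Q (e l) (e m))"
  proof (intro sum.cong refl)
    fix k :: nat assume "k \<in> {..<4}"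
    then have Ek: "E k \<in> VF" using E by simp
    have "Q (E k) (E k) = (\<Sum>l<4. g (E k) (e l) p * Q (e l) (E k))" by (rule Q1[OF Ek Ek])
    also have "\<dots> = (\<Sum>l<4. g (E k) (e l) p * (\<Sum>m<4. g (E k) (e m) p * Q (e l) (e m)))"
      using Q2[OF e' Ek] by simp
    finally show "Q (E k) (E k) = (\<Sum>l<4. \<Sum>m<4. g (E k) (e l) p * g (E k) (e m) p * Q (e l) (e m))"
      by (simp add: sum_distrib_left mult.assoc)
  qed
  also have "\<dots> = (\<Sum>l<4. \<Sum>k<4. \<Sum>m<4. g (E k) (e l) p * g (E k) (e m) p * Q (e l) (e m))"
    by (rule sum.swap)
  also have "\<dots> = (\<Sum>l<4. \<Sum>m<4. \<Sum>k<4. g (E k) (e l) p * g (E k) (e m) p * Q (e l) (e m))"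
    by (intro sum.cong refl sum.swap)
  also have "\<dots> = (\<Sum>l\<in>UNIV. \<Sum>m\<in>UNIV. \<Sum>k<4.
      g (E k) (e (\<kappa> l)) p * g (E k) (e (\<kappa> m)) p * Q (e (\<kappa> l)) (e (\<kappa> m)))"
    by (simp add: \<kappa>_sum[of "\<lambda>m. \<Sum>k<4. g (E k) (e _) p * g (E k) (e m) p * Q (e _) (e m)"]
        \<kappa>_sum[of "\<lambda>l. \<Sum>m<4. \<Sum>k<4. g (E k) (e l) p * g (E k) (e m) p * Q (e l) (e m)"])
  also have "\<dots> = (\<Sum>l\<in>UNIV. \<Sum>m\<in>UNIV. (if l = m then 1 else 0) * Q (e (\<kappa> l)) (e (\<kappa> m)))"
    by (simp add: orth flip: sum_distrib_right)
  also have "\<dots> = (\<Sum>l\<in>UNIV. \<Sum>m\<in>UNIV. if l = m then Q (e (\<kappa> l)) (e (\<kappa> l)) else 0)"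
    by (intro sum.cong refl) auto
  also have "\<dots> = (\<Sum>k<4. Q (e k) (e k))"
    using \<kappa>_sum[of "\<lambda>l. Q (e l) (e l)"] by simp
  finally show ?thesis by (simp add: ricci_trace_def Q_def)
qed

lemma ricci_form_eq:
  assumes e: "unitary_frame e" and X: "X \<in> VF" and Y: "Y \<in> VF"
  shows "ricci_form A J g D X Y p = ricci_trace e X Y p"
proof -
  have "local_orthonormal_frame A g p e"
    unfolding local_orthonormal_frame_def
    by (auto simp: e_vf[OF e] g_e_e[OF e] intro!: exI[of _ UNIV])
  then have "local_orthonormal_frame A g p (SOME E. local_orthonormal_frame A g p E)"
    by (metis someI)
  then have "ricci_trace (SOME E. local_orthonormal_frame A g p E) X Y p = ricci_trace e X Y p"
    by (rule ricci_trace_frame[OF e _ X Y])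
  then show ?thesis by (simp add: ricci_form_def ricci_trace_def Let_def)
qed

end

section \<open>Adapted frames\<close>

context bismut_lie_group
begin

lemma tau_add_left: "\<lbrakk>X \<in> VF; X' \<in> VF; Y \<in> VF; Z \<in> VF\<rbrakk> \<Longrightarrow> tau (X + X') Y Z p = tau X Y Z p + tau X' Y Z p"
  unfolding torsion_form_def by (simp add: g_add T_vf)

lemma tau_scale_left: "\<lbrakk>h \<in> SF; X \<in> VF; Y \<in> VF; Z \<in> VF\<rbrakk> \<Longrightarrow> tau (h \<odot> X) Y Z p = h p * tau X Y Z p"
  unfolding torsion_form_def by (simp add: g_scale T_vf)

lemma bracket_cscale: "\<lbrakk>X \<in> VF; Y \<in> VF\<rbrakk> \<Longrightarrow> lie_bracket ((\<lambda>_. c) \<odot> X) Y = (\<lambda>_. c) \<odot> lie_bracket X Y"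
  using fscale_bracket_left[OF sf_const[of c], of X Y] vf_f_const[of Y c] by (simp add: fscale_def fun_eq_iff)

text \<open>SKT provides some Bismut connection, possibly different from \<open>D\<close>; by
  \<open>tau_eq\<close> both have the same torsion form.\<close>

lemma skt_ext_deriv3:
  assumes "SKT A J g" and W: "W \<in> VF" "X \<in> VF" "Y \<in> VF" "Z \<in> VF"
  shows "ext_deriv3 tau W X Y Z = 0"
proof -
  obtain D' where D': "bismut_connection A J g D'"
    and closed: "ext_deriv3 (torsion_form g D') W X Y Z = 0"
    using assms unfolding SKT_def by blast
  interpret D': bismut_lie_group A J g D' by unfold_locales (rule D')
  have "torsion_form g D' X Y Z = tau X Y Z" if "X \<in> VF" "Y \<in> VF" "Z \<in> VF" for X Y Z
    using that by (simp add: fun_eq_iff tau_eq D'.tau_eq)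
  with closed W show ?thesis by (simp add: ext_deriv3_def vf_bracket del: fun_ops)
qed

section \<open>Connection coefficients, structure constants and Ricci form in a unitary
  frame\<close>

definition Gam :: "(nat \<Rightarrow> 'a vfield) \<Rightarrow> nat \<Rightarrow> nat \<Rightarrow> nat \<Rightarrow> real" where
  "Gam e i j k = g (D (e i) (e j)) (e k) 0"

definition Cst :: "(nat \<Rightarrow> 'a vfield) \<Rightarrow> nat \<Rightarrow> nat \<Rightarrow> nat \<Rightarrow> real" where
  "Cst e i j k = g (lie_bracket (e i) (e j)) (e k) 0"

definition adapted :: "(nat \<Rightarrow> 'a vfield) \<Rightarrow> bool" where
  "adapted e \<longleftrightarrow> unitary_frame e \<and> (\<forall>Y\<in>LI. \<forall>Z\<in>LI. tau (e 0) Y Z 0 = 0)"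

context
  fixes e :: "nat \<Rightarrow> 'a vfield"
  assumes e: "unitary_frame e"
begin

lemma g_e_expand: "\<lbrakk>X \<in> VF; Y \<in> VF\<rbrakk> \<Longrightarrow> g X Y p = (\<Sum>i<4. g X (e i) p * g (e i) Y p)"
  by (rule tensor_expand[OF e]) (simp_all add: g_add g_scale del: fun_ops)

lemma Gam_antisym: "Gam e i j k = - Gam e i k j"
  using g_D_li[OF e_li[OF e] e_li[OF e] e_li[OF e], of i j k 0]
    g_sym[of "e j" "D (e i) (e k)"] e_vf[OF e] D_vf
  by (simp add: Gam_def)

lemma Gam_diag: "Gam e i j j = 0"
  using Gam_antisym[of i j j] by simp

lemma Gam_J: "g (D (e i) (J (e j))) (e k) 0 = - g (D (e i) (e j)) (J (e k)) 0"
  by (simp add: D_J e_vf[OF e] D_vf g_J_right)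

text \<open>For each \<open>i\<close> the matrix of \<open>D (e i)\<close> is skew and commutes with
  \<open>J\<close>. It therefore lies in u(2), which has dimension four, and is determined by four
  entries.\<close>

lemma Gam_table:
  "Gam e i 1 2 = - Gam e i 0 3" "Gam e i 1 3 = Gam e i 0 2"
  "Gam e i 1 0 = - Gam e i 0 1" "Gam e i 2 0 = - Gam e i 0 2" "Gam e i 3 0 = - Gam e i 0 3"
  "Gam e i 2 1 = Gam e i 0 3" "Gam e i 3 1 = - Gam e i 0 2" "Gam e i 3 2 = - Gam e i 2 3"
proof -
  show 1: "Gam e i 1 2 = - Gam e i 0 3" "Gam e i 1 3 = Gam e i 0 2"
    using Gam_J[of i 0 2] Gam_J[of i 0 3] by (simp_all add: Gam_def J_e[OF e] g_uminus_right e_vf[OF e] D_vf)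
  show "Gam e i 1 0 = - Gam e i 0 1" "Gam e i 2 0 = - Gam e i 0 2" "Gam e i 3 0 = - Gam e i 0 3"
    "Gam e i 3 2 = - Gam e i 2 3"
    by (rule Gam_antisym)+
  show "Gam e i 2 1 = Gam e i 0 3" "Gam e i 3 1 = - Gam e i 0 2"
    using 1 Gam_antisym[of i 2 1] Gam_antisym[of i 3 1] by simp_all
qed

lemma Cst_eq: "Cst e i j k = Gam e i j k - Gam e j i k - tau (e k) (e i) (e j) 0"
  using g_bracket_left[OF e_vf[OF e, of i] e_vf[OF e, of j] e_vf[OF e, of k], of 0]
    g_sym[of "e k" "D (e i) (e j)"] g_sym[of "e k" "D (e j) (e i)"] e_vf[OF e] D_vf
  by (simp add: Cst_def Gam_def)

lemma Cst_antisym: "Cst e i j k = - Cst e j i k"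
proof -
  have "g (lie_bracket (e i) (e j)) (e k) 0 = g (- lie_bracket (e j) (e i)) (e k) 0"
    using lie_bracket_antisym[of "e i" "e j"] by simp
  then show ?thesis by (simp add: Cst_def g_uminus vf_bracket e_vf[OF e] del: fun_ops)
qed

lemma Cst_jacobi:
  "(\<Sum>m<4. Cst e i j m * Cst e m k l + Cst e j k m * Cst e m i l + Cst e k i m * Cst e m j l) = 0"
proof -
  note vf = e_vf[OF e] vf_bracket
  have *: "g (lie_bracket (lie_bracket (e i) (e j)) (e k)) (e l) 0 = (\<Sum>m<4. Cst e i j m * Cst e m k l)"
    for i j k
    unfolding Cst_def
    by (rule li_functional_expand[OF e])
      (simp_all add: bracket_add bracket_cscale vf g_add g_scale li_vf sf_const li_bracket e_li[OF e] del: fun_ops)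
  have "g (lie_bracket (lie_bracket (e i) (e j)) (e k) + lie_bracket (lie_bracket (e j) (e k)) (e i)
      + lie_bracket (lie_bracket (e k) (e i)) (e j)) (e l) 0 = 0"
    unfolding jacobi[OF vf(1) vf(1) vf(1)] using g_add[OF vf_0 vf_0 vf(1), of l 0] by simp
  then show ?thesis
    by (simp add: g_add vf vf_add * sum.distrib del: fun_ops)
qed

lemma ricci_trace_antisym: "\<lbrakk>X \<in> VF; Y \<in> VF\<rbrakk> \<Longrightarrow> ricci_trace e X Y p = - ricci_trace e Y X p"
proof -
  assume XY: "X \<in> VF" "Y \<in> VF"
  have "g (R X Y (e k)) (J (e k)) p = - g (R Y X (e k)) (J (e k)) p" for k
    using R_antisym[OF XY e_vf[OF e, of k]] g_uminus[OF R_vf[OF XY(2,1) e_vf[OF e, of k]] J_vf[OF e_vf[OF e, of k]], of p]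
    by simp
  then show ?thesis by (simp add: ricci_trace_def sum_negf)
qed

lemma ricci_trace_add:
  "\<lbrakk>X \<in> VF; X' \<in> VF; Y \<in> VF\<rbrakk> \<Longrightarrow> ricci_trace e (X + X') Y p = ricci_trace e X Y p + ricci_trace e X' Y p"
  by (simp add: ricci_trace_def R_add_left g_add R_vf J_vf e_vf[OF e] sum.distrib ring_distribs del: fun_ops)

lemma ricci_trace_scale:
  "\<lbrakk>h \<in> SF; X \<in> VF; Y \<in> VF\<rbrakk> \<Longrightarrow> ricci_trace e (h \<odot> X) Y p = h p * ricci_trace e X Y p"
  by (simp add: ricci_trace_def R_scale_left g_scale R_vf J_vf e_vf[OF e] sum_distrib_left mult_ac)

lemma ricci_trace_uminus:
  assumes "X \<in> VF" "Y \<in> VF"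
  shows "ricci_trace e (- X) Y p = - ricci_trace e X Y p" "ricci_trace e X (- Y) p = - ricci_trace e X Y p"
proof -
  have *: "ricci_trace e (- X) Y p = - ricci_trace e X Y p" if "X \<in> VF" "Y \<in> VF" for X Y
    unfolding uminus_eq_scale using ricci_trace_scale[OF sf_const that] by simp
  then show "ricci_trace e (- X) Y p = - ricci_trace e X Y p" using assms by simp
  show "ricci_trace e X (- Y) p = - ricci_trace e X Y p"
    using ricci_trace_antisym[of X "- Y" p] ricci_trace_antisym[of X Y p] *[of Y X] assms vf_uminus by simp
qed

lemma ricci_trace_expand:
  assumes "X \<in> VF" "Y \<in> VF"
  shows "ricci_trace e X Y p = (\<Sum>i<4. \<Sum>j<4. g X (e i) p * g Y (e j) p * ricci_trace e (e i) (e j) p)"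
proof -
  have *: "ricci_trace e X Y p = (\<Sum>i<4. g X (e i) p * ricci_trace e (e i) Y p)" if "X \<in> VF" "Y \<in> VF" for X Y
    by (rule tensor_expand[OF e]) (simp_all add: that ricci_trace_add ricci_trace_scale del: fun_ops)
  have "ricci_trace e (e i) Y p = (\<Sum>j<4. g Y (e j) p * ricci_trace e (e i) (e j) p)" for i
    using *[OF assms(2) e_vf[OF e, of i]] ricci_trace_antisym[OF e_vf[OF e, of i]] e_vf[OF e] assms(2)
    by (simp add: sum_negf)
  then show ?thesis using *[OF assms] by (simp add: sum_distrib_left mult.assoc)
qed

lemma fundamental_expand:
  assumes "X \<in> VF" "Y \<in> VF"
  shows "fundamental_form J g X Y p =
    (\<Sum>i<4. \<Sum>j<4. g X (e i) p * g Y (e j) p * fundamental_form J g (e i) (e j) p)"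
proof -
  have 1: "fundamental_form J g X Y p = (\<Sum>i<4. g X (e i) p * fundamental_form J g (e i) Y p)"
    unfolding fundamental_form_def by (rule g_e_expand) (simp_all add: assms J_vf)
  have "fundamental_form J g (e i) Y p = (\<Sum>j<4. g Y (e j) p * fundamental_form J g (e i) (e j) p)" for i
    unfolding fundamental_form_def
    by (rule tensor_expand[OF e])
      (simp_all add: assms J_add J_scale g_add_right g_scale_right J_vf e_vf[OF e] del: fun_ops)
  with 1 show ?thesis by (simp add: sum_distrib_left mult.assoc)
qed

definition "ricci_const i j = (\<Sum>m<4. (Gam e m 0 1 + Gam e m 2 3) * Cst e i j m)"

lemma ricci_trace_const: "ricci_trace e (e i) (e j) p = ricci_const i j"
proof -
  note li = e_li[OF e] and vf = e_vf[OF e]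
  have 1: "g (D (lie_bracket (e i) (e j)) (e k)) (J (e k)) 0 = (\<Sum>m<4. Cst e i j m * g (D (e m) (e k)) (J (e k)) 0)"
    for k
    unfolding Cst_def
    by (rule li_functional_expand[OF e])
      (simp_all add: D_add_left D_scale_left vf g_add g_scale li_vf sf_const li_bracket li J_vf D_vf del: fun_ops)
  have 2: "g (D (e i) (D (e j) (e k))) (J (e k)) 0 = - g (D (e j) (e k)) (J (D (e i) (e k))) 0" for i j k
    using g_D_li[OF li D_li[OF li li] J_li[OF li], of i j k k 0] by (simp add: D_J vf)
  have 3: "g (D (e j) (e k)) (J (D (e i) (e k))) 0 =
      Gam e j k 1 * Gam e i k 0 - Gam e j k 0 * Gam e i k 1 + Gam e j k 3 * Gam e i k 2 - Gam e j k 2 * Gam e i k 3"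
    for i j k
  proof -
    have J: "g (e l) (J (D (e i) (e k))) 0 = - g (D (e i) (e k)) (J (e l)) 0" for l
      using g_J_right[OF vf[of l] D_vf[OF vf vf], of i k 0] g_sym[OF J_vf[OF vf[of l]] D_vf[OF vf vf], of i k] by simp
    show ?thesis
      by (subst g_e_expand)
        (simp_all add: D_vf J_vf vf sum_lessThan_4 J J_e[OF e] g_uminus_right Gam_def
          del: fun_ops One_nat_def)
  qed
  have 4: "g (R (e i) (e j) (e k)) (J (e k)) p = (\<Sum>m<4. Cst e i j m * g (D (e m) (e k)) (J (e k)) 0)
      + g (D (e j) (e k)) (J (D (e i) (e k))) 0 - g (D (e i) (e k)) (J (D (e j) (e k))) 0" for k
  proof -
    have "g (R (e i) (e j) (e k)) (J (e k)) p = g (R (e i) (e j) (e k)) (J (e k)) 0"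
      by (rule g_li) (simp_all add: curvature_def li_diff D_li li_bracket li J_li del: fun_ops)
    also have "\<dots> = g (D (lie_bracket (e i) (e j)) (e k)) (J (e k)) 0
        - (g (D (e i) (D (e j) (e k))) (J (e k)) 0 - g (D (e j) (D (e i) (e k))) (J (e k)) 0)"
      by (simp add: curvature_def g_diff vf_diff D_vf vf_bracket vf J_vf del: fun_ops)
    finally show ?thesis unfolding 1 2 by simp
  qed
  have 5: "g (D (e m) (e 0)) (J (e 0)) 0 = Gam e m 0 1" "g (D (e m) (e 1)) (J (e 1)) 0 = Gam e m 0 1"
    "g (D (e m) (e 2)) (J (e 2)) 0 = Gam e m 2 3" "g (D (e m) (e 3)) (J (e 3)) 0 = Gam e m 2 3" for m
    using Gam_table(3,8)[of m] by (simp_all add: J_e[OF e] g_uminus_right D_vf vf Gam_def del: One_nat_def)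
  \<comment> \<open>The products of connection coefficients come from the commutator of two matrices
    in u(2), whose complex trace is 0, so they cancel in the sum over the frame. The term with the
    bracket remains.\<close>
  show ?thesis
    unfolding ricci_trace_def ricci_const_def 4 3 sum_lessThan_4 5
    by (simp only: Gam_table Gam_diag) algebra
qed

lemma ricci_const_antisym: "ricci_const i j = - ricci_const j i"
  unfolding ricci_const_def using Cst_antisym[of i j] by (simp add: sum_negf)

text \<open>Since omega is \<open>g X (J Y)\<close>, its value on \<open>e 0\<close> and
  \<open>e 1\<close> is -1. This absorbs the minus sign of the static condition and leaves
  \<open>lam\<close> itself.\<close>

lemma static_ricci_const:
  assumes static: "\<And>X Y p. \<lbrakk>X \<in> VF; Y \<in> VF\<rbrakk> \<Longrightarrow>
      - part11 J (ricci_form A J g D) X Y p = lam * fundamental_form J g X Y p"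
  shows "ricci_const 0 1 = lam" "ricci_const 2 3 = lam" "ricci_const 0 2 + ricci_const 1 3 = 0"
    "ricci_const 0 3 = ricci_const 1 2"
proof -
  note vf = e_vf[OF e]
  have F: "ricci_form A J g D X Y p = ricci_trace e X Y p" if "X \<in> VF" "Y \<in> VF" for X Y p
    by (rule ricci_form_eq[OF e that])
  note * = part11_def F J_vf vf vf_uminus J_e[OF e] fundamental_form_def ricci_trace_uminus
    ricci_trace_const g_e_e[OF e] g_uminus_right
  have "ricci_const 0 1 = lam \<and> ricci_const 2 3 = lam"
    using static[OF vf[of 0] vf[of 1], of 0] static[OF vf[of 2] vf[of 3], of 0]
      ricci_const_antisym[of 1 0] ricci_const_antisym[of 3 2]
    by (simp add: * del: fun_ops One_nat_def)
  then show "ricci_const 0 1 = lam" "ricci_const 2 3 = lam" by auto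
  show "ricci_const 0 2 + ricci_const 1 3 = 0"
    using static[OF vf[of 0] vf[of 2], of 0] by (simp add: * del: fun_ops One_nat_def)
  show "ricci_const 0 3 = ricci_const 1 2"
    using static[OF vf[of 0] vf[of 3], of 0] by (simp add: * del: fun_ops One_nat_def)
qed

end

lemma adapted_tau:
  assumes "adapted e"
  shows "tau (e 0) (e j) (e k) 0 = 0" "tau (e i) (e 0) (e k) 0 = 0" "tau (e i) (e k) (e 0) 0 = 0"
    "tau (e i) (e i) (e k) 0 = 0" "tau (e i) (e k) (e k) 0 = 0" "tau (e i) (e k) (e i) 0 = 0"
    "tau (e 1) (e 3) (e 2) 0 = - tau (e 1) (e 2) (e 3) 0"
    "tau (e 2) (e 1) (e 3) 0 = - tau (e 1) (e 2) (e 3) 0" "tau (e 2) (e 3) (e 1) 0 = tau (e 1) (e 2) (e 3) 0"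
    "tau (e 3) (e 1) (e 2) 0 = tau (e 1) (e 2) (e 3) 0" "tau (e 3) (e 2) (e 1) 0 = - tau (e 1) (e 2) (e 3) 0"
proof -
  have e: "unitary_frame e" using assms by (simp add: adapted_def)
  note vf = e_vf[OF e]
  note skew = tau_skew[OF vf vf vf]
  show t0: "tau (e 0) (e j) (e k) 0 = 0" for j k
    using assms e_li[OF e] by (simp add: adapted_def)
  show t1: "tau (e i) (e 0) (e k) 0 = 0" for i k
    using skew(1)[of 0 i k 0] t0 by simp
  show "tau (e i) (e k) (e 0) 0 = 0"
    using skew(2)[of i 0 k 0] t1 by simp
  show "tau (e i) (e i) (e k) 0 = 0" "tau (e i) (e k) (e k) 0 = 0" "tau (e i) (e k) (e i) 0 = 0"
    using skew(1)[of i i k 0] skew(2)[of i k k 0] skew(2)[of i i k 0] by simp_all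
  show "tau (e 1) (e 3) (e 2) 0 = - tau (e 1) (e 2) (e 3) 0"
    "tau (e 2) (e 1) (e 3) 0 = - tau (e 1) (e 2) (e 3) 0" "tau (e 2) (e 3) (e 1) 0 = tau (e 1) (e 2) (e 3) 0"
    "tau (e 3) (e 1) (e 2) 0 = tau (e 1) (e 2) (e 3) 0" "tau (e 3) (e 2) (e 1) 0 = - tau (e 1) (e 2) (e 3) 0"
    using skew(1)[of 1 3 2 0] skew(2)[of 1 3 2 0] skew(1)[of 1 2 3 0] skew(2)[of 2 1 3 0]
      skew(2)[of 3 1 2 0] by simp_all
qed

lemma adapted_constants:
  assumes "adapted e"
  shows "bismut_constants (Cst e) (\<lambda>i. Gam e i 0 1) (\<lambda>i. Gam e i 0 2) (\<lambda>i. Gam e i 0 3) (\<lambda>i. Gam e i 2 3)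
    (tau (e 1) (e 2) (e 3) 0)"
proof -
  have e: "unitary_frame e" using assms by (simp add: adapted_def)
  show ?thesis
    by unfold_locales
      ((rule Cst_antisym[OF e] Cst_jacobi[OF e])
        | (unfold Cst_eq[OF e] Gam_table[OF e] Gam_diag[OF e] adapted_tau[OF assms], simp; fail))+
qed

lemma adapted_exI:
  assumes X: "X \<in> LI" "g X X 0 = 1" and t: "\<And>Y Z. \<lbrakk>Y \<in> LI; Z \<in> LI\<rbrakk> \<Longrightarrow> tau X Y Z 0 = 0"
  shows "\<exists>e. adapted e"
proof -
  obtain Y where "unitary_frame (frame_of X Y)" by (rule unitary_frame_exI[OF X])
  then have "adapted (frame_of X Y)" using t by (simp add: adapted_def)
  then show ?thesis by blast
qed

lemma tau_vanish:
  assumes e: "unitary_frame e" and X: "X \<in> LI" and t: "\<And>j k. \<lbrakk>j < 4; k < 4\<rbrakk> \<Longrightarrow> tau X (e j) (e k) 0 = 0"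
    and Y: "Y \<in> LI" and Z: "Z \<in> LI"
  shows "tau X Y Z 0 = 0"
proof -
  note li = e_li[OF e] and vf = e_vf[OF e] and vfs = li_vf[OF X] li_vf[OF Y] li_vf[OF Z]
  have exp: "tau U V W 0 = (\<Sum>i<4. g U (e i) 0 * tau (e i) V W 0)" if "U \<in> LI" "V \<in> LI" "W \<in> LI" for U V W
    by (rule li_functional_expand[OF e])
      (simp_all add: that li_vf tau_add_left tau_scale_left sf_const del: fun_ops)
  have "tau X Y (e k) 0 = 0" if k: "k < 4" for k
  proof -
    have "tau Y X (e k) 0 = (\<Sum>i<4. g Y (e i) 0 * tau (e i) X (e k) 0)" by (rule exp[OF Y X li])
    also have "\<dots> = 0"
      using tau_skew(1)[OF vfs(1) vf vf, of _ k 0] t k by (intro sum.neutral) simp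
    finally show ?thesis using tau_skew(1)[OF vfs(1,2) vf, of k 0] by simp
  qed
  moreover have "tau Z X Y 0 = (\<Sum>i<4. g Z (e i) 0 * tau (e i) X Y 0)" by (rule exp[OF Z X Y])
  moreover have "tau (e i) X Y 0 = tau X Y (e i) 0" for i
    using tau_skew(1)[OF vfs(1) vf vfs(2), of i 0] tau_skew(2)[OF vfs(1) vf vfs(2), of i 0] by simp
  moreover have "tau Z X Y 0 = tau X Y Z 0"
    using tau_skew(1)[OF vfs(1,3,2), of 0] tau_skew(2)[OF vfs(1,3,2), of 0] by simp
  ultimately show ?thesis by simp
qed

text \<open>A 3-form on a four-dimensional space has a kernel vector, namely its Hodge dual.\<close>

lemma adapted_ex: "\<exists>e. adapted e"
proof -
  obtain e where e: "unitary_frame e" by (rule unitary_frame_ex)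
  note li = e_li[OF e] and vf = e_vf[OF e]
  define H where "H i j k = tau (e i) (e j) (e k) 0" for i j k
  have H1: "H j i k = - H i j k" and H2: "H i k j = - H i j k" for i j k
    unfolding H_def by (rule tau_skew[OF vf vf vf])+
  have H3: "H i i k = 0" "H i k k = 0" "H i k i = 0" for i k
    using H1[of i i k] H2[of i k k] H2[of i i k] by simp_all
  have H4: "H j i k = - H i j k" "H i k j = - H i j k" "H j k i = H i j k" "H k i j = H i j k"
    "H k j i = - H i j k" for i j k
    using H1[of j i k] H1[of k i j] H2[of i k j] H2[of j k i] H1[of k j i] H2[of k i j] by simp_all
  note H = H3 H4[where i = 0 and j = 1 and k = 2] H4[where i = 0 and j = 1 and k = 3]
    H4[where i = 0 and j = 2 and k = 3] H4[where i = 1 and j = 2 and k = 3]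
  \<comment> \<open>Components of the Hodge dual. Contracting with \<open>H\<close> produces each
    product of two components twice, with opposite signs.\<close>
  define x where "x i = (if i = 0 then H 1 2 3 else if i = 1 then - H 0 2 3 else if i = 2 then H 0 1 3 else - H 0 1 2)"
    for i :: nat
  have x: "x 0 = H 1 2 3" "x 1 = - H 0 2 3" "x 2 = H 0 1 3" "x 3 = - H 0 1 2" by (simp_all add: x_def)
  define X where "X = (\<Sum>i<4. (\<lambda>_. x i) \<odot> e i)"
  have X: "X \<in> LI" unfolding X_def by (intro li_sum li_cscale li)
  have gX: "g X (e j) 0 = x j" if "j < 4" for j
  proof -
    have "g X (e j) 0 = (\<Sum>i<4. x i * g (e i) (e j) 0)"
      unfolding X_def by (subst g_sum) (simp_all add: vf_cscale vf g_scale sf_const)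
    also have "\<dots> = (\<Sum>i<4. if j = i then x i else 0)"
      by (intro sum.cong) (auto simp: g_e_e[OF e] that)
    finally show ?thesis using that by simp
  qed
  have XH: "tau X (e j) (e k) 0 = (\<Sum>i<4. x i * H i j k)" for j k
  proof -
    have "tau X (e j) (e k) 0 = (\<Sum>i<4. g X (e i) 0 * H i j k)"
      unfolding H_def
      by (rule li_functional_expand[OF e])
        (simp_all add: X li_vf vf tau_add_left tau_scale_left sf_const del: fun_ops)
    then show ?thesis by (simp add: gX)
  qed
  have "tau X (e j) (e k) 0 = 0" if "j < 4" "k < 4" for j k
    using less_4_cases[OF that(1)] less_4_cases[OF that(2)]
    unfolding XH sum_lessThan_4 x
    by (elim disjE; simp add: H mult.commute del: One_nat_def)
  then have tX: "tau X Y Z 0 = 0" if "Y \<in> LI" "Z \<in> LI" for Y Z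
    using tau_vanish[OF e X _ that] by blast
  show ?thesis
  proof (cases "X = 0")
    case False
    obtain c where c: "g ((\<lambda>_. c) \<odot> X) ((\<lambda>_. c) \<odot> X) 0 = 1" by (rule li_normalize[OF X False])
    show ?thesis
      by (rule adapted_exI[OF li_cscale[OF X] c]) (simp add: tau_scale_left sf_const X li_vf tX)
  next
    \<comment> \<open>The dual vector vanishes only together with the form, and then every unitary
      frame is adapted.\<close>
    case True
    then have "g X (e j) 0 = 0" for j
      using g_add[OF vf_0 vf_0 vf, of j 0] by simp
    then have "x j = 0" if "j < 4" for j using gX[OF that] by simp
    then have x0: "H 1 2 3 = 0" "H 0 2 3 = 0" "H 0 1 3 = 0" "H 0 1 2 = 0"
      using x by (metis neg_equal_0_iff_equal zero_less_numeral one_less_numeral_iff semiring_norm(76) numeral_less_iff semiring_norm(78) semiring_norm(81))+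
    have "tau (e 0) (e j) (e k) 0 = 0" if "j < 4" "k < 4" for j k
      using less_4_cases[OF that(1)] less_4_cases[OF that(2)]
      unfolding H_def[symmetric]
      by (elim disjE; simp add: x0 H del: One_nat_def)
    then have "tau (e 0) Y Z 0 = 0" if "Y \<in> LI" "Z \<in> LI" for Y Z
      using tau_vanish[OF e li _ that] by blast
    moreover have "g (e 0) (e 0) 0 = 1" by (simp add: g_e_e[OF e])
    ultimately show ?thesis using adapted_exI[OF li] by blast
  qed
qed

definition tr_ad_frame :: "(nat \<Rightarrow> 'a vfield) \<Rightarrow> 'a vfield \<Rightarrow> real" where
  "tr_ad_frame e X = (\<Sum>j<4. g (lie_bracket X (e j)) (e j) 0)"

text \<open>Adaptedness constrains \<open>e 0\<close> only, so the plane of \<open>e 2\<close> and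
  \<open>e 3\<close> may be rotated. \<open>Y\<close> is turned towards the projection of the trace
  form to this plane, which puts \<open>J Y\<close> into its kernel; traces of ad do not depend on
  the rotation.\<close>

lemma adapted_normalized_ex: "\<exists>e. adapted e \<and> tr_ad_frame e (e 3) = 0"
proof -
  obtain e where ad: "adapted e" using adapted_ex by blast
  then have e: "unitary_frame e" by (simp add: adapted_def)
  note li = e_li[OF e] and vf = e_vf[OF e]
  define h where "h i = tr_ad_frame e (e i)" for i
  show ?thesis
  proof (cases "h 3 = 0")
    case True
    then show ?thesis using ad h_def by auto
  next
    case False
    define n where "n = sqrt ((h 2)\<^sup>2 + (h 3)\<^sup>2)"
    have n: "n * n = (h 2)\<^sup>2 + (h 3)\<^sup>2" "n \<noteq> 0"
      using False by (auto simp: n_def sum_power2_eq_zero_iff)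
    define u v where "u = h 2 / n" and "v = h 3 / n"
    have "u * u + v * v = ((h 2)\<^sup>2 + (h 3)\<^sup>2) / (n * n)"
      by (simp add: u_def v_def power2_eq_square add_divide_distrib)
    then have uv: "u * u + v * v = 1"
      unfolding n(1)[symmetric] using n(2) by simp
    define Y where "Y = (\<lambda>_. u) \<odot> e 2 + (\<lambda>_. v) \<odot> e 3"
    have Y: "Y \<in> LI" unfolding Y_def by (intro li_add li_cscale li)
    have JY: "J Y = (\<lambda>_. u) \<odot> e 3 + (\<lambda>_. - v) \<odot> e 2"
      using J_uminus[OF vf] unfolding Y_def
      by (simp add: J_add J_scale vf_cscale vf sf_const J_e[OF e] del: fun_ops)
        (simp add: fun_eq_iff fscale_apply)
    let ?e = "frame_of (e 0) Y"
    have gY: "g Y Z p = u * g (e 2) Z p + v * g (e 3) Z p" "g Z Y p = u * g Z (e 2) p + v * g Z (e 3) p"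
      if "Z \<in> VF" for Z p
      unfolding Y_def using that by (simp_all add: g_add g_add_right g_scale g_scale_right vf_cscale vf sf_const)
    have gJY: "g Z (J Y) p = u * g Z (e 3) p - v * g Z (e 2) p" if "Z \<in> VF" for Z p
      unfolding JY using that by (simp add: g_add_right g_scale_right vf_cscale vf sf_const)
    have e': "unitary_frame ?e"
    proof (rule unitary_frame_of)
      show "g Y Y 0 = 1" using uv by (simp add: gY li_vf[OF Y] vf g_e_e[OF e])
      show "g (e 0) (e 0) 0 = 1" by (simp add: g_e_e[OF e])
      show "g (e 0) Y 0 = 0" "g (J (e 0)) Y 0 = 0"
        by (simp_all add: gY vf J_e[OF e] g_e_e[OF e] del: One_nat_def)
    qed (intro li Y)+
    then have ad': "adapted ?e" using ad by (simp add: adapted_def)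
    have br: "lie_bracket X Y = (\<lambda>_. u) \<odot> lie_bracket X (e 2) + (\<lambda>_. v) \<odot> lie_bracket X (e 3)"
      "lie_bracket X (J Y) = (\<lambda>_. u) \<odot> lie_bracket X (e 3) + (\<lambda>_. - v) \<odot> lie_bracket X (e 2)"
      if "X \<in> VF" for X
    proof -
      have *: "lie_bracket X ((\<lambda>_. a) \<odot> V + (\<lambda>_. b) \<odot> W) = (\<lambda>_. a) \<odot> lie_bracket X V + (\<lambda>_. b) \<odot> lie_bracket X W"
        if VW: "V \<in> VF" "W \<in> VF" for a b V W
        unfolding lie_bracket_antisym[of X]
        by (simp add: bracket_add bracket_cscale vf_cscale VW \<open>X \<in> VF\<close> del: fun_ops)
          (simp add: fun_eq_iff fscale_apply)
      show "lie_bracket X Y = (\<lambda>_. u) \<odot> lie_bracket X (e 2) + (\<lambda>_. v) \<odot> lie_bracket X (e 3)"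
        "lie_bracket X (J Y) = (\<lambda>_. u) \<odot> lie_bracket X (e 3) + (\<lambda>_. - v) \<odot> lie_bracket X (e 2)"
        unfolding JY by (simp_all add: Y_def * vf del: fun_ops)
    qed
    have tr: "tr_ad_frame ?e X = tr_ad_frame e X" if X: "X \<in> VF" for X
    proof -
      have "g (lie_bracket X Y) Y 0 + g (lie_bracket X (J Y)) (J Y) 0 =
        (u * u + v * v) * (g (lie_bracket X (e 2)) (e 2) 0 + g (lie_bracket X (e 3)) (e 3) 0)"
        by (simp add: gY gJY br X vf_bracket vf_add vf_cscale vf li_vf[OF Y] J_vf g_add g_scale sf_const del: fun_ops)
          algebra
      then show ?thesis
        unfolding tr_ad_frame_def sum_lessThan_4 using uv by (simp add: J_e[OF e])
    qed
    have "tr_ad_frame e (J Y) = u * h 3 - v * h 2"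
      unfolding tr_ad_frame_def h_def JY
      by (simp add: bracket_add bracket_cscale vf_cscale vf g_add g_scale sf_const vf_bracket sum_lessThan_4 del: fun_ops)
        algebra
    also have "\<dots> = 0" by (simp add: u_def v_def)
    finally have "tr_ad_frame ?e (?e 3) = 0" using tr J_vf[OF li_vf[OF Y]] by simp
    with ad' show ?thesis by blast
  qed
qed

text \<open>On left-invariant fields \<open>tau\<close> is constant, so only the bracket terms of
  its exterior derivative remain. On the frame they add up to a multiple of \<open>s\<close> times
  the trace of ad (\<open>e 0\<close>), and \<open>s\<close> can be cancelled.\<close>

lemma skt_const:
  assumes "SKT A J g" and ad: "adapted e" and s: "tau (e 1) (e 2) (e 3) 0 \<noteq> 0"
  shows "Gam e 1 0 1 + Gam e 2 0 2 + Gam e 3 0 3 = 0"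
proof -
  have e: "unitary_frame e" using ad by (simp add: adapted_def)
  note li = e_li[OF e] and vf = e_vf[OF e]
  interpret bismut_constants "Cst e" "\<lambda>i. Gam e i 0 1" "\<lambda>i. Gam e i 0 2" "\<lambda>i. Gam e i 0 3"
    "\<lambda>i. Gam e i 2 3" "tau (e 1) (e 2) (e 3) 0"
    by (rule adapted_constants[OF ad])
  have c: "W (tau X Y Z) 0 = 0" if "W \<in> LI" "X \<in> LI" "Y \<in> LI" "Z \<in> LI" for W X Y Z
  proof -
    have "tau X Y Z = (\<lambda>_. tau X Y Z 0)" using tau_li[OF that(2-4)] by blast
    then show ?thesis using vf_f_const[OF li_vf[OF that(1)], of "tau X Y Z 0"] by simp
  qed
  have t: "tau (lie_bracket (e i) (e j)) (e k) (e l) 0 = (\<Sum>m<4. Cst e i j m * tau (e m) (e k) (e l) 0)" for i j k l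
    unfolding Cst_def
    by (rule li_functional_expand[OF e])
      (simp_all add: li_vf vf tau_add_left tau_scale_left sf_const li_bracket li del: fun_ops)
  have "ext_deriv3 tau (e 0) (e 1) (e 2) (e 3) 0 = 0"
    using skt_ext_deriv3[OF assms(1) vf vf vf vf] by simp
  then have "tau (e 1) (e 2) (e 3) 0 * (Cst e 0 1 1 + Cst e 0 2 2 + Cst e 0 3 3) = 0"
    unfolding ext_deriv3_def
    by (simp add: c li t sum_lessThan_4 adapted_tau[OF ad] algebra_simps del: One_nat_def)
  then show ?thesis using s C_01 C_02 C_03 by simp
qed

end

section \<open>The two cases\<close>

context bismut_lie_group
begin

lemma kaehler_einstein_if_torsion_free:
  assumes ad: "adapted e" and s: "tau (e 1) (e 2) (e 3) 0 = 0"
    and static: "\<And>X Y p. \<lbrakk>X \<in> VF; Y \<in> VF\<rbrakk> \<Longrightarrow>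
      - part11 J (ricci_form A J g D) X Y p = lam * fundamental_form J g X Y p"
  shows "kaehler_einstein A J g"
proof -
  have e: "unitary_frame e" using ad by (simp add: adapted_def)
  note li = e_li[OF e] and vf = e_vf[OF e]
  interpret bismut_constants "Cst e" "\<lambda>i. Gam e i 0 1" "\<lambda>i. Gam e i 0 2" "\<lambda>i. Gam e i 0 3"
    "\<lambda>i. Gam e i 2 3" "tau (e 1) (e 2) (e 3) 0"
    by (rule adapted_constants[OF ad])
  have "tau (e i) (e j) (e k) 0 = 0" if "i < 4" "j < 4" "k < 4" for i j k
    using less_4_cases[OF that(1)] less_4_cases[OF that(2)] less_4_cases[OF that(3)]
    by (elim disjE; simp add: adapted_tau[OF ad] s del: One_nat_def)
  then have tau_e: "tau (e i) (e j) (e k) p = 0" if "i < 4" "j < 4" "k < 4" for i j k p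
    using that tau_li[OF li li li, of i j k p] by simp
  have exp: "tau X Y Z p = (\<Sum>i<4. g X (e i) p * tau (e i) Y Z p)" if "X \<in> VF" "Y \<in> VF" "Z \<in> VF" for X Y Z p
    by (rule tensor_expand[OF e]) (simp_all add: that tau_add_left tau_scale_left del: fun_ops)
  \<comment> \<open>The expansion is available in the first slot only, so skew-symmetry brings the
    slots there one after the other.\<close>
  have tau1: "tau X (e j) (e k) p = 0" if "X \<in> VF" "j < 4" "k < 4" for X j k p
    by (simp add: exp[OF that(1) vf vf] tau_e that)
  have tau2: "tau X Y (e k) p = 0" if "X \<in> VF" "Y \<in> VF" "k < 4" for X Y k p
    using tau1[OF that(2) _ that(3)] tau_skew(1)[OF that(2) vf vf]
    by (simp add: exp[OF that(1,2) vf])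
  have tau3: "tau X Y Z p = 0" if "X \<in> VF" "Y \<in> VF" "Z \<in> VF" for X Y Z p
    using tau2[OF that(2,3)] tau_skew(1)[OF that(2) vf that(3)] tau_skew(2)[OF that(2) vf that(3)]
    by (simp add: exp[OF that])
  have "T X Y = 0" if "X \<in> VF" "Y \<in> VF" for X Y
    using tau3[OF vf that] g_sym[OF vf T_vf[OF that]]
    by (intro vf_eq_0[OF e T_vf[OF that]]) (simp add: torsion_form_def)
  then have lc: "levi_civita_connection A g D"
    using bismut by (simp add: levi_civita_connection_def bismut_connection_def)
  have "ext_deriv2 (fundamental_form J g) X Y Z = 0" if "X \<in> VF" "Y \<in> VF" "Z \<in> VF" for X Y Z
    by (rule ext) (simp add: ext_deriv2_fundamental that tau3 J_vf)
  then have kaehler: "kaehler A J g"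
    using complex hermitian by (simp add: kaehler_def)
  have ric: "ric i j = ricci_const e i j" for i j
    unfolding ric_def ricci_const_def[OF e] ..
  note const = static_ricci_const[OF e static]
  \<comment> \<open>The Bianchi identity and the static condition relate the same pairs of
    components with opposite signs, so these components vanish. The rest is \<open>- lam\<close>
    times omega, so the Einstein constant is \<open>- lam\<close>.\<close>
  have "ricci_const e 0 2 = 0" "ricci_const e 1 3 = 0" "ricci_const e 0 3 = 0" "ricci_const e 1 2 = 0"
    using kaehler_ric[OF s] const unfolding ric by auto
  note const' = this const(1,2) ricci_const_antisym[OF e, of 1 0] ricci_const_antisym[OF e, of 2 0]
    ricci_const_antisym[OF e, of 3 0] ricci_const_antisym[OF e, of 2 1] ricci_const_antisym[OF e, of 3 1]
    ricci_const_antisym[OF e, of 3 2]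
  have diag: "ricci_const e i i = 0" for i using ricci_const_antisym[OF e, of i i] by simp
  have *: "ricci_const e i j = - lam * fundamental_form J g (e i) (e j) p" if "i < 4" "j < 4" for i j p
    using less_4_cases[OF that(1)] less_4_cases[OF that(2)]
    by (elim disjE; simp add: const' diag fundamental_form_def J_e[OF e] g_uminus_right vf g_e_e[OF e] del: One_nat_def)
  have "ricci_form A J g D X Y p = - lam * fundamental_form J g X Y p" if "X \<in> VF" "Y \<in> VF" for X Y p
    unfolding ricci_form_eq[OF e that] ricci_trace_expand[OF e that] ricci_trace_const[OF e]
      fundamental_expand[OF e that] sum_distrib_left
    by (intro sum.cong refl) (simp add: *[of _ _ p])
  with kaehler lc show ?thesis unfolding kaehler_einstein_def by blast
qed

end

text \<open>The standard basis \<open>- \<i> / 2\<close> times the Pauli matrices, which satisfies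
  \<open>[T\<^sub>1, T\<^sub>2] = T\<^sub>3\<close> and its cyclic permutations.\<close>

definition su2_of :: "real \<Rightarrow> real \<Rightarrow> real \<Rightarrow> complex^2^2" where
  "su2_of x y z = (\<chi> i j. if i = 1 then (if j = 1 then Complex 0 (- z / 2) else Complex (- y / 2) (- x / 2))
    else (if j = 1 then Complex (y / 2) (- x / 2) else Complex 0 (z / 2)))"

lemma su2_of_nth:
  "su2_of x y z $ 1 $ 1 = Complex 0 (- z / 2)" "su2_of x y z $ 1 $ 2 = Complex (- y / 2) (- x / 2)"
  "su2_of x y z $ 2 $ 1 = Complex (y / 2) (- x / 2)" "su2_of x y z $ 2 $ 2 = Complex 0 (z / 2)"
  by (simp_all add: su2_of_def)

lemma su2_of_mem: "su2_of x y z \<in> su2"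
  by (simp add: su2_def vec_eq_iff forall_2 su2_of_nth trace_def sum_2 complex_eq_iff)

lemma su2_of_surj:
  assumes "M \<in> su2"
  shows "M = su2_of (- 2 * Im (M $ 1 $ 2)) (- 2 * Re (M $ 1 $ 2)) (- 2 * Im (M $ 1 $ 1))"
proof -
  have skew: "cnj (M $ j $ i) = - M $ i $ j" for i j
    using assms by (simp add: su2_def vec_eq_iff)
  have "Re (M $ 1 $ 1) = 0" "Re (M $ 2 $ 2) = 0"
    using arg_cong[OF skew[of 1 1], of Re] arg_cong[OF skew[of 2 2], of Re] by simp_all
  moreover have "Re (M $ 2 $ 1) = - Re (M $ 1 $ 2)" "Im (M $ 2 $ 1) = Im (M $ 1 $ 2)"
    using arg_cong[OF skew[of 1 2], of Re] arg_cong[OF skew[of 1 2], of Im] by simp_all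
  moreover have "Im (M $ 2 $ 2) = - Im (M $ 1 $ 1)"
    using assms by (simp add: su2_def trace_def sum_2 complex_eq_iff)
  ultimately show ?thesis
    by (simp add: vec_eq_iff forall_2 su2_of_nth complex_eq_iff)
qed

lemma su2_of_inj: "su2_of x y z = su2_of x' y' z' \<longleftrightarrow> x = x' \<and> y = y' \<and> z = z'"
  by (auto simp: vec_eq_iff forall_2 su2_of_nth)

lemma su2_of_add: "su2_of (x + x') (y + y') (z + z') = su2_of x y z + su2_of x' y' z'"
  by (simp add: vec_eq_iff forall_2 su2_of_nth complex_eq_iff field_simps)

lemma su2_of_scaleR: "su2_of (c * x) (c * y) (c * z) = c *\<^sub>R su2_of x y z"
  by (simp add: vec_eq_iff forall_2 su2_of_nth complex_eq_iff)

lemma su2_of_commutator: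
  "su2_of x y z ** su2_of x' y' z' - su2_of x' y' z' ** su2_of x y z =
    su2_of (y * z' - z * y') (z * x' - x * z') (x * y' - y * x')"
  by (simp add: vec_eq_iff forall_2 su2_of_nth matrix_matrix_mult_def sum_2 complex_eq_iff field_simps)

section \<open>Identification with su(2) and a line, and the classification\<close>

context bismut_lie_group
begin

text \<open>\<open>e 1\<close>, \<open>e 2\<close>, \<open>e 3\<close> span a copy of su(2), on
  which \<open>e 0\<close> acts as the inner derivation \<open>- f / s\<close> times ad
  (\<open>e 1\<close>). Hence \<open>e 0\<close> plus \<open>f / s\<close> times \<open>e 1\<close>
  is central and spans the line factor.\<close>

lemma isomorphic_su2_R:
  assumes e: "unitary_frame e" and s: "s \<noteq> 0"
    and C_antisym: "\<And>i j k. Cst e i j k = - Cst e j i k"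
    and C: "Cst e 0 1 0 = 0" "Cst e 0 1 1 = 0" "Cst e 0 1 2 = 0" "Cst e 0 1 3 = 0"
      "Cst e 0 2 0 = 0" "Cst e 0 2 1 = 0" "Cst e 0 2 2 = 0" "Cst e 0 2 3 = f"
      "Cst e 0 3 0 = 0" "Cst e 0 3 1 = 0" "Cst e 0 3 2 = - f" "Cst e 0 3 3 = 0"
      "Cst e 1 2 0 = 0" "Cst e 1 2 1 = 0" "Cst e 1 2 2 = 0" "Cst e 1 2 3 = - s"
      "Cst e 1 3 0 = 0" "Cst e 1 3 1 = 0" "Cst e 1 3 2 = s" "Cst e 1 3 3 = 0"
      "Cst e 2 3 0 = 0" "Cst e 2 3 1 = - s" "Cst e 2 3 2 = 0" "Cst e 2 3 3 = 0"
  shows "lie_algebra_isomorphic_su2_R A"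
proof -
  note li = e_li[OF e] and vf = e_vf[OF e]
  define x where "x X i = g X (e i) 0" for X i
  have x_add: "x (X + Y) i = x X i + x Y i" if "X \<in> LI" "Y \<in> LI" for X Y i
    using that by (simp add: x_def g_add li_vf vf)
  have x_scale: "x ((\<lambda>_. c) \<odot> X) i = c * x X i" if "X \<in> LI" for X c i
    using that by (simp add: x_def g_scale li_vf vf sf_const)
  have x_sum: "x (\<Sum>i<4. (\<lambda>_. y i) \<odot> e i) j = y j" if "j < 4" for y j
  proof -
    have "x (\<Sum>i<4. (\<lambda>_. y i) \<odot> e i) j = (\<Sum>i<4. y i * g (e i) (e j) 0)"
      unfolding x_def by (subst g_sum) (simp_all add: vf_cscale vf g_scale sf_const)
    also have "\<dots> = (\<Sum>i<4. if j = i then y i else 0)"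
      by (intro sum.cong) (auto simp: g_e_e[OF e] that)
    finally show ?thesis using that by simp
  qed
  have diag: "Cst e i i k = 0" for i k using C_antisym[of i i k] by simp
  have bracket: "x (lie_bracket X Y) k = (\<Sum>i<4. \<Sum>j<4. x X i * x Y j * Cst e i j k)"
    if X: "X \<in> LI" and Y: "Y \<in> LI" for X Y k
  proof -
    have 1: "x (lie_bracket U V) k = (\<Sum>i<4. x U i * x (lie_bracket (e i) V) k)" if "U \<in> LI" "V \<in> LI" for U V
      unfolding x_def
      by (rule li_functional_expand[OF e])
        (simp_all add: that bracket_add bracket_cscale vf g_add g_scale li_vf sf_const vf_bracket del: fun_ops)
    have 2: "x (lie_bracket U V) k = - x (lie_bracket V U) k" if "U \<in> LI" "V \<in> LI" for U V
    proof -
      have "g (lie_bracket U V) (e k) 0 = g (- lie_bracket V U) (e k) 0"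
        using lie_bracket_antisym[of U V] by simp
      then show ?thesis using that by (simp add: x_def g_uminus vf_bracket li_vf vf del: fun_ops)
    qed
    have "x (lie_bracket (e i) Y) k = (\<Sum>j<4. x Y j * Cst e i j k)" for i
      unfolding 2[OF li Y] 1[OF Y li] unfolding x_def[of "lie_bracket _ _"] Cst_def[symmetric]
      using C_antisym[of i] by (simp add: sum_negf flip: sum_negf)
    then show ?thesis using 1[OF X Y] by (simp add: sum_distrib_left mult.assoc)
  qed
  \<comment> \<open>The coefficient of \<open>e 1\<close> once \<open>e 0\<close> has been replaced
    by the central element.\<close>
  define z where "z X = x X 1 - f / s * x X 0" for X
  have B: "x (lie_bracket X Y) 0 = 0" "z (lie_bracket X Y) = - s * (x X 2 * x Y 3 - x X 3 * x Y 2)"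
    "x (lie_bracket X Y) 2 = - s * (x X 3 * z Y - z X * x Y 3)"
    "x (lie_bracket X Y) 3 = - s * (z X * x Y 2 - x X 2 * z Y)" if "X \<in> LI" "Y \<in> LI" for X Y
    using s C_antisym[of 1 0] C_antisym[of 2 0] C_antisym[of 3 0] C_antisym[of 2 1] C_antisym[of 3 1] C_antisym[of 3 2]
    by (simp_all add: z_def bracket that sum_lessThan_4 diag C field_simps del: One_nat_def)
  \<comment> \<open>From \<open>[e 1, e 2] = - s e 3\<close> and its cyclic versions, dividing
    \<open>e i\<close> by \<open>- s\<close> gives the standard basis of su(2), so components are
    multiplied by \<open>- s\<close>.\<close>
  define \<Phi> where "\<Phi> X = (su2_of (- s * z X) (- s * x X 2) (- s * x X 3), x X 0)" for X
  have "inj_on \<Phi> LI"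
  proof (rule inj_onI)
    fix X Y assume XY: "X \<in> LI" "Y \<in> LI" "\<Phi> X = \<Phi> Y"
    then have "x X 0 = x Y 0 \<and> x X 1 = x Y 1 \<and> x X 2 = x Y 2 \<and> x X 3 = x Y 3"
      using s by (auto simp: \<Phi>_def su2_of_inj z_def)
    then have "x X i = x Y i" if "i < 4" for i using less_4_cases[OF that] by auto
    then show "X = Y"
      using li_expand[OF e XY(1)] li_expand[OF e XY(2)] by (simp add: x_def)
  qed
  moreover have "\<Phi> ` LI = su2 \<times> UNIV"
  proof
    show "\<Phi> ` LI \<subseteq> su2 \<times> UNIV" by (auto simp: \<Phi>_def su2_of_mem)
    show "su2 \<times> UNIV \<subseteq> \<Phi> ` LI"
    proof
      fix M :: "(complex^2^2) \<times> real" assume "M \<in> su2 \<times> UNIV"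
      then obtain a b c t where M: "M = (su2_of a b c, t)"
        using su2_of_surj by (metis mem_Sigma_iff prod.collapse)
      define y where "y i = (if i = 0 then t else if i = 1 then - a / s + f / s * t else if i = 2 then - b / s else - c / s)"
        for i :: nat
      have y: "y 0 = t" "y 1 = - a / s + f / s * t" "y 2 = - b / s" "y 3 = - c / s" by (simp_all add: y_def)
      let ?X = "\<Sum>i<4. (\<lambda>_. y i) \<odot> e i"
      have "\<Phi> ?X = M"
        using s by (simp add: \<Phi>_def M z_def x_sum y del: One_nat_def)
      moreover have "?X \<in> LI" by (intro li_sum li_cscale li)
      ultimately show "M \<in> \<Phi> ` LI" by blast
    qed
  qed
  moreover have "\<Phi> (X + Y) = \<Phi> X + \<Phi> Y" if "X \<in> LI" "Y \<in> LI" for X Y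
    by (simp add: \<Phi>_def z_def x_add that algebra_simps flip: su2_of_add)
  moreover have "\<Phi> (lie_bracket X Y) = (fst (\<Phi> X) ** fst (\<Phi> Y) - fst (\<Phi> Y) ** fst (\<Phi> X), 0)"
    if "X \<in> LI" "Y \<in> LI" for X Y
    by (simp add: \<Phi>_def su2_of_commutator B[OF that] su2_of_inj algebra_simps)
  moreover have "\<Phi> ((\<lambda>_. c) \<odot> X) = c *\<^sub>R \<Phi> X" if "X \<in> LI" for X c
    by (simp add: \<Phi>_def z_def x_scale that algebra_simps flip: su2_of_scaleR)
  ultimately show ?thesis
    unfolding lie_algebra_isomorphic_su2_R_def bij_betw_def by blast
qed

lemma classification:
  assumes skt: "SKT A J g"
    and static: "\<And>X Y p. \<lbrakk>X \<in> VF; Y \<in> VF\<rbrakk> \<Longrightarrow>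
      - part11 J (ricci_form A J g D) X Y p = lam * fundamental_form J g X Y p"
  shows "kaehler_einstein A J g \<or> (lie_algebra_isomorphic_su2_R A \<and> lam = 0)"
proof -
  obtain e where ad: "adapted e" and tr3: "tr_ad_frame e (e 3) = 0"
    using adapted_normalized_ex by blast
  have e: "unitary_frame e" using ad by (simp add: adapted_def)
  show ?thesis
  proof (cases "tau (e 1) (e 2) (e 3) 0 = 0")
    case True
    then show ?thesis using kaehler_einstein_if_torsion_free[OF ad _ static] by blast
  next
    case s: False
    interpret bismut_constants "Cst e" "\<lambda>i. Gam e i 0 1" "\<lambda>i. Gam e i 0 2" "\<lambda>i. Gam e i 0 3"
      "\<lambda>i. Gam e i 2 3" "tau (e 1) (e 2) (e 3) 0"
      by (rule adapted_constants[OF ad])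
    have ric: "ric i j = ricci_const e i j" for i j
      unfolding ric_def ricci_const_def[OF e] ..
    note const = static_ricci_const[OF e static]
    have st: "ric 0 1 = ric 2 3" "ric 0 2 + ric 1 3 = 0" "ric 0 3 = ric 1 2"
      unfolding ric using const by simp_all
    note skt' = skt_const[OF skt ad s]
    have tr: "tr_ad i = tr_ad_frame e (e i)" for i
      by (simp add: tr_ad_def tr_ad_frame_def Cst_def)
    have tr3': "tr_ad 3 = 0" by (simp only: tr tr3)
    then have "tr_ad 2 = 0"
      using not_unimodular[OF s skt' st] by blast
    note vals = unimodular[OF s skt' st this tr3']
    \<comment> \<open>\<open>e 0\<close> and \<open>e 1\<close> commute, so the Ricci form, which
      depends on the bracket alone, vanishes on them; its value there is \<open>lam\<close>.\<close>
    have "ric 0 1 = 0" unfolding ric_def sum_lessThan_4 C_table vals by simp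
    then have "lam = 0" using const(1) ric by simp
    moreover have "lie_algebra_isomorphic_su2_R A"
      by (rule isomorphic_su2_R[OF e s, of "Gam e 0 2 3"])
        (rule Cst_antisym[OF e] | (unfold C_table vals, simp; fail))+
    ultimately show ?thesis by blast
  qed
qed

end

theorem theorem3p2:
  fixes A :: "('a::{group_add,t2_space,second_countable_topology}, real^4) chart set"
    and J :: "'a vfield \<Rightarrow> 'a vfield"
    and g :: "'a vfield \<Rightarrow> 'a vfield \<Rightarrow> ('a \<Rightarrow> real)"
    and lam :: real
  assumes "lie_group A"
    and "simply_connected (UNIV :: 'a set)"
    and "complex_structure A J" and "left_invariant_endo A J"
    and "hermitian_metric A J g" and "left_invariant_metric A g"
    and "static_metric A J g lam"
  shows "kaehler_einstein A J g \<or> (lie_algebra_isomorphic_su2_R A \<and> lam = 0)"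
proof -
  \<comment> \<open>The static condition itself supplies the Bismut connection on which the whole
    argument is run.\<close>
  obtain D where D: "bismut_connection A J g D" and static: "\<And>X Y p.
      \<lbrakk>X \<in> vector_fields A; Y \<in> vector_fields A\<rbrakk> \<Longrightarrow>
      - part11 J (ricci_form A J g D) X Y p = lam * fundamental_form J g X Y p"
    using assms(7) unfolding static_metric_def by blast
  interpret bismut_lie_group A J g D
    by unfold_locales (fact assms D)+
  show ?thesis
    using classification static assms(7) unfolding static_metric_def by blast
qed

end
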